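(* Let $f:U\to\mathbf{R}^3$ be a front with unit normal vector field $\nu$ that is a cuspidal edge at $p\in S(f)$, with $f(p)=\mathbf 0$, and let $f^*$ be the dual surface of $f$ with respect to a constant vector $\mathbf{c}\in\mathbf{R}^3\setminus\{\mathbf 0\}$ satisfying $\langle\nu(p),\mathbf{c}\rangle\neq0$. Let $$\tilde h(u,v)=\langle \bar f(u,v),\mathbf{n}_0\rangle-r_0,\qquad \bar f=f+\mathbf{c},\quad \mathbf{n}_0=\nu(p),\quad r_0=\langle\bar f(p),\mathbf{n}_0\rangle .$$ If the function $\tilde h$ has a $D_4$ singularity at $p$, then $f^*$ has a cuspidal edge at $p$.
   Context: All maps are $C^\infty$. A map $f:U\to\mathbf{R}^3$ ($U\subset\mathbf{R}^2$ a domain) is a front if there is a unit vector field $\nu$ along $f$ with $\langle df(X),\nu\rangle=0$ for all tangent vectors $X$ and such that $(f,\nu):U\to\mathbf{R}^3\times S^2$ is an immersion. $S(f)$ is the set of points where $f$ is not an immersion. A map is a cuspidal edge at $p$ (has a cuspidal edge at $p$) if its germ at $p$ is, up to diffeomorphism-germs of source and target, $(u,v)\mapsto(u,v^2,v^3)$ at $0$. Dual surface: with $\bar f=f+\mathbf{c}$ and $\rho=\langle\bar f,\nu\rangle$, $f^*(u,v)=\rho(u,v)\,\nu(u,v)$. A function-germ has a $D_4$ singularity at $p$ if it is right equivalent (i.e. equal up to composition with a diffeomorphism-germ of the source) to $u^3+uv^2$ or to $u^3-uv^2$ at $\mathbf 0$. *)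

theory Defs
  imports "HOL-Analysis.Analysis"
begin

text \<open>Maps on a domain are total functions whose values off the domain are irrelevant.
  All smoothness notions below are meant for open sets \<open>S\<close> in finite-dimensional spaces: there the
  condition for \<open>k\<close> says that \<open>f\<close> is of class \<open>C\<^sup>k\<close>, all iterated directional derivatives up to order \<open>k\<close> being
  continuous.\<close>

primrec Ck_on :: "nat \<Rightarrow> ('a::real_normed_vector \<Rightarrow> 'b::real_normed_vector) \<Rightarrow> 'a set \<Rightarrow> bool"
  where
    "Ck_on 0 f S \<longleftrightarrow> continuous_on S f"
  | "Ck_on (Suc k) f S \<longleftrightarrow> (\<forall>x\<in>S. f differentiable (at x)) \<and>
       (\<forall>v. Ck_on k (\<lambda>x. frechet_derivative f (at x) v) S)"

definition smooth_on :: "('a::real_normed_vector \<Rightarrow> 'b::real_normed_vector) \<Rightarrow> 'a set \<Rightarrow> bool"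
  where "smooth_on f S \<longleftrightarrow> (\<forall>k. Ck_on k f S)"

definition immersion_at ::
    "('a::real_normed_vector \<Rightarrow> 'b::real_normed_vector) \<Rightarrow> 'a \<Rightarrow> bool"
  where "immersion_at f x \<longleftrightarrow> f differentiable (at x) \<and> inj (frechet_derivative f (at x))"

text \<open>\<open>(f, \<nu>)\<close> takes values in \<open>\<real>\<^sup>3 \<times> S\<^sup>2\<close>; being an immersion into this submanifold is
  the same as being an immersion into the ambient space.\<close>

definition front_with_normal ::
    "(real^2) set \<Rightarrow> (real^2 \<Rightarrow> real^3) \<Rightarrow> (real^2 \<Rightarrow> real^3) \<Rightarrow> bool"
  where "front_with_normal U f \<nu> \<longleftrightarrow>
    open U \<and> connected U \<and> U \<noteq> {} \<and>
    smooth_on f U \<and> smooth_on \<nu> U \<and>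
    (\<forall>x\<in>U. norm (\<nu> x) = 1) \<and>
    (\<forall>x\<in>U. \<forall>X. frechet_derivative f (at x) X \<bullet> \<nu> x = 0) \<and>
    (\<forall>x\<in>U. immersion_at (\<lambda>y. (f y, \<nu> y)) x)"

definition singular_set :: "(real^2) set \<Rightarrow> (real^2 \<Rightarrow> real^3) \<Rightarrow> (real^2) set"
  where "singular_set U f = {x \<in> U. \<not> immersion_at f x}"

definition diffeo_germ ::
    "('a::real_normed_vector \<Rightarrow> 'b::real_normed_vector) \<Rightarrow> 'a \<Rightarrow> 'b \<Rightarrow> bool"
  where "diffeo_germ \<phi> p q \<longleftrightarrow> \<phi> p = q \<and>
    (\<exists>V W \<psi>. open V \<and> open W \<and> p \<in> V \<and> homeomorphism V W \<phi> \<psi> \<and>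
       smooth_on \<phi> V \<and> smooth_on \<psi> W)"

text \<open>Equivalence of the germ of \<open>f\<close> at \<open>p\<close> and the germ of \<open>g\<close> at \<open>q\<close>, up to diffeomorphism-germs
  of source and target, respectively of the source only. In \<open>germ_equiv\<close> the map \<open>f\<close> is understood to be continuous
  near \<open>p\<close>, so that only the values of \<open>\<Phi>\<close> near \<open>f p\<close> matter.\<close>

definition germ_equiv ::
    "('a::real_normed_vector \<Rightarrow> 'b::real_normed_vector) \<Rightarrow> 'a \<Rightarrow> ('a \<Rightarrow> 'b) \<Rightarrow> 'a \<Rightarrow> bool"
  where "germ_equiv f p g q \<longleftrightarrow>
    (\<exists>\<phi> \<Phi>. diffeo_germ \<phi> p q \<and> diffeo_germ \<Phi> (f p) (g q) \<and>
       (\<forall>\<^sub>F x in nhds p. \<Phi> (f x) = g (\<phi> x)))"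

definition right_equiv ::
    "('a::real_normed_vector \<Rightarrow> 'b) \<Rightarrow> 'a \<Rightarrow> ('a \<Rightarrow> 'b) \<Rightarrow> 'a \<Rightarrow> bool"
  where "right_equiv f p g q \<longleftrightarrow>
    (\<exists>\<phi>. diffeo_germ \<phi> p q \<and> (\<forall>\<^sub>F x in nhds p. f x = g (\<phi> x)))"

definition cuspidal_edge_at :: "(real^2 \<Rightarrow> real^3) \<Rightarrow> real^2 \<Rightarrow> bool"
  where "cuspidal_edge_at f p \<longleftrightarrow>
    germ_equiv f p (\<lambda>x. vector [x $ 1, (x $ 2)^2, (x $ 2)^3]) 0"

definition D4_singularity_at :: "(real^2 \<Rightarrow> real) \<Rightarrow> real^2 \<Rightarrow> bool"
  where "D4_singularity_at h p \<longleftrightarrow>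
    right_equiv h p (\<lambda>x. (x $ 1)^3 + x $ 1 * (x $ 2)^2) 0 \<or>
    right_equiv h p (\<lambda>x. (x $ 1)^3 - x $ 1 * (x $ 2)^2) 0"

definition dual_surface ::
    "(real^2 \<Rightarrow> real^3) \<Rightarrow> (real^2 \<Rightarrow> real^3) \<Rightarrow> real^3 \<Rightarrow> real^2 \<Rightarrow> real^3"
  where "dual_surface f \<nu> c x = ((f x + c) \<bullet> \<nu> x) *\<^sub>R \<nu> x"

end

theory Submission
  imports Defs
begin

text \<open>
  At a cuspidal edge the differential of \<open>f\<close> has rank one.  Let \<open>\<xi>\<close> span the kernel of
  \<open>df(p)\<close>, let \<open>e\<close> be a unit vector spanning its image, and complete \<open>e\<close> and \<open>n = \<nu>(p)\<close> by
  \<open>e' = n \<times> e\<close> to an orthonormal frame.  Write \<open>a\<close>, \<open>b\<close>, \<open>w\<close> for the components of \<open>f\<close> along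
  \<open>e\<close>, \<open>e'\<close>, \<open>n\<close>, and \<open>\<nu> = \<gamma> (n - s e - t e')\<close>.  That \<open>\<nu>\<close> is normal to \<open>f\<close> means
  \<open>dw = s da + t db\<close>, so \<open>k = s a + t b - w\<close>, the Legendre transform, satisfies \<open>dk = a ds + b dt\<close>.  The dual
  surface is the image of \<open>(t, s, k)\<close> under a fixed map of \<open>\<real>\<^sup>3\<close> with an explicit smooth inverse
  (\<open>pedal_chart_inverse\<close>; this is where \<open>\<langle>\<nu>(p), c\<rangle> \<noteq> 0\<close> enters), so \<open>(t, s, k)\<close> may be studied instead.

  By the symmetry of the second fundamental form, \<open>d\<nu>(\<xi>)\<close> is orthogonal to \<open>e\<close> as well as to \<open>n\<close>, and it is
  nonzero because \<open>(f, \<nu>)\<close> is an immersion (\<open>front_kernel_derivative_normal\<close>).  Hence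
  \<open>dt(\<xi>) \<noteq> 0 = da(\<xi>)\<close>, and \<open>(u, t)\<close> with \<open>u = a\<close> are coordinates at \<open>p\<close>.  In them, \<open>s\<close> and \<open>k\<close> become
  functions \<open>S\<close> and \<open>K\<close> with \<open>\<partial>K/\<partial>u = u \<partial>S/\<partial>u\<close>.  For such a pair, \<open>(t, S, K)\<close> is a cuspidal edge as soon as
  \<open>\<partial>S/\<partial>u = 0\<close> and \<open>\<partial>\<^sup>2S/\<partial>u\<^sup>2 \<noteq> 0\<close> at the origin (\<open>cuspidal_edge_normal_form\<close>).  The two conditions are what
  the \<open>D\<^sub>4\<close> singularity provides: for \<open>t = 0\<close> the gradient of \<open>w\<close> with respect to \<open>(u, t)\<close> is \<open>(S, 0)\<close>, while
  the gradient of \<open>X\<^sup>3 \<plusminus> X Y\<^sup>2\<close> is a quadratic map that vanishes at the origin only, so that \<open>S(u, 0)\<close> has a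
  zero of order exactly two (\<open>D4_second_order_zero\<close>).

  For the normal form, \<open>S\<close> is brought to \<open>C(t) \<plusminus> u\<^sup>2\<close> by a change of the coordinate \<open>u\<close>, and then \<open>K\<close> is
  written as \<open>A(u\<^sup>2, t) + u B(u\<^sup>2, t)\<close> with smooth \<open>A\<close> and \<open>B\<close>.  The relation between \<open>S\<close> and \<open>K\<close> forces \<open>B\<close>
  to be \<open>u\<^sup>2\<close> times a function \<open>Q(u\<^sup>2, t)\<close> with \<open>Q(0, 0) \<noteq> 0\<close>, and the target coordinate change
  \<open>(t, S, K) \<mapsto> (t, \<plusminus> (S - C), (K - A) / Q)\<close> ends in \<open>(t, u\<^sup>2, u\<^sup>3)\<close>.

  The analytic core is Whitney's theorem that a smooth even function of \<open>u\<close> is a smooth function of \<open>u\<^sup>2\<close>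
  (\<open>whitney_even\<close>).  The function of \<open>u\<^sup>2\<close> has to be defined on both sides of \<open>0\<close>, since a diffeomorphism of the
  target is wanted; it is extended to negative arguments, following Seeley, as an infinite
  combination of reflected and dilated copies of itself.
\<close>

section \<open>Calculus of smooth maps\<close>

lemma Ck_on_cong:
  assumes "open S" "\<And>x. x \<in> S \<Longrightarrow> f x = g x"
  shows "Ck_on k f S \<longleftrightarrow> Ck_on k g S"
  using assms(2)
proof (induction k arbitrary: f g)
  case 0
  then show ?case by (simp cong: continuous_on_cong)
next
  case (Suc k)
  have *: "(f has_derivative D) (at x) \<longleftrightarrow> (g has_derivative D) (at x)" if "x \<in> S" for x D
    using has_derivative_transform_within_open[OF _ \<open>open S\<close> that, of f D UNIV g]
      has_derivative_transform_within_open[OF _ \<open>open S\<close> that, of g D UNIV f] Suc.prems by auto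
  have "frechet_derivative f (at x) = frechet_derivative g (at x)" if "x \<in> S" for x
    by (simp add: frechet_derivative_def *[OF that])
  then have "Ck_on k (\<lambda>x. frechet_derivative f (at x) v) S
      \<longleftrightarrow> Ck_on k (\<lambda>x. frechet_derivative g (at x) v) S" for v
    by (intro Suc.IH) simp
  then show ?case
    using * by (simp add: differentiable_def)
qed

lemma Ck_on_SucI:
  assumes "open S" "\<And>x. x \<in> S \<Longrightarrow> (f has_derivative f' x) (at x)"
    and "\<And>v. Ck_on k (\<lambda>x. f' x v) S"
  shows "Ck_on (Suc k) f S"
proof -
  have "frechet_derivative f (at x) = f' x" if "x \<in> S" for x
    using frechet_derivative_at[OF assms(2)[OF that]] by simp
  then have "Ck_on k (\<lambda>x. frechet_derivative f (at x) v) S" for v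
    using assms(3)[of v] by (subst Ck_on_cong[OF \<open>open S\<close>]) auto
  then show ?thesis
    using assms(2) by (auto simp: differentiable_def)
qed

lemma Ck_on_SucD:
  assumes "Ck_on (Suc k) f S"
  shows "x \<in> S \<Longrightarrow> (f has_derivative frechet_derivative f (at x)) (at x)"
    and "Ck_on k (\<lambda>x. frechet_derivative f (at x) v) S"
  using assms frechet_derivative_works by auto

lemma Ck_on_SucD': "Ck_on (Suc k) f S \<Longrightarrow> Ck_on k f S"
proof (induction k arbitrary: f)
  case 0
  then show ?case
    by (auto intro!: differentiable_imp_continuous_on
        simp: differentiable_on_def differentiable_at_withinI)
next
  case (Suc k)
  then show ?case
    by (metis Ck_on.simps(2))
qed

lemma Ck_on_subset: "Ck_on k f S \<Longrightarrow> T \<subseteq> S \<Longrightarrow> Ck_on k f T"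
  by (induction k arbitrary: f) (auto intro: continuous_on_subset)

lemma Ck_on_const: "Ck_on k (\<lambda>x. c) S"
  by (induction k arbitrary: c) auto

lemma Ck_on_bounded_linear:
  assumes "open S" "bounded_linear L"
  shows "Ck_on k L S"
proof (cases k)
  case 0
  then show ?thesis
    using assms by (simp add: linear_continuous_on)
next
  case (Suc j)
  then show ?thesis
    using Ck_on_SucI[OF \<open>open S\<close> bounded_linear_imp_has_derivative[OF assms(2)] Ck_on_const] by simp
qed

lemma Ck_on_add:
  assumes "open S" "Ck_on k f S" "Ck_on k g S"
  shows "Ck_on k (\<lambda>x. f x + g x) S"
  using assms(2,3)
proof (induction k arbitrary: f g)
  case 0
  then show ?case by (simp add: continuous_on_add)
next
  case (Suc k)
  note D = Ck_on_SucD[OF Suc.prems(1)] Ck_on_SucD[OF Suc.prems(2)]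
  show ?case
    by (rule Ck_on_SucI[OF \<open>open S\<close> has_derivative_add[OF D(1) D(3)]]) (auto intro: Suc.IH D)
qed

lemma Ck_on_sum:
  assumes "open S" "\<And>i. i \<in> I \<Longrightarrow> Ck_on k (f i) S"
  shows "Ck_on k (\<lambda>x. \<Sum>i\<in>I. f i x) S"
  using assms(2)
  by (induction I rule: infinite_finite_induct) (auto intro: Ck_on_add[OF \<open>open S\<close>] Ck_on_const)

lemma Ck_on_bounded_bilinear:
  assumes "open S" "bounded_bilinear B" "Ck_on k f S" "Ck_on k g S"
  shows "Ck_on k (\<lambda>x. B (f x) (g x)) S"
  using assms(3,4)
proof (induction k arbitrary: f g)
  case 0
  then show ?case by (simp add: bounded_bilinear.continuous_on[OF assms(2)])
next
  case (Suc k)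
  note D = Ck_on_SucD[OF Suc.prems(1)] Ck_on_SucD[OF Suc.prems(2)]
  show ?case
    by (rule Ck_on_SucI[OF \<open>open S\<close> bounded_bilinear.FDERIV[OF assms(2) D(1) D(3)]])
      (auto intro!: Ck_on_add Suc.IH D \<open>open S\<close> Suc.prems[THEN Ck_on_SucD'])
qed

text \<open>The chain rule expresses the derivative of a composite through the coordinates of the
  derivative of the inner map, so that the induction over the order of differentiability only needs
  sums, products and composites of lower order.\<close>

lemma Ck_on_compose:
  fixes f :: "'a::real_normed_vector \<Rightarrow> 'b::euclidean_space"
    and g :: "'b \<Rightarrow> 'c::real_normed_vector"
  assumes "open S" "open T" "Ck_on k f S" "Ck_on k g T" "f ` S \<subseteq> T"
  shows "Ck_on k (\<lambda>x. g (f x)) S"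
  using assms(3,4)
proof (induction k arbitrary: g)
  case 0
  then show ?case
    using continuous_on_compose2 assms(5) by auto
next
  case (Suc k)
  note D = Ck_on_SucD[OF Suc.prems(1)] Ck_on_SucD[OF Suc.prems(2)]
  define D' where "D' x v = (\<Sum>b\<in>Basis. (frechet_derivative f (at x) v \<bullet> b) *\<^sub>R
      frechet_derivative g (at (f x)) b)" for x v
  show ?case
  proof (rule Ck_on_SucI[OF \<open>open S\<close>])
    fix x assume x: "x \<in> S"
    have fx: "f x \<in> T" using x assms(5) by blast
    interpret G: bounded_linear "frechet_derivative g (at (f x))"
      by (rule has_derivative_bounded_linear[OF D(3)[OF fx]])
    have "D' x v = frechet_derivative g (at (f x)) (\<Sum>b\<in>Basis. (frechet_derivative f (at x) v \<bullet> b) *\<^sub>R b)" for v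
      unfolding D'_def G.sum G.scaleR ..
    then have "D' x = frechet_derivative g (at (f x)) \<circ> frechet_derivative f (at x)"
      by (simp add: euclidean_representation fun_eq_iff)
    with diff_chain_at[OF D(1)[OF x] D(3)[OF fx]]
    show "((\<lambda>x. g (f x)) has_derivative D' x) (at x)"
      by (simp add: o_def)
  next
    fix v
    show "Ck_on k (\<lambda>x. D' x v) S"
      unfolding D'_def
      by (intro Ck_on_sum Ck_on_bounded_bilinear[OF _ bounded_bilinear_scaleR]
          Ck_on_bounded_bilinear[OF _ bounded_bilinear_inner] Suc.IH D Ck_on_const \<open>open S\<close>
          Suc.prems[THEN Ck_on_SucD'])
  qed
qed

subsection \<open>Smooth maps\<close>

lemma smooth_onI: "(\<And>k. Ck_on k f S) \<Longrightarrow> smooth_on f S"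
  by (simp add: smooth_on_def)

lemma smooth_on_Ck: "smooth_on f S \<Longrightarrow> Ck_on k f S"
  by (simp add: smooth_on_def)

lemma smooth_on_subset: "smooth_on f S \<Longrightarrow> T \<subseteq> S \<Longrightarrow> smooth_on f T"
  unfolding smooth_on_def using Ck_on_subset by blast

lemma smooth_on_continuous: "smooth_on f S \<Longrightarrow> continuous_on S f"
  using smooth_on_Ck[of f S 0] by simp

lemma smooth_on_has_derivative:
  "smooth_on f S \<Longrightarrow> x \<in> S \<Longrightarrow> (f has_derivative frechet_derivative f (at x)) (at x)"
  using Ck_on_SucD(1)[OF smooth_on_Ck[of f S "Suc 0"]] by blast

lemma smooth_on_derivative: "smooth_on f S \<Longrightarrow> smooth_on (\<lambda>x. frechet_derivative f (at x) v) S"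
  using Ck_on_SucD(2)[OF smooth_on_Ck] by (metis smooth_onI)

lemma smooth_on_const: "smooth_on (\<lambda>x. c) S"
  by (intro smooth_onI Ck_on_const)

lemma smooth_on_bounded_linear: "open S \<Longrightarrow> bounded_linear L \<Longrightarrow> smooth_on L S"
  by (intro smooth_onI Ck_on_bounded_linear)

lemma smooth_on_id: "open S \<Longrightarrow> smooth_on (\<lambda>x. x) S"
  by (intro smooth_on_bounded_linear bounded_linear_ident)

lemma smooth_on_compose:
  fixes f :: "'a::real_normed_vector \<Rightarrow> 'b::euclidean_space"
  assumes "smooth_on g T" "smooth_on f S" "open S" "open T" "\<And>x. x \<in> S \<Longrightarrow> f x \<in> T"
  shows "smooth_on (\<lambda>x. g (f x)) S"
  by (rule smooth_onI, rule Ck_on_compose[of S T]) (use assms in \<open>auto intro: smooth_on_Ck\<close>)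

lemma smooth_on_linear_compose:
  assumes "bounded_linear L" "smooth_on (f :: 'a::real_normed_vector \<Rightarrow> 'b::euclidean_space) S" "open S"
  shows "smooth_on (\<lambda>x. L (f x)) S"
  by (rule smooth_on_compose[OF smooth_on_bounded_linear[OF open_UNIV assms(1)] assms(2,3) open_UNIV]) simp

lemma smooth_on_bilinear:
  assumes "bounded_bilinear B" "smooth_on f S" "smooth_on g S" "open S"
  shows "smooth_on (\<lambda>x. B (f x) (g x)) S"
  by (rule smooth_onI, rule Ck_on_bounded_bilinear) (use assms in \<open>auto intro: smooth_on_Ck\<close>)

lemma smooth_on_add: "smooth_on f S \<Longrightarrow> smooth_on g S \<Longrightarrow> open S \<Longrightarrow> smooth_on (\<lambda>x. f x + g x) S"
  by (intro smooth_onI Ck_on_add) (auto intro: smooth_on_Ck)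

lemma smooth_on_sum:
  "(\<And>i. i \<in> I \<Longrightarrow> smooth_on (f i) S) \<Longrightarrow> open S \<Longrightarrow> smooth_on (\<lambda>x. \<Sum>i\<in>I. f i x) S"
  by (intro smooth_onI Ck_on_sum) (auto intro: smooth_on_Ck)

lemmas smooth_on_mult = smooth_on_bilinear[OF bounded_bilinear_mult]
lemmas smooth_on_scaleR = smooth_on_bilinear[OF bounded_bilinear_scaleR]
lemmas smooth_on_inner = smooth_on_bilinear[OF bounded_bilinear_inner]

lemma smooth_on_minus:
  fixes f :: "'a::real_normed_vector \<Rightarrow> 'b::euclidean_space"
  shows "smooth_on f S \<Longrightarrow> open S \<Longrightarrow> smooth_on (\<lambda>x. - f x) S"
  by (rule smooth_on_linear_compose[OF bounded_linear_minus[OF bounded_linear_ident]])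

lemma smooth_on_diff:
  fixes f g :: "'a::real_normed_vector \<Rightarrow> 'b::euclidean_space"
  assumes "smooth_on f S" "smooth_on g S" "open S"
  shows "smooth_on (\<lambda>x. f x - g x) S"
  using smooth_on_add[OF assms(1) smooth_on_minus[OF assms(2,3)] assms(3)] by simp

lemma smooth_on_power:
  fixes f :: "'a::real_normed_vector \<Rightarrow> real"
  shows "smooth_on f S \<Longrightarrow> open S \<Longrightarrow> smooth_on (\<lambda>x. f x ^ n) S"
  by (induction n) (auto intro: smooth_on_mult smooth_on_const)

lemma smooth_on_nth:
  "smooth_on f S \<Longrightarrow> open S \<Longrightarrow> smooth_on (\<lambda>x. (f x :: real^'n) $ i) S"
  by (rule smooth_on_linear_compose[OF bounded_linear_vec_nth])

lemma smooth_on_vec: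
  fixes f :: "'a::real_normed_vector \<Rightarrow> real^'n"
  assumes "\<And>i. smooth_on (\<lambda>x. f x $ i) S" "open S"
  shows "smooth_on f S"
proof -
  have "smooth_on (\<lambda>x. \<Sum>i\<in>UNIV. (f x $ i) *\<^sub>R (axis i 1 :: real^'n)) S"
    using assms by (intro smooth_on_sum smooth_on_scaleR smooth_on_const) auto
  moreover have "(\<Sum>i\<in>UNIV. (f x $ i) *\<^sub>R (axis i 1 :: real^'n)) = f x" for x
    using basis_expansion[of "f x"] by (simp add: scalar_mult_eq_scaleR)
  ultimately show ?thesis by simp
qed

lemma smooth_on_vector_3:
  assumes "smooth_on a S" "smooth_on b S" "smooth_on c S" "open S"
  shows "smooth_on (\<lambda>x. vector [a x, b x, c x] :: real^3) S"
proof (rule smooth_on_vec)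
  fix i :: 3
  show "smooth_on (\<lambda>x. (vector [a x, b x, c x] :: real^3) $ i) S"
    using assms exhaust_3[of i] by (auto simp: vector_3)
qed fact

lemma Ck_on_inverse_real: "Ck_on k (inverse :: real \<Rightarrow> real) (- {0})"
proof (induction k)
  case 0
  then show ?case by (auto intro!: continuous_intros)
next
  case (Suc k)
  show ?case
  proof (rule Ck_on_SucI)
    show "(inverse has_derivative (\<lambda>h. - (inverse x * h * inverse x))) (at x)"
      if "x \<in> - {0}" for x :: real
      using that by (intro has_derivative_inverse') auto
    have "Ck_on k (\<lambda>x. (inverse x * inverse x) * (- v)) (- {0::real})" for v
      by (intro Ck_on_bounded_bilinear[OF _ bounded_bilinear_mult] Suc Ck_on_const) auto
    moreover have "(\<lambda>x. (inverse x * inverse x) * (- v)) = (\<lambda>x. - (inverse x * v * inverse x))" for v :: real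
      by (simp add: fun_eq_iff)
    ultimately show "Ck_on k (\<lambda>x. - (inverse x * v * inverse x)) (- {0::real})" for v
      by simp
  qed auto
qed

lemma smooth_on_divide:
  fixes f g :: "'a::real_normed_vector \<Rightarrow> real"
  assumes "smooth_on f S" "smooth_on g S" "open S" "\<And>x. x \<in> S \<Longrightarrow> g x \<noteq> 0"
  shows "smooth_on (\<lambda>x. f x / g x) S"
proof -
  have "smooth_on (\<lambda>x. inverse (g x)) S"
    by (rule smooth_on_compose[OF smooth_onI[OF Ck_on_inverse_real] assms(2,3)]) (use assms in auto)
  from smooth_on_mult[OF assms(1) this assms(3)] show ?thesis
    by (simp add: divide_inverse)
qed

lemma Ck_on_sqrt: "Ck_on k sqrt {0<..}"
proof (induction k)
  case 0
  then show ?case by (auto intro!: continuous_intros)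
next
  case (Suc k)
  show ?case
  proof (rule Ck_on_SucI)
    show "(sqrt has_derivative (\<lambda>h. h * (inverse (sqrt x) / 2))) (at x)" if "x \<in> {0<..}" for x
    proof -
      have "(\<lambda>h. h * (inverse (sqrt x) / 2)) = (*) (inverse (sqrt x) / 2)"
        by (simp add: fun_eq_iff)
      then show ?thesis
        using DERIV_real_sqrt[of x] that by (simp only: has_field_derivative_def) simp
    qed
    have "Ck_on k (\<lambda>x. inverse (sqrt x)) {0<..}"
      by (rule Ck_on_compose[OF _ _ Suc Ck_on_inverse_real]) auto
    then have "Ck_on k (\<lambda>x. (v / 2) * inverse (sqrt x)) {0<..}" for v
      by (intro Ck_on_bounded_bilinear[OF _ bounded_bilinear_mult] Ck_on_const) auto
    then show "Ck_on k (\<lambda>x. v * (inverse (sqrt x) / 2)) {0<..}" for v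
      by (simp add: mult.commute)
  qed auto
qed

lemma smooth_on_sqrt:
  fixes f :: "'a::real_normed_vector \<Rightarrow> real"
  assumes "smooth_on f S" "open S" "\<And>x. x \<in> S \<Longrightarrow> 0 < f x"
  shows "smooth_on (\<lambda>x. sqrt (f x)) S"
  by (rule smooth_on_compose[OF smooth_onI[OF Ck_on_sqrt] assms(1,2)]) (use assms in auto)

lemmas smooth_intros = smooth_on_add smooth_on_diff smooth_on_minus smooth_on_mult smooth_on_scaleR
  smooth_on_inner smooth_on_divide smooth_on_power smooth_on_sqrt smooth_on_const smooth_on_id
  smooth_on_nth

section \<open>Diffeomorphism germs and the smooth inverse function theorem\<close>

lemma diffeo_germI:
  assumes "open V" "open W" "p \<in> V" "\<phi> p = q" "smooth_on \<phi> V" "smooth_on \<psi> W"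
    and "\<And>x. x \<in> V \<Longrightarrow> \<phi> x \<in> W \<and> \<psi> (\<phi> x) = x" "\<And>y. y \<in> W \<Longrightarrow> \<psi> y \<in> V \<and> \<phi> (\<psi> y) = y"
  shows "diffeo_germ \<phi> p q"
proof -
  have "homeomorphism V W \<phi> \<psi>"
    using assms(7,8) smooth_on_continuous[OF assms(5)] smooth_on_continuous[OF assms(6)]
    by (intro homeomorphismI) auto
  then show ?thesis
    using assms unfolding diffeo_germ_def by blast
qed

lemma diffeo_germD:
  assumes "diffeo_germ \<phi> p q"
  shows "\<exists>V W \<psi>. open V \<and> open W \<and> p \<in> V \<and> q \<in> W \<and> \<phi> p = q \<and> \<psi> q = p \<and>
    smooth_on \<phi> V \<and> smooth_on \<psi> W \<and> (\<forall>x\<in>V. \<phi> x \<in> W \<and> \<psi> (\<phi> x) = x) \<and>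
    (\<forall>y\<in>W. \<psi> y \<in> V \<and> \<phi> (\<psi> y) = y)"
proof -
  obtain V W \<psi> where *: "\<phi> p = q" "open V" "open W" "p \<in> V" "homeomorphism V W \<phi> \<psi>"
    "smooth_on \<phi> V" "smooth_on \<psi> W"
    using assms unfolding diffeo_germ_def by blast
  then have "\<phi> ` V = W" "\<psi> ` W = V" "\<forall>x\<in>V. \<psi> (\<phi> x) = x" "\<forall>y\<in>W. \<phi> (\<psi> y) = y"
    by (auto simp: homeomorphism_def)
  with * show ?thesis
    by (intro exI[of _ V] exI[of _ W] exI[of _ \<psi>]) auto
qed

lemma diffeo_germ_compose:
  fixes \<phi> :: "'a::real_normed_vector \<Rightarrow> 'b::euclidean_space"
    and \<theta> :: "'b \<Rightarrow> 'c::euclidean_space"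
  assumes "diffeo_germ \<phi> p q" "diffeo_germ \<theta> q r"
  shows "diffeo_germ (\<lambda>x. \<theta> (\<phi> x)) p r"
proof -
  obtain V W \<psi> where 1: "open V" "open W" "p \<in> V" "q \<in> W" "\<phi> p = q" "\<psi> q = p"
    "smooth_on \<phi> V" "smooth_on \<psi> W" "\<forall>x\<in>V. \<phi> x \<in> W \<and> \<psi> (\<phi> x) = x"
    "\<forall>y\<in>W. \<psi> y \<in> V \<and> \<phi> (\<psi> y) = y"
    using diffeo_germD[OF assms(1)] by blast
  obtain V' W' \<psi>' where 2: "open V'" "open W'" "q \<in> V'" "r \<in> W'" "\<theta> q = r" "\<psi>' r = q"
    "smooth_on \<theta> V'" "smooth_on \<psi>' W'" "\<forall>x\<in>V'. \<theta> x \<in> W' \<and> \<psi>' (\<theta> x) = x"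
    "\<forall>y\<in>W'. \<psi>' y \<in> V' \<and> \<theta> (\<psi>' y) = y"
    using diffeo_germD[OF assms(2)] by blast
  define A where "A = V \<inter> \<phi> -` V'"
  define B where "B = W' \<inter> \<psi>' -` W"
  have A: "open A"
    unfolding A_def using continuous_open_preimage[OF smooth_on_continuous[OF 1(7)] 1(1) 2(1)] .
  have B: "open B"
    unfolding B_def using continuous_open_preimage[OF smooth_on_continuous[OF 2(8)] 2(2) 1(2)] .
  show ?thesis
  proof (rule diffeo_germI[OF A B])
    show "smooth_on (\<lambda>x. \<theta> (\<phi> x)) A"
      by (rule smooth_on_compose[OF 2(7) smooth_on_subset[OF 1(7)] A 2(1)]) (auto simp: A_def)
    show "smooth_on (\<lambda>y. \<psi> (\<psi>' y)) B"
      by (rule smooth_on_compose[OF 1(8) smooth_on_subset[OF 2(8)] B 1(2)]) (auto simp: B_def)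
  qed (use 1 2 in \<open>auto simp: A_def B_def\<close>)
qed

lemma diffeo_germ_inverse:
  assumes "diffeo_germ \<phi> p q"
  shows "\<exists>\<psi>. diffeo_germ \<psi> q p \<and> (\<forall>\<^sub>F x in nhds p. \<psi> (\<phi> x) = x) \<and> (\<forall>\<^sub>F y in nhds q. \<phi> (\<psi> y) = y)"
proof -
  obtain V W \<psi> where *: "open V" "open W" "p \<in> V" "q \<in> W" "\<phi> p = q" "\<psi> q = p"
    "smooth_on \<phi> V" "smooth_on \<psi> W" "\<forall>x\<in>V. \<phi> x \<in> W \<and> \<psi> (\<phi> x) = x"
    "\<forall>y\<in>W. \<psi> y \<in> V \<and> \<phi> (\<psi> y) = y"
    using diffeo_germD[OF assms] by blast
  have "diffeo_germ \<psi> q p"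
    using * by (intro diffeo_germI[of W V q \<psi> p \<phi>]) auto
  moreover have "\<forall>\<^sub>F x in nhds p. \<psi> (\<phi> x) = x" "\<forall>\<^sub>F y in nhds q. \<phi> (\<psi> y) = y"
    using * by (auto simp: eventually_nhds)
  ultimately show ?thesis by blast
qed

lemma diffeo_germ_bij_derivative:
  fixes \<phi> :: "'a::euclidean_space \<Rightarrow> 'b::euclidean_space"
  assumes "diffeo_germ \<phi> p q"
  shows "(\<phi> has_derivative frechet_derivative \<phi> (at p)) (at p)" "bij (frechet_derivative \<phi> (at p))"
proof -
  obtain V W \<psi> where *: "open V" "open W" "p \<in> V" "q \<in> W" "\<phi> p = q" "\<psi> q = p"
    "smooth_on \<phi> V" "smooth_on \<psi> W" "\<forall>x\<in>V. \<phi> x \<in> W \<and> \<psi> (\<phi> x) = x"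
    "\<forall>y\<in>W. \<psi> y \<in> V \<and> \<phi> (\<psi> y) = y"
    using diffeo_germD[OF assms] by blast
  show D\<phi>: "(\<phi> has_derivative frechet_derivative \<phi> (at p)) (at p)"
    by (rule smooth_on_has_derivative[OF *(7,3)])
  have D\<psi>: "(\<psi> has_derivative frechet_derivative \<psi> (at q)) (at q)"
    by (rule smooth_on_has_derivative[OF *(8,4)])
  have "((\<psi> \<circ> \<phi>) has_derivative frechet_derivative \<psi> (at q) \<circ> frechet_derivative \<phi> (at p)) (at p)"
    by (rule diff_chain_at[OF D\<phi>]) (simp add: *(5) D\<psi>)
  moreover have "((\<psi> \<circ> \<phi>) has_derivative id) (at p)"
    by (rule has_derivative_transform_within_open[OF has_derivative_id *(1,3)]) (use *(9) in simp)
  ultimately have 1: "frechet_derivative \<psi> (at q) \<circ> frechet_derivative \<phi> (at p) = id"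
    by (rule has_derivative_unique)
  have "((\<phi> \<circ> \<psi>) has_derivative frechet_derivative \<phi> (at p) \<circ> frechet_derivative \<psi> (at q)) (at q)"
    by (rule diff_chain_at[OF D\<psi>]) (simp add: *(6) D\<phi>)
  moreover have "((\<phi> \<circ> \<psi>) has_derivative id) (at q)"
    by (rule has_derivative_transform_within_open[OF has_derivative_id *(2,4)]) (use *(10) in simp)
  ultimately have 2: "frechet_derivative \<phi> (at p) \<circ> frechet_derivative \<psi> (at q) = id"
    by (rule has_derivative_unique)
  show "bij (frechet_derivative \<phi> (at p))"
    using 1 2 by (rule o_bij)
qed

lemma diffeo_germ_filterlim:
  fixes \<phi> :: "'a::real_normed_vector \<Rightarrow> 'b::real_normed_vector"
  assumes "diffeo_germ \<phi> p q"
  shows "filterlim \<phi> (nhds q) (nhds p)"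
proof -
  obtain V where "open V" "p \<in> V" "smooth_on \<phi> V" "\<phi> p = q"
    using diffeo_germD[OF assms] by blast
  then have "isCont \<phi> p" "\<phi> p = q"
    using smooth_on_continuous[of \<phi> V] continuous_on_eq_continuous_at[of V \<phi>] by auto
  then show ?thesis
    unfolding isCont_def tendsto_at_iff_tendsto_nhds by simp
qed

text \<open>Coordinate changes of the source are usually constructed as parametrizations, in the direction
  opposite to the one in the definition of equivalence.\<close>

lemma germ_equiv_parametrizedI:
  assumes \<psi>: "diffeo_germ \<psi> q p" and \<Phi>: "diffeo_germ \<Phi> (f p) (g q)"
    and eq: "\<forall>\<^sub>F y in nhds q. \<Phi> (f (\<psi> y)) = g y"
  shows "germ_equiv f p g q"
proof -
  obtain \<phi> where \<phi>: "diffeo_germ \<phi> p q" "\<forall>\<^sub>F x in nhds p. \<psi> (\<phi> x) = x"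
    using diffeo_germ_inverse[OF \<psi>] by blast
  have "\<forall>\<^sub>F x in nhds p. \<Phi> (f (\<psi> (\<phi> x))) = g (\<phi> x)"
    by (rule eventually_compose_filterlim[OF eq diffeo_germ_filterlim[OF \<phi>(1)]])
  with \<phi>(2) have "\<forall>\<^sub>F x in nhds p. \<Phi> (f x) = g (\<phi> x)"
    by eventually_elim simp
  then show ?thesis
    unfolding germ_equiv_def using \<phi>(1) \<Phi> by blast
qed

lemma germ_equiv_trans:
  fixes f :: "'a::euclidean_space \<Rightarrow> 'b::euclidean_space"
  assumes "germ_equiv f p g q" "germ_equiv g q h r"
  shows "germ_equiv f p h r"
proof -
  obtain \<phi> \<Phi> where 1: "diffeo_germ \<phi> p q" "diffeo_germ \<Phi> (f p) (g q)"
    "\<forall>\<^sub>F x in nhds p. \<Phi> (f x) = g (\<phi> x)"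
    using assms(1) unfolding germ_equiv_def by blast
  obtain \<phi>' \<Phi>' where 2: "diffeo_germ \<phi>' q r" "diffeo_germ \<Phi>' (g q) (h r)"
    "\<forall>\<^sub>F x in nhds q. \<Phi>' (g x) = h (\<phi>' x)"
    using assms(2) unfolding germ_equiv_def by blast
  have "\<forall>\<^sub>F x in nhds p. \<Phi>' (g (\<phi> x)) = h (\<phi>' (\<phi> x))"
    by (rule eventually_compose_filterlim[OF 2(3) diffeo_germ_filterlim[OF 1(1)]])
  then have "\<forall>\<^sub>F x in nhds p. \<Phi>' (\<Phi> (f x)) = h (\<phi>' (\<phi> x))"
    using 1(3) by eventually_elim simp
  then show ?thesis
    unfolding germ_equiv_def
    using diffeo_germ_compose[OF 1(1) 2(1)] diffeo_germ_compose[OF 1(2) 2(2)]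
    by (intro exI[of _ "\<lambda>x. \<phi>' (\<phi> x)"] exI[of _ "\<lambda>x. \<Phi>' (\<Phi> x)"]) auto
qed

text \<open>A local inverse inherits smoothness by induction on the order: by Cramer's rule, the entries of
  its derivative are rational in the entries of the derivative of the given map, taken at the values
  of the inverse.\<close>

theorem smooth_inverse_function:
  fixes f :: "real^'n \<Rightarrow> real^'n"
  assumes S: "open S" "p \<in> S" and f: "smooth_on f S" and "surj (frechet_derivative f (at p))"
  shows "diffeo_germ f p (f p)"
proof -
  let ?D = "\<lambda>x. frechet_derivative f (at x)"
  note D = smooth_on_has_derivative[OF f]
  have lin: "bounded_linear (?D x)" if "x \<in> S" for x
    using D[OF that] has_derivative_bounded_linear by blast
  define f' where "f' x = Blinfun (?D x)" for x
  have f'_apply: "blinfun_apply (f' x) = ?D x" if "x \<in> S" for x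
    unfolding f'_def using lin[OF that] by (rule bounded_linear_Blinfun_apply)
  have "continuous_on S f'"
  proof (rule continuous_on_blinfun_componentwise)
    fix i :: "real^'n" assume "i \<in> Basis"
    have "continuous_on S (\<lambda>x. ?D x i)"
      using smooth_on_continuous[OF smooth_on_derivative[OF f]] .
    then show "continuous_on S (\<lambda>x. f' x i)"
      by (simp add: f'_apply cong: continuous_on_cong)
  qed
  moreover obtain g where g: "linear g" "g \<circ> ?D p = id"
    using linear_surjective_isomorphism[OF bounded_linear.linear[OF lin[OF S(2)]] assms(4)]
    by (auto simp: fun_eq_iff)
  have "Blinfun g o\<^sub>L f' p = id_blinfun"
    using g linear_conv_bounded_linear[of g]
    by (intro blinfun_eqI) (simp add: f'_apply[OF S(2)] bounded_linear_Blinfun_apply fun_eq_iff)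
  ultimately obtain V W h h' where VW: "open V" "V \<subseteq> S" "p \<in> V" "open W" "f p \<in> W"
    and hom: "homeomorphism V W f h" and h: "\<And>y. y \<in> W \<Longrightarrow> (h has_derivative h' y) (at y)"
    and h': "\<And>y. y \<in> W \<Longrightarrow> h' y = inv (blinfun_apply (f' (h y)))"
    and bij: "\<And>y. y \<in> W \<Longrightarrow> bij (blinfun_apply (f' (h y)))"
    using inverse_function_theorem[OF S(1), of f f' p "Blinfun g"] D f'_apply S(2) by metis
  have hW: "h y \<in> V" "f (h y) = y" if "y \<in> W" for y
    using hom that by (auto simp: homeomorphism_def)
  have fV: "f x \<in> W" "h (f x) = x" if "x \<in> V" for x
    using hom that by (auto simp: homeomorphism_def)
  define M where "M y = matrix (?D (h y))" for y
  have M: "h' y v = (\<chi> k. det (\<chi> i j. if j = k then v $ i else M y $ i $ j) / det (M y))"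
    and M0: "det (M y) \<noteq> 0" if y: "y \<in> W" for y v
  proof -
    have hS: "h y \<in> S" using hW(1)[OF y] VW(2) by blast
    have linD: "linear (?D (h y))" using lin[OF hS] bounded_linear.linear by blast
    have b: "bij (?D (h y))" using bij[OF y] f'_apply[OF hS] by simp
    show d: "det (M y) \<noteq> 0"
      unfolding M_def using det_nz_iff_inj[OF linD] b by (simp add: bij_def)
    have "M y *v h' y v = v"
      unfolding M_def matrix_works[OF linD[unfolded linear_matrix_vector_mul_eq[symmetric]]] h'[OF y] f'_apply[OF hS]
      using b by (simp add: bij_is_surj surj_f_inv_f)
    then show "h' y v = (\<chi> k. det (\<chi> i j. if j = k then v $ i else M y $ i $ j) / det (M y))"
      using cramer[OF d] by blast
  qed
  have "Ck_on k h W" for k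
  proof (induction k)
    case 0
    then show ?case using hom by (simp add: homeomorphism_def)
  next
    case (Suc k)
    have C_mult: "Ck_on k (\<lambda>y. a y * b y) W" if "Ck_on k a W" "Ck_on k b W" for a b :: "_ \<Rightarrow> real"
      by (rule Ck_on_bounded_bilinear[OF VW(4) bounded_bilinear_mult that])
    have C_prod: "Ck_on k (\<lambda>y. \<Prod>i\<in>I. a i y) W" if "\<And>i. Ck_on k (a i) W"
      for I :: "'n set" and a :: "'n \<Rightarrow> _ \<Rightarrow> real"
      using that by (induction I rule: infinite_finite_induct) (auto intro: C_mult Ck_on_const)
    have C_det: "Ck_on k (\<lambda>y. det (A y)) W" if "\<And>i j. Ck_on k (\<lambda>y. A y $ i $ j) W"
      for A :: "_ \<Rightarrow> real^'n^'n"
      unfolding det_def by (intro Ck_on_sum C_mult C_prod Ck_on_const that VW(4))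
    have C_M: "Ck_on k (\<lambda>y. M y $ i $ j) W" for i j
    proof -
      have "Ck_on k (\<lambda>y. ?D (h y) (axis j 1) $ i) W"
        by (rule Ck_on_compose[OF VW(4) S(1) Suc, of "\<lambda>x. ?D x (axis j 1) $ i"])
          (use hW VW in \<open>auto intro!: smooth_on_Ck smooth_on_nth smooth_on_derivative f S(1)\<close>)
      then show ?thesis
        by (simp add: M_def matrix_def)
    qed
    have C_h': "Ck_on k (\<lambda>y. h' y v) W" for v
    proof -
      let ?E = "\<lambda>y l. det (\<chi> i j. if j = l then v $ i else M y $ i $ j)"
      have "Ck_on k (\<lambda>y. (\<chi> i j. if j = l then v $ i else M y $ i $ j) $ i $ j) W" for l i j
        by (cases "j = l") (auto intro: Ck_on_const C_M)
      then have "Ck_on k (\<lambda>y. ?E y l * inverse (det (M y))) W" for l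
        by (intro C_mult C_det Ck_on_compose[OF VW(4) _ _ Ck_on_inverse_real] C_M) (auto simp: M0)
      then have "Ck_on k (\<lambda>y. \<Sum>l\<in>UNIV. (?E y l * inverse (det (M y))) *\<^sub>R axis l 1) W"
        by (intro Ck_on_sum VW(4) Ck_on_bounded_bilinear[OF _ bounded_bilinear_scaleR] Ck_on_const)
      moreover have "(\<Sum>l\<in>UNIV. (?E y l * inverse (det (M y))) *\<^sub>R axis l 1) = h' y v"
        if "y \<in> W" for y
        using basis_expansion[of "h' y v"] M[OF that, of v]
        by (simp add: scalar_mult_eq_scaleR divide_inverse)
      ultimately show ?thesis
        by (subst Ck_on_cong[OF VW(4)]) auto
    qed
    show ?case
      by (rule Ck_on_SucI[OF VW(4) h C_h'])
  qed
  then show ?thesis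
    using VW hW fV by (intro diffeo_germI[of V W p f "f p" h] smooth_onI
      smooth_on_Ck[OF smooth_on_subset[OF f]]) auto
qed

section \<open>Symmetry of second derivatives\<close>

text \<open>Two applications of the mean value theorem to the second difference, which is symmetric in the
  two directions; the symmetry of the second derivative follows as the parallelogram shrinks.\<close>

lemma second_difference_mean_value:
  fixes F :: "'a::real_normed_vector \<Rightarrow> real"
  assumes F: "smooth_on F S" and "0 < h"
    and S: "\<And>a b. a \<in> {0..h} \<Longrightarrow> b \<in> {0..h} \<Longrightarrow> p + a *\<^sub>R v + b *\<^sub>R w \<in> S"
  shows "\<exists>a\<in>{0..h}. \<exists>b\<in>{0..h}. F (p + h *\<^sub>R v + h *\<^sub>R w) - F (p + h *\<^sub>R v) - F (p + h *\<^sub>R w) + F p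
    = h * h * frechet_derivative (\<lambda>x. frechet_derivative F (at x) v) (at (p + a *\<^sub>R v + b *\<^sub>R w)) w"
proof -
  let ?G = "\<lambda>x. frechet_derivative F (at x) v"
  have chain: "((\<lambda>s. H (q + s *\<^sub>R u)) has_real_derivative frechet_derivative H (at (q + s *\<^sub>R u)) u) (at s)"
    if "smooth_on H S" "q + s *\<^sub>R u \<in> S" for H :: "'a \<Rightarrow> real" and q u s
  proof -
    note H = smooth_on_has_derivative[OF that]
    interpret bounded_linear "frechet_derivative H (at (q + s *\<^sub>R u))"
      using H by (rule has_derivative_bounded_linear)
    have "((\<lambda>s. q + s *\<^sub>R u) has_derivative (\<lambda>t. t *\<^sub>R u)) (at s)"
      by (auto intro!: derivative_eq_intros)
    from diff_chain_at[OF this H] show ?thesis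
      by (simp add: o_def scaleR has_field_derivative_def mult_commute_abs)
  qed
  let ?\<phi> = "\<lambda>s. F ((p + h *\<^sub>R w) + s *\<^sub>R v) - F (p + s *\<^sub>R v)"
  have "\<exists>a>0. a < h \<and> ?\<phi> h - ?\<phi> 0 = (h - 0) * (?G ((p + h *\<^sub>R w) + a *\<^sub>R v) - ?G (p + a *\<^sub>R v))"
  proof (rule MVT2[OF \<open>0 < h\<close>])
    fix s assume "0 \<le> s" "s \<le> h"
    then have "(p + h *\<^sub>R w) + s *\<^sub>R v \<in> S" "p + s *\<^sub>R v \<in> S"
      using S[of s h] S[of s 0] \<open>0 < h\<close> by (auto simp: algebra_simps)
    then show "(?\<phi> has_real_derivative ?G ((p + h *\<^sub>R w) + s *\<^sub>R v) - ?G (p + s *\<^sub>R v)) (at s)"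
      by (intro DERIV_diff chain F)
  qed
  then obtain a where a: "0 < a" "a < h"
    and a_eq: "?\<phi> h - ?\<phi> 0 = h * (?G ((p + h *\<^sub>R w) + a *\<^sub>R v) - ?G (p + a *\<^sub>R v))"
    by auto
  let ?\<psi> = "\<lambda>s. ?G ((p + a *\<^sub>R v) + s *\<^sub>R w)"
  have "\<exists>b>0. b < h \<and> ?\<psi> h - ?\<psi> 0 = (h - 0) * frechet_derivative ?G (at ((p + a *\<^sub>R v) + b *\<^sub>R w)) w"
  proof (rule MVT2[OF \<open>0 < h\<close>])
    fix s assume "0 \<le> s" "s \<le> h"
    then show "(?\<psi> has_real_derivative frechet_derivative ?G (at ((p + a *\<^sub>R v) + s *\<^sub>R w)) w) (at s)"
      using S[of a s] a by (intro chain smooth_on_derivative F) auto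
  qed
  then obtain b where b: "0 < b" "b < h"
    and b_eq: "?\<psi> h - ?\<psi> 0 = h * frechet_derivative ?G (at ((p + a *\<^sub>R v) + b *\<^sub>R w)) w"
    by auto
  show ?thesis
    using a b a_eq b_eq by (intro bexI[of _ a] bexI[of _ b]) (auto simp: algebra_simps)
qed

lemma second_derivative_symmetric_real:
  fixes F :: "'a::real_normed_vector \<Rightarrow> real"
  assumes "open S" "smooth_on F S" "p \<in> S"
  shows "frechet_derivative (\<lambda>x. frechet_derivative F (at x) v) (at p) w
    = frechet_derivative (\<lambda>x. frechet_derivative F (at x) w) (at p) v"
proof (rule ccontr)
  define H where "H v w x = frechet_derivative (\<lambda>x. frechet_derivative F (at x) v) (at x) w" for v w x
  assume "\<not> ?thesis"
  then have ne: "H v w p \<noteq> H w v p"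
    by (simp add: H_def)
  define e where "e = dist (H v w p) (H w v p) / 2"
  have "e > 0" using ne by (simp add: e_def)
  have cont: "isCont (H v w) p" for v w
    using smooth_on_continuous[OF smooth_on_derivative[OF smooth_on_derivative[OF assms(2)]]] assms(1,3)
    unfolding H_def by (metis continuous_on_eq_continuous_at)
  have "\<forall>\<^sub>F x in nhds p. dist (H v w x) (H v w p) < e" for v w
    using cont[of v w, unfolded isCont_def tendsto_at_iff_tendsto_nhds] \<open>e > 0\<close> by (rule tendstoD)
  then have "\<forall>\<^sub>F x in nhds p. dist (H v w x) (H v w p) < e \<and> dist (H w v x) (H w v p) < e \<and> x \<in> S"
    using assms(1,3) by (intro eventually_conj eventually_nhds_in_open) auto
  then obtain r where r: "r > 0"
    and r': "\<And>x. dist x p < r \<Longrightarrow> dist (H v w x) (H v w p) < e \<and> dist (H w v x) (H w v p) < e \<and> x \<in> S"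
    unfolding eventually_nhds_metric by blast
  define h where "h = r / (2 * (norm v + norm w + 1))"
  have den: "norm v + norm w + 1 > 0"
    by (simp add: add_nonneg_pos)
  have "h > 0" using r den by (simp add: h_def)
  have small: "dist (p + a *\<^sub>R v + b *\<^sub>R w) p < r" if "a \<in> {0..h}" "b \<in> {0..h}" for a b
  proof -
    have "dist (p + a *\<^sub>R v + b *\<^sub>R w) p \<le> a * norm v + b * norm w"
      using norm_triangle_ineq[of "a *\<^sub>R v" "b *\<^sub>R w"] that by (simp add: dist_norm add.assoc)
    also have "\<dots> \<le> h * norm v + h * norm w"
      using that by (intro add_mono mult_right_mono) auto
    also have "\<dots> \<le> h * (norm v + norm w + 1)"
      using \<open>h > 0\<close> by (simp add: algebra_simps)
    also have "\<dots> = r / 2"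
      using den by (simp add: h_def field_simps)
    finally show ?thesis using r by simp
  qed
  then have small': "dist (p + a *\<^sub>R w + b *\<^sub>R v) p < r" if "a \<in> {0..h}" "b \<in> {0..h}" for a b
    using that by (metis add.assoc add.commute)
  obtain a b where ab: "a \<in> {0..h}" "b \<in> {0..h}"
    and 1: "F (p + h *\<^sub>R v + h *\<^sub>R w) - F (p + h *\<^sub>R v) - F (p + h *\<^sub>R w) + F p = h * h * H v w (p + a *\<^sub>R v + b *\<^sub>R w)"
    using second_difference_mean_value[OF assms(2) \<open>h > 0\<close>, of p v w] small r' unfolding H_def by metis
  obtain a' b' where ab': "a' \<in> {0..h}" "b' \<in> {0..h}"
    and 2: "F (p + h *\<^sub>R w + h *\<^sub>R v) - F (p + h *\<^sub>R w) - F (p + h *\<^sub>R v) + F p = h * h * H w v (p + a' *\<^sub>R w + b' *\<^sub>R v)"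
    using second_difference_mean_value[OF assms(2) \<open>h > 0\<close>, of p w v] small' r' unfolding H_def by metis
  have "h * h * H v w (p + a *\<^sub>R v + b *\<^sub>R w) = h * h * H w v (p + a' *\<^sub>R w + b' *\<^sub>R v)"
    unfolding 1[symmetric] 2[symmetric] by (simp add: algebra_simps)
  then have "H v w (p + a *\<^sub>R v + b *\<^sub>R w) = H w v (p + a' *\<^sub>R w + b' *\<^sub>R v)"
    using \<open>h > 0\<close> by simp
  moreover have "dist (H v w (p + a *\<^sub>R v + b *\<^sub>R w)) (H v w p) < e"
    "dist (H w v (p + a' *\<^sub>R w + b' *\<^sub>R v)) (H w v p) < e"
    using r' small[OF ab] small'[OF ab'] by blast+
  ultimately show False
    using dist_triangle3[of "H v w p" "H w v p" "H v w (p + a *\<^sub>R v + b *\<^sub>R w)"]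
    unfolding e_def by simp
qed

section \<open>Functions of two variables\<close>

text \<open>Points of the plane by coordinates; as a linear combination of the axes, it inherits
  smoothness, continuity and derivatives from the coordinates.\<close>

definition pt :: "real \<Rightarrow> real \<Rightarrow> real^2"
  where "pt u t = u *\<^sub>R axis 1 1 + t *\<^sub>R axis 2 1"

lemma pt_nth [simp]: "pt u t $ 1 = u" "pt u t $ 2 = t"
  by (simp_all add: pt_def axis_def)

lemma pt_collapse [simp]: "pt (x $ 1) (x $ 2) = x"
  by (simp add: vec_eq_iff forall_2)

lemma pt_0 [simp]: "pt 0 0 = 0"
  by (simp add: pt_def)

lemma pt_eq_iff [simp]: "pt a b = pt c d \<longleftrightarrow> a = c \<and> b = d"
  by (metis pt_nth)

lemma smooth_on_pt:
  "smooth_on a S \<Longrightarrow> smooth_on b S \<Longrightarrow> open S \<Longrightarrow> smooth_on (\<lambda>x. pt (a x) (b x)) S"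
  unfolding pt_def by (intro smooth_intros)

lemma continuous_on_pt [continuous_intros]:
  "continuous_on S a \<Longrightarrow> continuous_on S b \<Longrightarrow> continuous_on S (\<lambda>x. pt (a x) (b x))"
  unfolding pt_def by (intro continuous_intros)

lemma has_derivative_pt [derivative_intros]:
  "(a has_derivative a') F \<Longrightarrow> (b has_derivative b') F \<Longrightarrow>
    ((\<lambda>x. pt (a x) (b x)) has_derivative (\<lambda>h. pt (a' h) (b' h))) F"
  unfolding pt_def by (auto intro!: derivative_eq_intros)

abbreviation pd1 :: "(real^2 \<Rightarrow> real) \<Rightarrow> real^2 \<Rightarrow> real"
  where "pd1 F x \<equiv> frechet_derivative F (at x) (axis 1 1)"

abbreviation pd2 :: "(real^2 \<Rightarrow> real) \<Rightarrow> real^2 \<Rightarrow> real"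
  where "pd2 F x \<equiv> frechet_derivative F (at x) (axis 2 1)"

lemma frechet_derivative_partials:
  assumes "(F has_derivative frechet_derivative F (at x)) (at x)"
  shows "frechet_derivative F (at x) v = v $ 1 * pd1 F x + v $ 2 * pd2 F x"
proof -
  interpret bounded_linear "frechet_derivative F (at x)"
    using assms by (rule has_derivative_bounded_linear)
  have "frechet_derivative F (at x) (pt (v $ 1) (v $ 2)) = v $ 1 * pd1 F x + v $ 2 * pd2 F x"
    unfolding pt_def by (simp add: add scaleR)
  then show ?thesis by simp
qed

lemma has_derivative_partials:
  assumes "smooth_on F S" "x \<in> S"
  shows "(F has_derivative (\<lambda>v. v $ 1 * pd1 F x + v $ 2 * pd2 F x)) (at x)"
  using smooth_on_has_derivative[OF assms] frechet_derivative_partials[OF smooth_on_has_derivative[OF assms]]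
  by (metis (no_types, lifting) ext)

lemma DERIV_pt:
  assumes F: "smooth_on F S" and "pt (a s) (b s) \<in> S"
    and "(a has_real_derivative a') (at s)" "(b has_real_derivative b') (at s)"
  shows "((\<lambda>s. F (pt (a s) (b s))) has_real_derivative
    a' * pd1 F (pt (a s) (b s)) + b' * pd2 F (pt (a s) (b s))) (at s)"
proof -
  have "((\<lambda>s. pt (a s) (b s)) has_derivative (\<lambda>h. pt (a' * h) (b' * h))) (at s)"
    using assms(3,4) by (intro has_derivative_pt) (auto simp: has_field_derivative_def)
  from diff_chain_at[OF this has_derivative_partials[OF F assms(2)]]
  have "((\<lambda>s. F (pt (a s) (b s))) has_derivative
      (\<lambda>h. a' * h * pd1 F (pt (a s) (b s)) + b' * h * pd2 F (pt (a s) (b s)))) (at s)"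
    by (simp add: o_def)
  then show ?thesis
    unfolding has_field_derivative_def
    by (rule has_derivative_eq_rhs) (simp add: fun_eq_iff algebra_simps)
qed

lemma DERIV_pd1:
  assumes "smooth_on F S" "pt u t \<in> S"
  shows "((\<lambda>u. F (pt u t)) has_real_derivative pd1 F (pt u t)) (at u)"
  using DERIV_pt[OF assms(1), of "\<lambda>s. s" u "\<lambda>s. t" 1 0] assms(2) by simp

lemma DERIV_pd2:
  assumes "smooth_on F S" "pt u t \<in> S"
  shows "((\<lambda>t. F (pt u t)) has_real_derivative pd2 F (pt u t)) (at t)"
  using DERIV_pt[OF assms(1), of "\<lambda>s. u" t "\<lambda>s. s" 0 1] assms(2) by simp

section \<open>Division by a coordinate\<close>

lemmas has_derivative_nth [derivative_intros] = bounded_linear.has_derivative[OF bounded_linear_vec_nth]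

definition sq :: "real \<Rightarrow> (real^2) set"
  where "sq R = {x. \<bar>x $ 1\<bar> < R \<and> \<bar>x $ 2\<bar> < R}"

lemma open_sq [simp]: "open (sq R)"
proof -
  have "sq R = (\<lambda>x. \<bar>x $ 1\<bar>) -` {..<R} \<inter> (\<lambda>x. \<bar>x $ 2\<bar>) -` {..<R}"
    by (auto simp: sq_def)
  moreover have "open \<dots>"
    by (intro open_Int open_vimage continuous_intros open_lessThan)
  ultimately show ?thesis by simp
qed

lemma convex_sq: "convex (sq R)"
proof -
  have "sq R = (\<lambda>x. x $ 1) -` {-R<..<R} \<inter> (\<lambda>x. x $ 2) -` {-R<..<R}"
    by (auto simp: sq_def)
  then show ?thesis
    by (auto intro!: convex_Int convex_linear_vimage bounded_linear.linear bounded_linear_vec_nth)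
qed

lemma pt_in_sq [simp]: "pt u t \<in> sq R \<longleftrightarrow> \<bar>u\<bar> < R \<and> \<bar>t\<bar> < R"
  by (simp add: sq_def)

lemma zero_in_sq: "0 \<in> sq R \<longleftrightarrow> 0 < R"
  by (simp add: sq_def)

lemma sq_mono: "r \<le> R \<Longrightarrow> sq r \<subseteq> sq R"
  by (auto simp: sq_def)

lemma sq_subset_nbhd:
  assumes "open N" "0 \<in> N"
  shows "\<exists>R>0. sq R \<subseteq> N"
proof -
  obtain e where e: "e > 0" "ball 0 e \<subseteq> N"
    using assms open_contains_ball by blast
  have "x \<in> ball 0 e" if "x \<in> sq (e / 2)" for x
    using norm_le_l1_cart[of x] that by (simp add: sum_2 sq_def)
  then show ?thesis
    using e by (intro exI[of _ "e / 2"]) auto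
qed

lemma shrink_in_sq:
  assumes "x \<in> sq R" "0 \<le> s" "s \<le> 1"
  shows "pt (s * x $ 1) (x $ 2) \<in> sq R"
proof -
  have "\<bar>s * x $ 1\<bar> \<le> 1 * \<bar>x $ 1\<bar>"
    unfolding abs_mult using assms by (intro mult_right_mono) auto
  then show ?thesis
    using assms by (auto simp: sq_def)
qed

text \<open>Differentiation under the integral sign in the direction of the first axis produces a factor
  \<open>s\<close>, so the induction over the order of differentiability is carried out for all powers of \<open>s\<close> as
  weights at once.\<close>

lemma Ck_on_integral_shrink:
  assumes F: "smooth_on F (sq R)"
  shows "Ck_on k (\<lambda>x. integral {0..1} (\<lambda>s. s ^ n * F (pt (s * x $ 1) (x $ 2)))) (sq R)"
  using assms
proof (induction k arbitrary: F n)
  have cont: "continuous_on (sq R \<times> {0..1}) (\<lambda>(x, s). s ^ n * F (pt (s * x $ 1) (x $ 2)))"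
    if "smooth_on F (sq R)" for F n
    unfolding case_prod_unfold
    by (intro continuous_intros continuous_on_compose2[OF smooth_on_continuous[OF that]])
      (auto intro: shrink_in_sq)
  {
    case 0
    then show ?case
      using integral_continuous_on_param[of "sq R" 0 1
          "\<lambda>x s. s ^ n * F (pt (s * x $ 1) (x $ 2))"] cont[OF 0] by simp
  next
    case (Suc k)
    define D where "D x s = Blinfun (\<lambda>v :: real^2. v $ 1 * (s ^ Suc n * pd1 F (pt (s * x $ 1) (x $ 2)))
      + v $ 2 * (s ^ n * pd2 F (pt (s * x $ 1) (x $ 2))))" for x :: "real^2" and s :: real
    have D: "blinfun_apply (D x s) v = v $ 1 * (s ^ Suc n * pd1 F (pt (s * x $ 1) (x $ 2)))
      + v $ 2 * (s ^ n * pd2 F (pt (s * x $ 1) (x $ 2)))" for x s v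
      unfolding D_def
      by (subst bounded_linear_Blinfun_apply)
        (auto intro!: bounded_linear_add bounded_linear_mult_left bounded_linear_compose[OF bounded_linear_mult_left] bounded_linear_vec_nth)
    note smooth_pd = smooth_on_derivative[OF Suc.prems]
    have cont_D: "continuous_on (sq R \<times> {0..1}) (\<lambda>(x, s). D x s)"
      unfolding case_prod_unfold
    proof (rule continuous_on_blinfun_componentwise)
      fix i :: "real^2"
      show "continuous_on (sq R \<times> {0..1}) (\<lambda>x. blinfun_apply (D (fst x) (snd x)) i)"
        unfolding D
        by (intro continuous_intros cont[OF smooth_pd, unfolded case_prod_unfold])
    qed
    have D_int: "D x integrable_on {0..1}" if "x \<in> sq R" for x
    proof -
      have "continuous_on {0..1} (\<lambda>s. (\<lambda>(x, s). D x s) (x, s))"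
        by (rule continuous_on_compose2[OF cont_D]) (use that in \<open>auto intro!: continuous_intros\<close>)
      then show ?thesis
        using integrable_continuous_real by simp
    qed
    show ?case
    proof (rule Ck_on_SucI[OF open_sq])
      fix x assume x: "x \<in> sq R"
      have "((\<lambda>x. integral (cbox 0 1) (\<lambda>s. s ^ n * F (pt (s * x $ 1) (x $ 2)))) has_derivative
          integral (cbox 0 1) (D x)) (at x within sq R)"
      proof (rule leibniz_rule[OF _ _ _ x convex_sq])
        fix y s assume y: "y \<in> sq R" and s: "s \<in> cbox (0::real) 1"
        have "((\<lambda>x. pt (s * x $ 1) (x $ 2)) has_derivative (\<lambda>h. pt (s * h $ 1) (h $ 2))) (at y)"
          by (auto intro!: derivative_eq_intros)
        from diff_chain_at[OF this has_derivative_partials[OF Suc.prems shrink_in_sq[OF y]]]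
        have "((\<lambda>x. F (pt (s * x $ 1) (x $ 2))) has_derivative (\<lambda>h. s * h $ 1 * pd1 F (pt (s * y $ 1) (y $ 2))
            + h $ 2 * pd2 F (pt (s * y $ 1) (y $ 2)))) (at y)"
          using s by (simp add: o_def)
        from has_derivative_mult_right[OF this, of "s ^ n"]
        have "((\<lambda>x. s ^ n * F (pt (s * x $ 1) (x $ 2))) has_derivative blinfun_apply (D y s)) (at y)"
          by (rule has_derivative_eq_rhs) (simp add: fun_eq_iff D algebra_simps)
        then show "((\<lambda>x. s ^ n * F (pt (s * x $ 1) (x $ 2))) has_derivative blinfun_apply (D y s)) (at y within sq R)"
          by (rule has_derivative_at_withinI)
      next
        fix y assume y: "y \<in> sq R"
        have "continuous_on {0..1} (\<lambda>s. (\<lambda>(x, s). s ^ n * F (pt (s * x $ 1) (x $ 2))) (y, s))"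
          by (rule continuous_on_compose2[OF cont[OF Suc.prems]]) (use y in \<open>auto intro!: continuous_intros\<close>)
        then show "(\<lambda>s. s ^ n * F (pt (s * y $ 1) (y $ 2))) integrable_on cbox 0 1"
          using integrable_continuous_real by simp
      qed (use cont_D in simp)
      then show "((\<lambda>x. integral {0..1} (\<lambda>s. s ^ n * F (pt (s * x $ 1) (x $ 2)))) has_derivative
          blinfun_apply (integral {0..1} (D x))) (at x)"
        using at_within_open[OF x open_sq] by simp
    next
      fix v :: "real^2"
      let ?I = "\<lambda>m G x. integral {0..1} (\<lambda>s. s ^ m * G (pt (s * x $ 1) (x $ 2)))"
      have "Ck_on k (\<lambda>x. v $ 1 * ?I (Suc n) (pd1 F) x + v $ 2 * ?I n (pd2 F) x) (sq R)"
        by (intro Ck_on_add[OF open_sq] Ck_on_bounded_bilinear[OF open_sq bounded_bilinear_mult]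
            Ck_on_const Suc.IH smooth_pd)
      moreover have "blinfun_apply (integral {0..1} (D x)) v
          = v $ 1 * ?I (Suc n) (pd1 F) x + v $ 2 * ?I n (pd2 F) x" if x: "x \<in> sq R" for x
      proof -
        have int: "(\<lambda>s. s ^ m * G (pt (s * x $ 1) (x $ 2))) integrable_on {0..1}"
          if "smooth_on G (sq R)" for m G
        proof -
          have "continuous_on {0..1} (\<lambda>s. (\<lambda>(x, s). s ^ m * G (pt (s * x $ 1) (x $ 2))) (x, s))"
            by (rule continuous_on_compose2[OF cont[OF that]]) (use x in \<open>auto intro!: continuous_intros\<close>)
          then show ?thesis
            using integrable_continuous_real by simp
        qed
        show ?thesis
          unfolding blinfun_apply_integral[OF D_int[OF x]] D
          by (simp add: integral_add integrable_on_mult_right int[OF smooth_pd] del: power_Suc)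
      qed
      ultimately show "Ck_on k (\<lambda>x. blinfun_apply (integral {0..1} (D x)) v) (sq R)"
        by (subst Ck_on_cong[OF open_sq]) auto
    qed
  }
qed

text \<open>The quotient \<open>(F(u, t) - F(0, t)) / u\<close>, written as an integral to make it smooth at
  \<open>u = 0\<close>.\<close>

definition hadamard_quotient :: "(real^2 \<Rightarrow> real) \<Rightarrow> real^2 \<Rightarrow> real"
  where "hadamard_quotient F x = integral {0..1} (\<lambda>s. pd1 F (pt (s * x $ 1) (x $ 2)))"

lemma smooth_on_hadamard_quotient:
  assumes "smooth_on F (sq R)"
  shows "smooth_on (hadamard_quotient F) (sq R)"
proof (rule smooth_onI)
  fix k
  show "Ck_on k (hadamard_quotient F) (sq R)"
    using Ck_on_integral_shrink[OF smooth_on_derivative[OF assms], of k 0]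
    by (simp add: hadamard_quotient_def[abs_def])
qed

lemma hadamard_quotient:
  assumes F: "smooth_on F (sq R)" and x: "x \<in> sq R"
  shows "F x = F (pt 0 (x $ 2)) + x $ 1 * hadamard_quotient F x"
proof -
  have "((\<lambda>s. x $ 1 * pd1 F (pt (s * x $ 1) (x $ 2))) has_integral
      F (pt (1 * x $ 1) (x $ 2)) - F (pt (0 * x $ 1) (x $ 2))) {0..1}"
  proof (rule fundamental_theorem_of_calculus)
    fix s :: real assume "s \<in> {0..1}"
    then have "pt (s * x $ 1) (x $ 2) \<in> sq R"
      using shrink_in_sq[OF x] by auto
    then have "((\<lambda>s. F (pt (s * x $ 1) (x $ 2))) has_real_derivative
        x $ 1 * pd1 F (pt (s * x $ 1) (x $ 2)) + 0 * pd2 F (pt (s * x $ 1) (x $ 2))) (at s)"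
      by (intro DERIV_pt[OF F, of "\<lambda>s. s * x $ 1" s "\<lambda>s. x $ 2"]) (auto intro!: derivative_eq_intros)
    then show "((\<lambda>s. F (pt (s * x $ 1) (x $ 2))) has_vector_derivative
        x $ 1 * pd1 F (pt (s * x $ 1) (x $ 2))) (at s within {0..1})"
      by (simp add: has_real_derivative_iff_has_vector_derivative has_vector_derivative_at_within)
  qed simp
  from integral_unique[OF this]
  have "integral {0..1} (\<lambda>s. x $ 1 * pd1 F (pt (s * x $ 1) (x $ 2))) = F x - F (pt 0 (x $ 2))"
    by simp
  then show ?thesis
    by (simp add: hadamard_quotient_def)
qed

lemma hadamard_quotient_0: "hadamard_quotient F (pt 0 t) = pd1 F (pt 0 t)"
  by (simp add: hadamard_quotient_def)

lemma DERIV_id_mult: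
  fixes h :: "real \<Rightarrow> real"
  assumes "isCont h 0"
  shows "((\<lambda>u. u * h u) has_real_derivative h 0) (at 0)"
  by (rule CARAT_DERIV[THEN iffD2], rule exI[of _ h]) (use assms in \<open>auto simp: mult.commute\<close>)

text \<open>With \<open>S = S(0, t) + u G\<close>, the first derivative is \<open>G + u \<partial>G/\<partial>u\<close>; at the origin both terms
  contribute \<open>\<partial>G/\<partial>u\<close> to the second derivative.\<close>

lemma pd1_pd1_hadamard:
  assumes R: "0 < R" and S: "smooth_on S (sq R)"
  shows "pd1 (pd1 S) 0 = 2 * hadamard_quotient (hadamard_quotient S) 0"
proof -
  let ?G = "hadamard_quotient S"
  have G: "smooth_on ?G (sq R)"
    by (rule smooth_on_hadamard_quotient[OF S])
  have 0: "pt 0 0 \<in> sq R" using R by (simp add: zero_in_sq)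
  have S_eq: "pd1 S (pt u 0) = ?G (pt u 0) + u * pd1 ?G (pt u 0)" if u: "\<bar>u\<bar> < R" for u
  proof -
    have in_sq: "pt u 0 \<in> sq R" using u R by simp
    have "((\<lambda>u. S (pt 0 0) + u * ?G (pt u 0)) has_real_derivative ?G (pt u 0) + u * pd1 ?G (pt u 0)) (at u)"
      by (rule derivative_eq_intros DERIV_pd1[OF G in_sq] refl)+ simp
    then have "((\<lambda>u. S (pt u 0)) has_real_derivative ?G (pt u 0) + u * pd1 ?G (pt u 0)) (at u)"
      by (rule has_field_derivative_transform_within_open[of _ _ _ "{- R<..<R}"])
        (use u R hadamard_quotient[OF S, of "pt v 0" for v] in \<open>auto simp: abs_less_iff\<close>)
    from DERIV_unique[OF DERIV_pd1[OF S in_sq] this] show ?thesis .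
  qed
  have "isCont (\<lambda>u. pd1 ?G (pt u 0)) 0"
    by (rule DERIV_isCont[OF DERIV_pd1[OF smooth_on_derivative[OF G] 0]])
  from DERIV_add[OF DERIV_pd1[OF G 0] DERIV_id_mult[OF this]]
  have "((\<lambda>u. pd1 S (pt u 0)) has_real_derivative pd1 ?G (pt 0 0) + pd1 ?G (pt 0 0)) (at 0)"
    by (rule has_field_derivative_transform_within_open[of _ _ _ "{- R<..<R}"])
      (use R S_eq in \<open>auto simp: abs_less_iff\<close>)
  from DERIV_unique[OF DERIV_pd1[OF smooth_on_derivative[OF S] 0] this]
  show ?thesis
    using hadamard_quotient_0[of ?G 0] by simp
qed

section \<open>A sequence of weights with alternating moments\<close>

text \<open>The reflection below needs numbers \<open>a\<^sub>k\<close> and \<open>b\<^sub>k > 0\<close> such that the sums of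
  \<open>a\<^sub>k (- b\<^sub>k)\<^sup>j\<close> are \<open>1\<close> for all \<open>j\<close>.  The starting point is a signed measure on the powers of \<open>q\<close> all of
  whose moments vanish: the terms of the theta series with weights \<open>(- 1)\<^sup>k q\<^bsup>k(k+1)/2\<^esup>\<close> at the nodes
  \<open>x\<^sub>k = q\<^sup>k\<close>, over all integers \<open>k\<close>, cancel in pairs.  Dividing the weights by \<open>1 + x\<^sub>k\<close> turns the recursion
  "moment \<open>j + 1\<close> plus moment \<open>j\<close> is zero" into alternating moments, which only need to be
  normalized.  The value \<open>1 / 9\<close> of \<open>q\<close> is small enough for the term \<open>1 / 2\<close> at \<open>k = 0\<close> to dominate the sum of
  the others, so that the normalizing constant is not zero.\<close>

definition theta_nome :: real where "theta_nome = 1 / 9"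

definition theta_weight :: "int \<Rightarrow> real"
  where "theta_weight k = (if even k then 1 else - 1) * theta_nome powi (k * (k + 1) div 2)"

definition theta_node :: "int \<Rightarrow> real"
  where "theta_node k = theta_nome powi k"

lemma theta_nome_pos: "0 < theta_nome" "theta_nome < 1" "theta_nome \<noteq> 0"
  by (simp_all add: theta_nome_def)

lemma theta_node_pos: "0 < theta_node k"
  by (simp add: theta_node_def theta_nome_pos)

lemma theta_node_power: "theta_node k ^ j = theta_nome powi (k * int j)"
  by (simp add: theta_node_def power_int_power')

lemma theta_moment: "theta_weight k * theta_node k ^ j = (if even k then 1 else - 1) * theta_nome powi (k * (k + 1) div 2 + k * int j)"
  by (simp add: theta_weight_def theta_node_power power_int_add theta_nome_pos)

lemma abs_theta_moment: "\<bar>theta_weight k * theta_node k ^ j\<bar> = theta_nome powi (k * (k + 1) div 2 + k * int j)"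
  using theta_nome_pos by (simp add: theta_moment abs_mult)

lemma theta_geometric_has_sum: "((\<lambda>k. theta_nome ^ nat \<bar>k\<bar>) has_sum 1 / 4) (- {0})"
proof -
  have 1: "((\<lambda>n. theta_nome ^ n) has_sum 1 / 8) {1::nat..}"
    using has_sum_geometric_from_1[of theta_nome] by (simp add: theta_nome_def)
  have "((\<lambda>k. theta_nome ^ nat \<bar>k\<bar>) has_sum 1 / 8) (int ` {1..})"
    by (subst has_sum_reindex) (use 1 in \<open>auto simp: o_def\<close>)
  moreover have "((\<lambda>k. theta_nome ^ nat \<bar>k\<bar>) has_sum 1 / 8) ((\<lambda>n. - int n) ` {1..})"
    by (subst has_sum_reindex) (use 1 in \<open>auto simp: o_def inj_on_def\<close>)
  ultimately have "((\<lambda>k. theta_nome ^ nat \<bar>k\<bar>) has_sum 1 / 8 + 1 / 8) (int ` {1..} \<union> (\<lambda>n. - int n) ` {1..})"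
    by (rule has_sum_Un_disjoint) auto
  moreover have "int ` {1..} \<union> (\<lambda>n. - int n) ` {1..} = - {0}"
  proof -
    have "k \<in> int ` {1..} \<union> (\<lambda>n. - int n) ` {1..}" if "k \<noteq> 0" for k
      using that by (cases k rule: int_cases3) auto
    then show ?thesis by auto
  qed
  ultimately show ?thesis by simp
qed

lemma geometric_summable: "(\<lambda>k. theta_nome ^ nat \<bar>k\<bar>) summable_on UNIV"
proof -
  have "(\<lambda>k. theta_nome ^ nat \<bar>k\<bar>) summable_on (- {0} \<union> {0})"
    using theta_geometric_has_sum by (intro summable_on_Un_disjoint)
      (auto simp: summable_on_def intro!: has_sum_finite exI)
  moreover have "- {0} \<union> {0} = (UNIV :: int set)"
    by auto
  ultimately show ?thesis by simp
qed

text \<open>The quadratic growth of the exponent beats every power of a node.\<close>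

lemma theta_moment_exponent: "\<bar>k\<bar> - (int j + 2)\<^sup>2 \<le> k * (k + 1) div 2 + k * int j"
proof -
  have 1: "2 * (k * (k + 1) div 2) = k * k + k"
    by (simp add: algebra_simps)
  have "0 \<le> (\<bar>k\<bar> - (int j + 2))\<^sup>2"
    by simp
  then have 2: "2 * (\<bar>k\<bar> * int j) + 4 * \<bar>k\<bar> \<le> k * k + (int j + 2)\<^sup>2"
    by (simp add: power2_diff power2_eq_square[of k] algebra_simps)
  have 3: "- (k * int j) \<le> \<bar>k\<bar> * int j"
    by (metis abs_mult abs_of_nat abs_ge_minus_self)
  have "0 \<le> (int j + 2)\<^sup>2" "- \<bar>k\<bar> \<le> k" "0 \<le> \<bar>k\<bar>"
    by auto
  with 1 2 3 show ?thesis
    by linarith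
qed

lemma theta_moment_summable: "(\<lambda>k. norm (theta_weight k * theta_node k ^ j)) summable_on UNIV"
proof (rule Infinite_Sum.abs_summable_on_comparison_test')
  show "(\<lambda>k. theta_nome powi (- (int j + 2)\<^sup>2) * theta_nome ^ nat \<bar>k\<bar>) summable_on UNIV"
    by (intro summable_on_cmult_right geometric_summable)
  fix k :: int
  have "theta_nome powi (k * (k + 1) div 2 + k * int j) \<le> theta_nome powi (\<bar>k\<bar> - (int j + 2)\<^sup>2)"
    using theta_moment_exponent[of k j] theta_nome_pos by (intro power_int_decreasing) auto
  also have "\<dots> = theta_nome powi (- (int j + 2)\<^sup>2) * theta_nome ^ nat \<bar>k\<bar>"
  proof -
    have "\<bar>k\<bar> - (int j + 2)\<^sup>2 = - (int j + 2)\<^sup>2 + int (nat \<bar>k\<bar>)" by simp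
    then show ?thesis
      using theta_nome_pos by (simp only: power_int_add power_int_of_nat simp_thms)
  qed
  finally show "norm (theta_weight k * theta_node k ^ j) \<le> theta_nome powi (- (int j + 2)\<^sup>2) * theta_nome ^ nat \<bar>k\<bar>"
    using abs_theta_moment[of k j] by simp
qed

text \<open>The substitution \<open>k \<mapsto> - (2 j + 1) - k\<close> preserves the exponent and changes the parity.\<close>

lemma theta_moments_vanish: "infsum (\<lambda>k. theta_weight k * theta_node k ^ j) UNIV = 0"
proof -
  let ?\<sigma> = "\<lambda>k. - (2 * int j + 1) - k"
  let ?f = "\<lambda>k. theta_weight k * theta_node k ^ j"
  have "bij_betw ?\<sigma> UNIV UNIV"
    by (rule bij_betwI[of _ _ _ ?\<sigma>]) auto
  then have "infsum (\<lambda>k. ?f (?\<sigma> k)) UNIV = infsum ?f UNIV"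
    by (rule infsum_reindex_bij_betw)
  moreover have "?f (?\<sigma> k) = - ?f k" for k
  proof -
    have *: "2 * (k * (k + 1) div 2 + k * int j) = k * (k + 1) + 2 * k * int j" for k
      by (simp add: algebra_simps)
    have "2 * (?\<sigma> k * (?\<sigma> k + 1) div 2 + ?\<sigma> k * int j) = 2 * (k * (k + 1) div 2 + k * int j)"
      unfolding * by (simp add: algebra_simps)
    then have e: "?\<sigma> k * (?\<sigma> k + 1) div 2 + ?\<sigma> k * int j = k * (k + 1) div 2 + k * int j"
      by (rule mult_left_cancel[THEN iffD1, rotated]) simp
    show ?thesis
      unfolding theta_moment e by simp
  qed
  ultimately have "- infsum ?f UNIV = infsum ?f UNIV"
    by (simp add: infsum_uminus)
  then show ?thesis by simp
qed

definition seeley_sum :: "nat \<Rightarrow> real"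
  where "seeley_sum j = infsum (\<lambda>k. theta_weight k * theta_node k ^ j / (1 + theta_node k)) UNIV"

lemma seeley_sum_summable: "(\<lambda>k. norm (theta_weight k * theta_node k ^ j / (1 + theta_node k))) summable_on UNIV"
proof (rule Infinite_Sum.abs_summable_on_comparison_test[OF theta_moment_summable[of j]])
  fix k :: int
  have "norm (theta_weight k * theta_node k ^ j / (1 + theta_node k))
      = norm (theta_weight k * theta_node k ^ j) / (1 + theta_node k)"
    using theta_node_pos[of k] by (simp add: norm_divide)
  also have "\<dots> \<le> norm (theta_weight k * theta_node k ^ j) / 1"
    using theta_node_pos[of k] by (intro divide_left_mono) auto
  finally show "norm (theta_weight k * theta_node k ^ j / (1 + theta_node k))
      \<le> norm (theta_weight k * theta_node k ^ j)" by simp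
qed

lemma seeley_sum_Suc: "seeley_sum (Suc j) = - seeley_sum j"
proof -
  have "seeley_sum (Suc j) + seeley_sum j = infsum (\<lambda>k. theta_weight k * theta_node k ^ Suc j / (1 + theta_node k)
      + theta_weight k * theta_node k ^ j / (1 + theta_node k)) UNIV"
    unfolding seeley_sum_def
    by (rule infsum_add[symmetric])
      (rule Infinite_Sum.abs_summable_summable[OF seeley_sum_summable])+
  also have "\<dots> = infsum (\<lambda>k. theta_weight k * theta_node k ^ j) UNIV"
  proof (rule infsum_cong)
    fix k :: int
    have "1 + theta_node k \<noteq> 0" using theta_node_pos[of k] by simp
    then show "theta_weight k * theta_node k ^ Suc j / (1 + theta_node k) + theta_weight k * theta_node k ^ j / (1 + theta_node k) = theta_weight k * theta_node k ^ j"
      by (simp add: add_divide_distrib[symmetric] divide_eq_eq algebra_simps)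
  qed
  finally show ?thesis
    using theta_moments_vanish by simp
qed

lemma seeley_sum_0_pos: "seeley_sum 0 > 0"
proof -
  let ?f = "\<lambda>k. theta_weight k * theta_node k ^ 0 / (1 + theta_node k)"
  have f: "?f summable_on A" for A
    using Infinite_Sum.abs_summable_summable[OF seeley_sum_summable[of 0]] by (rule summable_on_subset_banach) simp
  have fn: "(\<lambda>k. norm (?f k)) summable_on A" for A
    using f summable_on_iff_abs_summable_on_real[of ?f A] by blast
  have geom: "(\<lambda>k. theta_nome ^ nat \<bar>k\<bar>) summable_on - {0}"
    unfolding summable_on_def using theta_geometric_has_sum by blast
  have "seeley_sum 0 = infsum ?f ({0} \<union> - {0})"
    by (simp add: seeley_sum_def)
  also have "\<dots> = infsum ?f {0} + infsum ?f (- {0})"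
    by (rule infsum_Un_disjoint) (use f in auto)
  finally have "seeley_sum 0 = 1 / 2 + infsum ?f (- {0})"
    by (simp add: theta_weight_def theta_node_def)
  moreover have "norm (?f k) \<le> theta_nome ^ nat \<bar>k\<bar>" if "k \<in> - {0}" for k
  proof (cases "k > 0")
    case True
    have "\<bar>?f k\<bar> \<le> \<bar>theta_weight k\<bar>"
      using theta_node_pos[of k] by (simp add: divide_le_eq mult_le_cancel_left1)
    also have "\<dots> \<le> theta_nome powi k"
    proof -
      have "2 * k \<le> k * (k + 1)"
        using True by (simp add: mult.commute)
      then have "k \<le> k * (k + 1) div 2"
        by simp
      then show ?thesis
        using theta_nome_pos abs_theta_moment[of k 0] by (simp add: power_int_decreasing)
    qed
    also have "\<dots> = theta_nome ^ nat \<bar>k\<bar>"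
      using True by (simp add: power_int_def)
    finally show ?thesis by simp
  next
    case False
    with that have k: "k < 0" by simp
    have "\<bar>?f k\<bar> \<le> \<bar>theta_weight k\<bar> / theta_node k"
      using theta_node_pos[of k] by (simp add: frac_le)
    also have "\<dots> = theta_nome powi (k * (k + 1) div 2 - k)"
      using theta_nome_pos abs_theta_moment[of k 0] by (simp add: theta_node_def power_int_diff)
    also have "\<dots> \<le> theta_nome powi (- k)"
    proof -
      have "0 \<le> k * (k + 1)"
        using k by (intro mult_nonpos_nonpos) auto
      then show ?thesis
        using theta_nome_pos by (intro power_int_decreasing) auto
    qed
    also have "\<dots> = theta_nome ^ nat \<bar>k\<bar>"
      using k by (simp add: power_int_def)
    finally show ?thesis by simp
  qed
  then have "infsum (\<lambda>k. norm (?f k)) (- {0}) \<le> infsum (\<lambda>k. theta_nome ^ nat \<bar>k\<bar>) (- {0})"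
    using geom by (intro infsum_mono fn)
  moreover have "norm (infsum ?f (- {0})) \<le> infsum (\<lambda>k. norm (?f k)) (- {0})"
    by (rule norm_infsum_bound[OF fn])
  moreover have "infsum (\<lambda>k. theta_nome ^ nat \<bar>k\<bar>) (- {0}) = 1 / 4"
    using theta_geometric_has_sum by (rule infsumI)
  ultimately show ?thesis
    by (simp add: abs_le_iff)
qed

lemma alternating_moment_weights:
  "\<exists>a b :: nat \<Rightarrow> real. (\<forall>k. b k > 0) \<and> (\<forall>j. summable (\<lambda>k. \<bar>a k * b k ^ j\<bar>)) \<and>
    (\<forall>j. (\<Sum>k. a k * (- b k) ^ j) = 1)"
proof -
  define a where "a n = theta_weight (int_decode n) / (1 + theta_node (int_decode n)) / seeley_sum 0" for n
  define b where "b n = theta_node (int_decode n)" for n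
  have seeley_sum: "seeley_sum j = (- 1) ^ j * seeley_sum 0" for j
    by (induction j) (simp_all add: seeley_sum_Suc)
  have moment: "a n * b n ^ j = (theta_weight (int_decode n) * theta_node (int_decode n) ^ j / (1 + theta_node (int_decode n))) / seeley_sum 0" for n j
    by (simp add: a_def b_def)
  have has: "((\<lambda>n. a n * b n ^ j) has_sum seeley_sum j / seeley_sum 0) UNIV" for j
  proof -
    have "((\<lambda>k. theta_weight k * theta_node k ^ j / (1 + theta_node k)) has_sum seeley_sum j) UNIV"
      unfolding seeley_sum_def by (rule has_sum_infsum[OF Infinite_Sum.abs_summable_summable[OF seeley_sum_summable]])
    then have "((\<lambda>n. theta_weight (int_decode n) * theta_node (int_decode n) ^ j / (1 + theta_node (int_decode n))) has_sum seeley_sum j) UNIV"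
      by (subst has_sum_reindex_bij_betw[OF bij_int_decode])
    from has_sum_cmult_left[OF this, of "1 / seeley_sum 0"] show ?thesis
      by (simp add: moment)
  qed
  have "(\<lambda>n. norm (a n * b n ^ j)) summable_on UNIV" for j
    by (rule summable_on_iff_abs_summable_on_real[THEN iffD1, OF has_sum_imp_summable[OF has]])
  then have "summable (\<lambda>k. \<bar>a k * b k ^ j\<bar>)" for j
    using summable_on_imp_summable[of "\<lambda>k. norm (a k * b k ^ j)"] by simp
  moreover have "(\<Sum>k. a k * (- b k) ^ j) = 1" for j
  proof -
    have "(\<lambda>k. a k * b k ^ j) sums ((- 1) ^ j)"
      using has_sum_imp_sums[OF has[of j]] seeley_sum[of j] seeley_sum_0_pos by simp
    from sums_mult[OF this, of "(- 1) ^ j"] have "(\<lambda>k. a k * (- b k) ^ j) sums 1"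
      by (simp add: mult.left_commute[of "(- 1) ^ j"] flip: power_mult_distrib)
    then show ?thesis by (simp add: sums_iff)
  qed
  ultimately show ?thesis
    using theta_node_pos by (intro exI[of _ a] exI[of _ b]) (auto simp: b_def)
qed

section \<open>Whitney's theorem on even functions\<close>

text \<open>Both \<open>f\<close> and the integral of \<open>f'\<close> are continuous, so the fundamental theorem of calculus
  tolerates the exceptional point.\<close>

lemma DERIV_removable:
  fixes f f' :: "real \<Rightarrow> real"
  assumes f: "\<And>y. isCont f y" and f': "\<And>y. isCont f' y"
    and D: "\<And>y. y \<noteq> 0 \<Longrightarrow> (f has_real_derivative f' y) (at y)"
  shows "(f has_real_derivative f' y) (at y)"
proof (cases "y = 0")
  case True
  have int: "(f' has_integral f y - f (- 1)) {- 1..y}" if "y \<ge> - 1" for y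
  proof (rule fundamental_theorem_of_calculus_interior_strong[of "{0}"])
    show "(f has_vector_derivative f' x) (at x)" if "x \<in> {- 1<..<y} - {0}" for x
      using D that by (auto simp: has_real_derivative_iff_has_vector_derivative)
    show "continuous_on {- 1..y} f"
      using f by (simp add: continuous_at_imp_continuous_on)
  qed (use that in auto)
  have "((\<lambda>y. integral {- 1..y} f') has_real_derivative f' 0) (at 0 within {- 1..1})"
    using f' by (intro integral_has_real_derivative) (auto simp: continuous_at_imp_continuous_on)
  moreover have "at 0 within {- 1..1} = at (0::real)"
    by (rule at_within_interior) simp
  ultimately have der: "((\<lambda>y. f (- 1) + integral {- 1..y} f') has_real_derivative f' 0) (at 0)"
    using DERIV_add[OF DERIV_const[of "f (- 1)"]] by fastforce
  have ev: "\<forall>\<^sub>F y in nhds 0. f (- 1) + integral {- 1..y} f' = f y"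
  proof -
    have "\<forall>\<^sub>F y in nhds (0::real). y \<in> {- 1<..}"
      by (rule eventually_nhds_in_open) auto
    then show ?thesis
      by eventually_elim (use integral_unique[OF int] in force)
  qed
  show ?thesis
    using DERIV_cong_ev[OF refl ev refl] der True by simp
qed (use D in simp)

lemma has_derivative_from_partials:
  assumes T: "open T" "x \<in> T" and P: "continuous_on T P" and Q: "continuous_on T Q"
    and P': "\<And>u t. pt u t \<in> T \<Longrightarrow> ((\<lambda>u. F (pt u t)) has_real_derivative P (pt u t)) (at u)"
    and Q': "\<And>u t. pt u t \<in> T \<Longrightarrow> ((\<lambda>t. F (pt u t)) has_real_derivative Q (pt u t)) (at t)"
  shows "(F has_derivative (\<lambda>v. v $ 1 * P x + v $ 2 * Q x)) (at x)"
proof -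
  let ?u = "x $ 1" and ?t = "x $ 2"
  define e where "e = (\<lambda>v :: real \<times> real. pt (fst v) (snd v))"
  have "continuous_on UNIV e"
    unfolding e_def by (intro continuous_intros)
  then have "open (e -` T)"
    using T(1) by (simp add: open_vimage)
  moreover have "(?u, ?t) \<in> e -` T"
    using T(2) by (simp add: e_def)
  ultimately obtain X Y where XY: "open X" "open Y" "(?u, ?t) \<in> X \<times> Y" "X \<times> Y \<subseteq> e -` T"
    by (rule open_prod_elim)
  obtain d where d: "d > 0" "ball ?t d \<subseteq> Y"
    using XY(2,3) by (meson mem_Sigma_iff open_contains_ball)
  let ?B = "ball ?t d"
  have in_T: "pt u t \<in> T" if "u \<in> X" "t \<in> ?B" for u t
    using XY(4) d(2) that by (force simp: e_def)
  have t: "?t \<in> ?B" using d(1) by simp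
  have "((\<lambda>(u, t). F (pt u t)) has_derivative (\<lambda>(h, k). P x * h + blinfun_mult_right (Q (pt ?u ?t)) k))
      (at (?u, ?t) within X \<times> ?B)"
  proof (rule has_derivative_partialsI)
    show "((\<lambda>u. F (pt u ?t)) has_derivative (*) (P x)) (at ?u within X)"
      using P'[of ?u ?t] T(2) by (simp add: has_field_derivative_def has_derivative_at_withinI)
    show "((\<lambda>t. F (pt u t)) has_derivative blinfun_apply (blinfun_mult_right (Q (pt u t)))) (at t within ?B)"
      if "u \<in> X" "t \<in> ?B" for u t
      using Q'[OF in_T[OF that]] by (simp add: has_field_derivative_def has_derivative_at_withinI)
    have "continuous_on (X \<times> ?B) (\<lambda>(u, t). blinfun_mult_right (Q (pt u t)))"
      unfolding case_prod_unfold
      by (intro continuous_intros continuous_on_compose2[OF Q] bounded_linear.continuous_on[OF bounded_linear_blinfun_mult_right])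
        (use in_T in auto)
    then show "continuous (at (?u, ?t) within X \<times> ?B) (\<lambda>(u, t). blinfun_mult_right (Q (pt u t)))"
      using XY(3) t by (simp add: continuous_on_eq_continuous_within)
  qed (use t in auto)
  moreover have "at (?u, ?t) within X \<times> ?B = at (?u, ?t)"
    using XY t by (intro at_within_open open_Times) auto
  ultimately have 1: "((\<lambda>(u, t). F (pt u t)) has_derivative (\<lambda>(h, k). P x * h + Q x * k)) (at (?u, ?t))"
    by simp
  have 2: "((\<lambda>x. (x $ 1, x $ 2)) has_derivative (\<lambda>v. (v $ 1, v $ 2))) (at x)"
    by (auto intro!: derivative_eq_intros)
  from diff_chain_at[OF 2 1] show ?thesis
    by (simp add: o_def mult.commute)
qed

text \<open>In an even function \<open>F(u, t)\<close> the variable \<open>u\<close> is replaced by the chart of \<open>z \<ge> 0\<close>.  The chart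
  compresses the half-line into \<open>[0, r)\<close>, so that arbitrarily large dilations of \<open>z\<close> stay in the domain of
  \<open>F\<close> and no cut-off function is needed.  Its square \<open>r\<^sup>2 z / (1 + z)\<close> is a rational function of \<open>z\<close> that is a
  coordinate on both sides of \<open>z = 0\<close>.\<close>

definition seeley_chart :: "real \<Rightarrow> real \<Rightarrow> real"
  where "seeley_chart r z = r * sqrt (z / (1 + z))"

locale seeley_extension =
  fixes r R :: real and a b :: "nat \<Rightarrow> real"
  assumes r: "0 < r" "r < R" and b: "\<And>k. 0 < b k"
    and weights_summable: "\<And>j. summable (\<lambda>k. \<bar>a k * b k ^ j\<bar>)"
    and weights_moment: "\<And>j. (\<Sum>k. a k * (- b k) ^ j) = 1"
begin

abbreviation chart :: "real \<Rightarrow> real"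
  where "chart \<equiv> seeley_chart r"

lemma chart_bounds: "0 \<le> z \<Longrightarrow> 0 \<le> chart z \<and> chart z < r"
proof -
  assume z: "0 \<le> z"
  have "sqrt (z / (1 + z)) < 1"
    using z by (simp add: divide_less_eq)
  then show ?thesis
    using z r by (simp add: seeley_chart_def)
qed

lemma chart_square: "0 \<le> z \<Longrightarrow> 1 - (chart z)\<^sup>2 / r\<^sup>2 = 1 / (1 + z)"
proof -
  assume z: "0 \<le> z"
  then have "(chart z)\<^sup>2 / r\<^sup>2 = z / (1 + z)"
    using r by (simp add: seeley_chart_def power_mult_distrib)
  then show ?thesis
    using z by (simp add: field_simps)
qed

lemma continuous_on_chart: "continuous_on {0..} chart"
  unfolding seeley_chart_def by (intro continuous_intros) auto

lemma chart_in_sq: "0 \<le> z \<Longrightarrow> \<bar>t\<bar> < r \<Longrightarrow> pt (chart z) t \<in> sq R"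
  using chart_bounds[of z] r by simp

lemma DERIV_chart:
  assumes "0 < z"
  shows "\<exists>c. (chart has_real_derivative c) (at z) \<and> 2 * chart z * c = r\<^sup>2 * (1 / (1 + z))\<^sup>2"
proof -
  let ?s = "z / (1 + z)"
  have s: "?s > 0" using assms by simp
  have "((\<lambda>z. z / (1 + z)) has_real_derivative (1 / (1 + z))\<^sup>2) (at z)"
    using assms by (auto intro!: derivative_eq_intros simp: power2_eq_square field_simps)
  from DERIV_chain2[OF DERIV_real_sqrt[OF s] this]
  have "(chart has_real_derivative r * (inverse (sqrt ?s) / 2 * (1 / (1 + z))\<^sup>2)) (at z)"
    unfolding seeley_chart_def[abs_def] by (rule DERIV_cmult)
  moreover have "2 * chart z * (r * (inverse (sqrt ?s) / 2 * (1 / (1 + z))\<^sup>2))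
      = (r * r) * (sqrt ?s * inverse (sqrt ?s)) * (1 / (1 + z))\<^sup>2"
    by (simp add: seeley_chart_def)
  moreover have "sqrt ?s * inverse (sqrt ?s) = 1"
    using s by (intro right_inverse) (metis less_irrefl real_sqrt_eq_zero_cancel_iff)
  ultimately show ?thesis
    by (intro exI conjI) (assumption, simp add: power2_eq_square)
qed

definition even_smooth :: "(real^2 \<Rightarrow> real) \<Rightarrow> bool"
  where "even_smooth F \<longleftrightarrow> smooth_on F (sq R) \<and>
    (\<forall>u t. \<bar>u\<bar> < R \<longrightarrow> \<bar>t\<bar> < R \<longrightarrow> F (pt (- u) t) = F (pt u t))"

text \<open>The derivative of \<open>z \<mapsto> F (chart z, t)\<close> is again the value at \<open>(chart z, t)\<close> of an even
  function: \<open>\<partial>F/\<partial>u\<close> is odd, hence \<open>u\<close> times the Hadamard quotient, and the derivative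
  \<open>r\<^sup>2 / (1 + z)\<^sup>2\<close> of the squared chart is a polynomial in the squared chart.\<close>

definition square_derivative :: "(real^2 \<Rightarrow> real) \<Rightarrow> real^2 \<Rightarrow> real"
  where "square_derivative F x = r\<^sup>2 / 2 * (1 - (x $ 1)\<^sup>2 / r\<^sup>2)\<^sup>2 * hadamard_quotient (pd1 F) x"

lemma even_smooth_pd1_odd:
  assumes "even_smooth F" "\<bar>u\<bar> < R" "\<bar>t\<bar> < R"
  shows "pd1 F (pt (- u) t) = - pd1 F (pt u t)"
proof -
  have F: "smooth_on F (sq R)"
    using assms(1) by (simp add: even_smooth_def)
  have "((\<lambda>u. F (pt (- u) t)) has_real_derivative (- 1) * pd1 F (pt (- u) t) + 0 * pd2 F (pt (- u) t)) (at u)"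
    by (rule DERIV_pt[OF F]) (use assms in \<open>auto intro!: derivative_eq_intros\<close>)
  moreover have "((\<lambda>u. F (pt (- u) t)) has_real_derivative pd1 F (pt u t)) (at u)"
  proof (rule has_field_derivative_transform_within_open[OF DERIV_pd1[OF F]])
    show "open {- R<..<R}" by simp
    show "F (pt u t) = F (pt (- u) t)" if "u \<in> {- R<..<R}" for u
      using assms that by (simp add: even_smooth_def abs_less_iff)
  qed (use assms in auto)
  ultimately show ?thesis
    using DERIV_unique by fastforce
qed

lemma even_smooth_pd2:
  assumes "even_smooth F"
  shows "even_smooth (pd2 F)"
  unfolding even_smooth_def
proof (intro conjI allI impI)
  have F: "smooth_on F (sq R)"
    using assms(1) by (simp add: even_smooth_def)
  show "smooth_on (pd2 F) (sq R)"
    by (rule smooth_on_derivative[OF F])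
  fix u t :: real assume ut: "\<bar>u\<bar> < R" "\<bar>t\<bar> < R"
  have "((\<lambda>t. F (pt (- u) t)) has_real_derivative pd2 F (pt u t)) (at t)"
  proof (rule has_field_derivative_transform_within_open[OF DERIV_pd2[OF F]])
    show "open {- R<..<R}" by simp
    show "F (pt u t) = F (pt (- u) t)" if "t \<in> {- R<..<R}" for t
      using assms ut that by (simp add: even_smooth_def abs_less_iff)
  qed (use ut in auto)
  moreover have "((\<lambda>t. F (pt (- u) t)) has_real_derivative pd2 F (pt (- u) t)) (at t)"
    by (rule DERIV_pd2[OF F]) (use ut in simp)
  ultimately show "pd2 F (pt (- u) t) = pd2 F (pt u t)"
    using DERIV_unique by blast
qed

lemma pd1_even:
  assumes F: "even_smooth F" and x: "x \<in> sq R"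
  shows "pd1 F x = x $ 1 * hadamard_quotient (pd1 F) x"
proof -
  have "\<bar>x $ 2\<bar> < R" using x by (simp add: sq_def)
  then have "pd1 F (pt 0 (x $ 2)) = 0"
    using even_smooth_pd1_odd[OF F, of 0 "x $ 2"] r by simp
  then show ?thesis
    using hadamard_quotient[OF smooth_on_derivative x, of F] F
    by (simp add: even_smooth_def)
qed

lemma even_smooth_square_derivative:
  assumes F: "even_smooth F"
  shows "even_smooth (square_derivative F)"
  unfolding even_smooth_def
proof (intro conjI allI impI)
  have "smooth_on (hadamard_quotient (pd1 F)) (sq R)"
    using F by (intro smooth_on_hadamard_quotient smooth_on_derivative) (simp add: even_smooth_def)
  then show "smooth_on (square_derivative F) (sq R)"
    unfolding square_derivative_def[abs_def] using r by (intro smooth_intros) auto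
  fix u t :: real assume ut: "\<bar>u\<bar> < R" "\<bar>t\<bar> < R"
  have "hadamard_quotient (pd1 F) (pt (- u) t) = hadamard_quotient (pd1 F) (pt u t)"
  proof (cases "u = 0")
    case False
    have "- u * hadamard_quotient (pd1 F) (pt (- u) t) = - (u * hadamard_quotient (pd1 F) (pt u t))"
      using pd1_even[OF F, of "pt u t"] pd1_even[OF F, of "pt (- u) t"] even_smooth_pd1_odd[OF F ut] ut
      by auto
    with False show ?thesis by simp
  qed simp
  then show "square_derivative F (pt (- u) t) = square_derivative F (pt u t)"
    by (simp add: square_derivative_def)
qed

lemma DERIV_even_chart:
  assumes F: "even_smooth F" and "0 < z" "\<bar>t\<bar> < r"
  shows "((\<lambda>z. F (pt (chart z) t)) has_real_derivative square_derivative F (pt (chart z) t)) (at z)"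
proof -
  obtain c where c: "(chart has_real_derivative c) (at z)" "2 * chart z * c = r\<^sup>2 * (1 / (1 + z))\<^sup>2"
    using DERIV_chart[OF assms(2)] by blast
  have in_sq: "pt (chart z) t \<in> sq R"
    using chart_in_sq[of z t] assms by (simp del: pt_in_sq)
  have "((\<lambda>z. F (pt (chart z) t)) has_real_derivative
      c * pd1 F (pt (chart z) t) + 0 * pd2 F (pt (chart z) t)) (at z)"
    by (rule DERIV_pt[OF _ in_sq c(1)]) (use F in \<open>auto simp: even_smooth_def\<close>)
  moreover have "c * pd1 F (pt (chart z) t) = square_derivative F (pt (chart z) t)"
  proof -
    have "c * pd1 F (pt (chart z) t) = (2 * chart z * c) / 2 * hadamard_quotient (pd1 F) (pt (chart z) t)"
      using pd1_even[OF F in_sq] by simp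
    also have "\<dots> = square_derivative F (pt (chart z) t)"
      unfolding c(2) using chart_square[of z] assms by (simp add: square_derivative_def)
    finally show ?thesis .
  qed
  ultimately show ?thesis by simp
qed

text \<open>For \<open>j = 0\<close> this is the extension of \<open>z \<mapsto> F (chart z, t)\<close> to negative \<open>z\<close>.  The general \<open>j\<close>
  makes the family closed under differentiation: each derivative in \<open>z\<close> of the \<open>k\<close>-th summand brings a factor
  \<open>- b\<^sub>k\<close>.\<close>

definition extension :: "nat \<Rightarrow> (real^2 \<Rightarrow> real) \<Rightarrow> real^2 \<Rightarrow> real"
  where "extension j F x = (if x $ 1 \<le> 0
    then (\<Sum>k. a k * (- b k) ^ j * F (pt (chart (- (b k * x $ 1))) (x $ 2)))
    else F (pt (chart (x $ 1)) (x $ 2)))"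

definition strip :: "(real^2) set"
  where "strip = {x. \<bar>x $ 2\<bar> < r}"

lemma open_strip: "open strip"
proof -
  have "strip = (\<lambda>x. \<bar>x $ 2\<bar>) -` {..<r}"
    by (auto simp: strip_def)
  moreover have "open \<dots>"
    by (intro open_vimage continuous_intros open_lessThan)
  ultimately show ?thesis by simp
qed

lemma reflected_arg_nonneg: "y \<le> 0 \<Longrightarrow> 0 \<le> - (b k * y)"
  using b[of k] by (simp add: mult_nonneg_nonpos)

lemma extension_nonneg:
  assumes "0 \<le> x $ 1"
  shows "extension j F x = F (pt (chart (x $ 1)) (x $ 2))"
proof (cases "x $ 1 = 0")
  case True
  have "summable (\<lambda>k. a k * (- b k) ^ j)"
    by (rule summable_rabs_cancel) (use weights_summable[of j] in \<open>simp add: abs_mult power_abs\<close>)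
  from suminf_mult2[OF this, of "F (pt (chart 0) (x $ 2))"]
  have "(\<Sum>k. a k * (- b k) ^ j * F (pt (chart 0) (x $ 2))) = F (pt (chart 0) (x $ 2))"
    unfolding weights_moment by simp
  then show ?thesis
    using True by (simp add: extension_def)
qed (use assms in \<open>simp add: extension_def\<close>)

lemma even_smooth_bounded:
  assumes "even_smooth F"
  shows "\<exists>M. \<forall>z t. 0 \<le> z \<longrightarrow> \<bar>t\<bar> < r \<longrightarrow> \<bar>F (pt (chart z) t)\<bar> \<le> M"
proof -
  let ?K = "(\<lambda>v. pt (fst v) (snd v)) ` ({- r..r} \<times> {- r..r})"
  have "compact ?K"
    by (intro compact_continuous_image compact_Times continuous_intros) auto
  moreover have "?K \<subseteq> sq R"
    using r by auto
  then have "continuous_on ?K F"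
    using assms smooth_on_continuous continuous_on_subset unfolding even_smooth_def by blast
  ultimately have "bounded (F ` ?K)"
    using compact_continuous_image compact_imp_bounded by blast
  then obtain M where M: "\<And>y. y \<in> F ` ?K \<Longrightarrow> norm y \<le> M"
    using bounded_iff by metis
  have "\<bar>F (pt (chart z) t)\<bar> \<le> M" if "0 \<le> z" "\<bar>t\<bar> < r" for z t
  proof -
    have "(chart z, t) \<in> {- r..r} \<times> {- r..r}"
      using chart_bounds[OF that(1)] that(2) r by auto
    then have "pt (chart z) t \<in> ?K"
      by (rule rev_image_eqI) simp
    then show ?thesis
      using M by fastforce
  qed
  then show ?thesis by blast
qed

lemma extension_uniform_limit:
  assumes "even_smooth F"
  shows "uniform_limit {x \<in> strip. x $ 1 \<le> 0}
    (\<lambda>n x. \<Sum>k<n. a k * (- b k) ^ j * F (pt (chart (- (b k * x $ 1))) (x $ 2))) (extension j F) sequentially"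
proof -
  obtain M where M: "\<forall>z t. 0 \<le> z \<longrightarrow> \<bar>t\<bar> < r \<longrightarrow> \<bar>F (pt (chart z) t)\<bar> \<le> M"
    using even_smooth_bounded[OF assms] ..
  let ?f = "\<lambda>k x. a k * (- b k) ^ j * F (pt (chart (- (b k * x $ 1))) (x $ 2))"
  have "uniform_limit {x \<in> strip. x $ 1 \<le> 0} (\<lambda>n x. \<Sum>k<n. ?f k x) (\<lambda>x. \<Sum>k. ?f k x) sequentially"
  proof (rule Weierstrass_m_test)
    show "summable (\<lambda>k. \<bar>a k * b k ^ j\<bar> * M)"
      by (intro summable_mult2 weights_summable)
    fix k and x :: "real^2" assume x: "x \<in> {x \<in> strip. x $ 1 \<le> 0}"
    have "\<bar>a k * (- b k) ^ j\<bar> * \<bar>F (pt (chart (- (b k * x $ 1))) (x $ 2))\<bar> \<le> \<bar>a k * (- b k) ^ j\<bar> * M"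
      using x reflected_arg_nonneg by (intro mult_left_mono M[rule_format]) (auto simp: strip_def)
    then show "norm (?f k x) \<le> \<bar>a k * b k ^ j\<bar> * M"
      by (simp add: abs_mult power_abs)
  qed
  moreover have "(\<Sum>k. ?f k x) = extension j F x" if "x \<in> {x \<in> strip. x $ 1 \<le> 0}" for x
    using that by (simp add: extension_def)
  ultimately show ?thesis
    by (subst uniform_limit_cong'[of _ _ _ _ "\<lambda>x. \<Sum>k. ?f k x"]) auto
qed

lemma continuous_on_even_chart:
  assumes "even_smooth F" "continuous_on S g" "\<And>x. x \<in> S \<Longrightarrow> 0 \<le> g x" "S \<subseteq> strip"
  shows "continuous_on S (\<lambda>x. F (pt (chart (g x)) (x $ 2)))"
proof (rule continuous_on_compose2[of "sq R" F])
  show "continuous_on (sq R) F"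
    using assms(1) smooth_on_continuous[of F] by (simp add: even_smooth_def)
  show "continuous_on S (\<lambda>x. pt (chart (g x)) (x $ 2))"
    by (intro continuous_intros continuous_on_compose2[OF continuous_on_chart assms(2)])
      (use assms(3) in auto)
  show "(\<lambda>x. pt (chart (g x)) (x $ 2)) ` S \<subseteq> sq R"
    using assms(3,4) chart_in_sq by (auto simp: strip_def simp del: pt_in_sq)
qed

lemma continuous_on_extension:
  assumes "even_smooth F"
  shows "continuous_on strip (extension j F)"
proof -
  have "continuous_on strip (\<lambda>x. if x $ 1 \<le> 0 then extension j F x else F (pt (chart (x $ 1)) (x $ 2)))"
  proof (rule continuous_on_cases_le[where h = "\<lambda>x. x $ 1"])
    show "continuous_on {x \<in> strip. x $ 1 \<le> 0} (extension j F)"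
    proof (rule uniform_limit_theorem[OF _ extension_uniform_limit[OF assms]])
      show "\<forall>\<^sub>F n in sequentially. continuous_on {x \<in> strip. x $ 1 \<le> 0}
          (\<lambda>x. \<Sum>k<n. a k * (- b k) ^ j * F (pt (chart (- (b k * x $ 1))) (x $ 2)))"
        by (intro always_eventually allI continuous_on_sum continuous_on_mult continuous_on_const
            continuous_on_even_chart[OF assms])
          (auto intro!: continuous_intros simp: mult_nonneg_nonpos b less_imp_le)
    qed simp
    show "continuous_on {x \<in> strip. 0 \<le> x $ 1} (\<lambda>x. F (pt (chart (x $ 1)) (x $ 2)))"
      by (rule continuous_on_even_chart[OF assms]) (auto intro!: continuous_intros)
    show "extension j F x = F (pt (chart (x $ 1)) (x $ 2))" if "x \<in> strip" "x $ 1 = 0" for x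
      using that by (simp add: extension_nonneg)
  qed (auto intro!: continuous_intros)
  then show ?thesis
    by (rule continuous_on_eq) (simp add: extension_nonneg)
qed

text \<open>Away from \<open>u = 0\<close> the partial derivatives are computed directly, respectively term by term.
  Raising \<open>j\<close> compensates for the inner derivative of \<open>- b k * u\<close>, and all moments of the weights
  being \<open>1\<close> makes the two sides fit together at \<open>u = 0\<close>.\<close>

lemma DERIV_extension_1:
  assumes F: "even_smooth F" and t: "\<bar>t\<bar> < r"
  shows "((\<lambda>u. extension j F (pt u t)) has_real_derivative
    extension (Suc j) (square_derivative F) (pt u t)) (at u)"
proof -
  note DF = even_smooth_square_derivative[OF F]
  have cont: "isCont (\<lambda>u. extension i G (pt u t)) u" if "even_smooth G" for i G u
  proof -
    have "continuous_on UNIV (\<lambda>u. extension i G (pt u t))"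
      by (rule continuous_on_compose2[OF continuous_on_extension[OF that]])
        (use t in \<open>auto simp: strip_def intro!: continuous_intros\<close>)
    then show ?thesis
      by (simp add: continuous_on_eq_continuous_at)
  qed
  show ?thesis
  proof (rule DERIV_removable[OF cont[OF F] cont[OF DF]])
    fix u :: real assume "u \<noteq> 0"
    then consider "u > 0" | "u < 0" by linarith
    then show "((\<lambda>u. extension j F (pt u t)) has_real_derivative
        extension (Suc j) (square_derivative F) (pt u t)) (at u)"
    proof cases
      case 1
      have "((\<lambda>u. extension j F (pt u t)) has_real_derivative square_derivative F (pt (chart u) t)) (at u)"
      proof (rule has_field_derivative_transform_within_open[OF DERIV_even_chart[OF F 1 t]])
        show "open {0::real<..}" by simp
      qed (use 1 in \<open>auto simp: extension_def\<close>)
      then show ?thesis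
        using 1 by (simp add: extension_def)
    next
      case 2
      let ?f = "\<lambda>k u. a k * (- b k) ^ j * F (pt (chart (- (b k * u))) t)"
      let ?f' = "\<lambda>k u. a k * (- b k) ^ Suc j * square_derivative F (pt (chart (- (b k * u))) t)"
      have D: "(?f k has_real_derivative ?f' k u) (at u)" if "u < 0" for k u
      proof -
        have "0 < - (b k * u)" using b[of k] that by (simp add: mult_pos_neg)
        then have "((\<lambda>u. F (pt (chart (- (b k * u))) t)) has_real_derivative
            square_derivative F (pt (chart (- (b k * u))) t) * (- b k)) (at u)"
          by (intro DERIV_chain2[OF DERIV_even_chart[OF F _ t]]) (auto intro!: derivative_eq_intros)
        from DERIV_cmult[OF this, of "a k * (- b k) ^ j"] show ?thesis
          by (simp add: mult_ac)
      qed
      have UC: "uniformly_convergent_on {..<0} (\<lambda>n u. \<Sum>k<n. ?f' k u)"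
      proof -
        have "uniform_limit ((\<lambda>u. pt u t) ` {..<0}) (\<lambda>n x. \<Sum>k<n. a k * (- b k) ^ Suc j *
            square_derivative F (pt (chart (- (b k * x $ 1))) (x $ 2))) (extension (Suc j) (square_derivative F)) sequentially"
          by (rule uniform_limit_on_subset[OF extension_uniform_limit[OF DF]]) (use t in \<open>auto simp: strip_def\<close>)
        then show ?thesis
          unfolding uniformly_convergent_on_def uniform_limit_iff by (intro exI[of _ "\<lambda>u. extension (Suc j) (square_derivative F) (pt u t)"]) auto
      qed
      have SU: "summable (\<lambda>k. ?f k u)"
      proof -
        have "(\<lambda>n. \<Sum>k<n. ?f k u) \<longlonglongrightarrow> extension j F (pt u t)"
          using tendsto_uniform_limitI[OF extension_uniform_limit[OF F], of "pt u t" j] 2 t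
          by (simp add: strip_def)
        then show ?thesis
          by (auto simp: summable_def sums_def)
      qed
      have "((\<lambda>u. \<Sum>k. ?f k u) has_real_derivative (\<Sum>k. ?f' k u)) (at u)"
      proof (rule has_field_derivative_series'(2)[where f = ?f and f' = ?f' and ?x0.0 = u, OF _ _ UC _ SU])
        show "(?f k has_real_derivative ?f' k v) (at v within {..<0})" if "v \<in> {..<0}" for k v
          using that by (intro has_field_derivative_at_within[OF D]) simp
      qed (use 2 in \<open>auto simp: interior_open\<close>)
      then have "((\<lambda>u. extension j F (pt u t)) has_real_derivative (\<Sum>k. ?f' k u)) (at u)"
      proof (rule has_field_derivative_transform_within_open)
        show "open {..<0::real}" by simp
      qed (use 2 in \<open>auto simp: extension_def\<close>)
      then show ?thesis
        using 2 by (simp add: extension_def)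
    qed
  qed
qed

lemma DERIV_extension_2:
  assumes F: "even_smooth F" and t: "\<bar>t\<bar> < r"
  shows "((\<lambda>t. extension j F (pt u t)) has_real_derivative extension j (pd2 F) (pt u t)) (at t)"
proof -
  have smooth: "smooth_on F (sq R)" using F by (simp add: even_smooth_def)
  have D: "((\<lambda>t. F (pt (chart z) t)) has_real_derivative pd2 F (pt (chart z) t)) (at t)"
    if "0 \<le> z" "\<bar>t\<bar> < r" for z t
    by (rule DERIV_pd2[OF smooth chart_in_sq[OF that]])
  show ?thesis
  proof (cases "u \<ge> 0")
    case True
    then show ?thesis
      using D[OF True t] by (simp add: extension_nonneg)
  next
    case False
    let ?f = "\<lambda>k t. a k * (- b k) ^ j * F (pt (chart (- (b k * u))) t)"
    let ?f' = "\<lambda>k t. a k * (- b k) ^ j * pd2 F (pt (chart (- (b k * u))) t)"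
    have UC: "uniformly_convergent_on {- r<..<r} (\<lambda>n t. \<Sum>k<n. ?f' k t)"
    proof -
      have "uniform_limit (pt u ` {- r<..<r}) (\<lambda>n x. \<Sum>k<n. a k * (- b k) ^ j *
          pd2 F (pt (chart (- (b k * x $ 1))) (x $ 2))) (extension j (pd2 F)) sequentially"
        by (rule uniform_limit_on_subset[OF extension_uniform_limit[OF even_smooth_pd2[OF F]]])
          (use False in \<open>auto simp: strip_def\<close>)
      then show ?thesis
        unfolding uniformly_convergent_on_def uniform_limit_iff
        by (intro exI[of _ "\<lambda>t. extension j (pd2 F) (pt u t)"]) auto
    qed
    have SU: "summable (\<lambda>k. ?f k t)"
    proof -
      have "(\<lambda>n. \<Sum>k<n. ?f k t) \<longlonglongrightarrow> extension j F (pt u t)"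
        using tendsto_uniform_limitI[OF extension_uniform_limit[OF F], of "pt u t" j] False t
        by (simp add: strip_def)
      then show ?thesis
        by (auto simp: summable_def sums_def)
    qed
    have "((\<lambda>t. \<Sum>k. ?f k t) has_real_derivative (\<Sum>k. ?f' k t)) (at t)"
    proof (rule has_field_derivative_series'(2)[where f = ?f and f' = ?f' and ?x0.0 = t, OF _ _ UC _ SU])
      show "(?f k has_real_derivative ?f' k s) (at s within {- r<..<r})" if "s \<in> {- r<..<r}" for k s
        by (rule has_field_derivative_at_within[OF DERIV_cmult[OF D[OF reflected_arg_nonneg]]])
          (use False that in auto)
    qed (use t in \<open>auto simp: interior_open abs_less_iff\<close>)
    then show ?thesis
      using False by (simp add: extension_def)
  qed
qed

lemma smooth_on_extension:
  assumes "even_smooth F"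
  shows "smooth_on (extension j F) strip"
proof (rule smooth_onI)
  fix k
  show "Ck_on k (extension j F) strip"
    using assms
  proof (induction k arbitrary: F j)
    case 0
    then show ?case by (simp add: continuous_on_extension)
  next
    case (Suc k)
    note F1 = even_smooth_square_derivative[OF Suc.prems] and F2 = even_smooth_pd2[OF Suc.prems]
    show ?case
    proof (rule Ck_on_SucI[OF open_strip])
      show "(extension j F has_derivative (\<lambda>v. v $ 1 * extension (Suc j) (square_derivative F) x
          + v $ 2 * extension j (pd2 F) x)) (at x)" if "x \<in> strip" for x
        by (rule has_derivative_from_partials[OF open_strip that continuous_on_extension[OF F1]
            continuous_on_extension[OF F2] DERIV_extension_1[OF Suc.prems] DERIV_extension_2[OF Suc.prems]])
          (simp_all add: strip_def)
      show "Ck_on k (\<lambda>x. v $ 1 * extension (Suc j) (square_derivative F) x + v $ 2 * extension j (pd2 F) x) strip" for v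
        by (intro Ck_on_add[OF open_strip] Ck_on_bounded_bilinear[OF open_strip bounded_bilinear_mult]
            Ck_on_const Suc.IH F1 F2)
    qed
  qed
qed

end

text \<open>The extension is a function of \<open>z\<close>, and \<open>u\<^sup>2 = r\<^sup>2 z / (1 + z)\<close> is solved by
  \<open>z = u\<^sup>2 / (r\<^sup>2 - u\<^sup>2)\<close>.\<close>

lemma whitney_even:
  fixes F :: "real^2 \<Rightarrow> real"
  assumes R: "0 < R" and F: "smooth_on F (sq R)"
    and even: "\<And>u t. \<bar>u\<bar> < R \<Longrightarrow> \<bar>t\<bar> < R \<Longrightarrow> F (pt (- u) t) = F (pt u t)"
  shows "\<exists>\<delta>>0. \<exists>A. smooth_on A (sq \<delta>) \<and> (\<forall>u t. \<bar>u\<bar> < \<delta> \<longrightarrow> \<bar>t\<bar> < \<delta> \<longrightarrow> F (pt u t) = A (pt (u\<^sup>2) t))"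
proof -
  obtain a b :: "nat \<Rightarrow> real" where ab: "\<forall>k. b k > 0" "\<forall>j. summable (\<lambda>k. \<bar>a k * b k ^ j\<bar>)"
    "\<forall>j. (\<Sum>k. a k * (- b k) ^ j) = 1"
    using alternating_moment_weights by blast
  define r where "r = R / 2"
  interpret seeley_extension r R a b
    using R ab by unfold_locales (auto simp: r_def)
  have eF: "even_smooth F"
    using F even by (simp add: even_smooth_def)
  define A where "A x = extension 0 F (pt (x $ 1 / (r\<^sup>2 - x $ 1)) (x $ 2))" for x :: "real^2"
  define \<delta> where "\<delta> = min r (r\<^sup>2)"
  have \<delta>: "0 < \<delta>" "\<delta> \<le> r" "\<delta> \<le> r\<^sup>2"
    using r by (simp_all add: \<delta>_def)
  have "smooth_on A (sq \<delta>)"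
    unfolding A_def[abs_def]
  proof (rule smooth_on_compose[OF smooth_on_extension[OF eF] _ open_sq open_strip])
    show "smooth_on (\<lambda>x. pt (x $ 1 / (r\<^sup>2 - x $ 1)) (x $ 2)) (sq \<delta>)"
      using \<delta> by (intro smooth_on_pt smooth_intros open_sq) (auto simp: sq_def)
  qed (use \<delta> in \<open>auto simp: strip_def sq_def\<close>)
  moreover have "F (pt u t) = A (pt (u\<^sup>2) t)" if ut: "\<bar>u\<bar> < \<delta>" "\<bar>t\<bar> < \<delta>" for u t
  proof -
    have u: "\<bar>u\<bar> < r" using ut \<delta> by simp
    then have u2: "u\<^sup>2 < r\<^sup>2"
      using abs_le_square_iff[of r u] r by (simp add: not_le[symmetric])
    let ?y = "u\<^sup>2 / (r\<^sup>2 - u\<^sup>2)"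
    have y: "0 \<le> ?y" using u2 by simp
    have "1 + ?y = r\<^sup>2 / (r\<^sup>2 - u\<^sup>2)"
      using u2 by (simp add: field_simps)
    then have "?y / (1 + ?y) = u\<^sup>2 / r\<^sup>2"
      using u2 by simp
    then have "chart ?y = r * sqrt (u\<^sup>2 / r\<^sup>2)"
      by (simp only: seeley_chart_def)
    also have "\<dots> = \<bar>u\<bar>"
      using r by (simp add: real_sqrt_divide)
    finally have "chart ?y = \<bar>u\<bar>" .
    then have "A (pt (u\<^sup>2) t) = F (pt \<bar>u\<bar> t)"
      using y by (simp add: A_def extension_nonneg)
    also have "\<dots> = F (pt u t)"
      using even[of u t] u ut \<delta> r by (auto simp: abs_if)
    finally show ?thesis ..
  qed
  ultimately show ?thesis
    using \<delta>(1) by blast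
qed

lemma whitney_even_odd:
  fixes F :: "real^2 \<Rightarrow> real"
  assumes R: "0 < R" and F: "smooth_on F (sq R)"
  shows "\<exists>\<delta>>0. \<exists>A B. smooth_on A (sq \<delta>) \<and> smooth_on B (sq \<delta>) \<and>
    (\<forall>u t. \<bar>u\<bar> < \<delta> \<longrightarrow> \<bar>t\<bar> < \<delta> \<longrightarrow> F (pt u t) = A (pt (u\<^sup>2) t) + u * B (pt (u\<^sup>2) t))"
proof -
  let ?m = "\<lambda>x :: real^2. pt (- x $ 1) (x $ 2)"
  have m: "smooth_on (\<lambda>x. F (?m x)) (sq R)"
  proof (rule smooth_on_compose[OF F _ open_sq open_sq])
    show "smooth_on ?m (sq R)"
      by (intro smooth_on_pt smooth_intros open_sq)
  qed (auto simp: sq_def)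
  define E where "E x = (F x + F (?m x)) / 2" for x
  define O' where "O' x = (F x - F (?m x)) / 2" for x
  have E: "smooth_on E (sq R)" and O': "smooth_on O' (sq R)"
    unfolding E_def[abs_def] O'_def[abs_def] by (intro smooth_intros F m open_sq; simp)+
  let ?Q = "hadamard_quotient O'"
  have Q: "O' (pt u t) = u * ?Q (pt u t)" if "\<bar>u\<bar> < R" "\<bar>t\<bar> < R" for u t
    using hadamard_quotient[OF O', of "pt u t"] that by (simp add: O'_def)
  obtain \<delta>1 A where A: "\<delta>1 > 0" "smooth_on A (sq \<delta>1)"
    "\<forall>u t. \<bar>u\<bar> < \<delta>1 \<longrightarrow> \<bar>t\<bar> < \<delta>1 \<longrightarrow> E (pt u t) = A (pt (u\<^sup>2) t)"
    using whitney_even[OF R E] by (auto simp: E_def)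
  have "?Q (pt (- u) t) = ?Q (pt u t)" if "\<bar>u\<bar> < R" "\<bar>t\<bar> < R" for u t
  proof (cases "u = 0")
    case False
    have "O' (pt (- u) t) = - O' (pt u t)"
      by (simp add: O'_def field_simps)
    then have "- u * ?Q (pt (- u) t) = - (u * ?Q (pt u t))"
      using Q[of u t] Q[of "- u" t] that by linarith
    with False show ?thesis by simp
  qed simp
  then obtain \<delta>2 B where B: "\<delta>2 > 0" "smooth_on B (sq \<delta>2)"
    "\<forall>u t. \<bar>u\<bar> < \<delta>2 \<longrightarrow> \<bar>t\<bar> < \<delta>2 \<longrightarrow> ?Q (pt u t) = B (pt (u\<^sup>2) t)"
    using whitney_even[OF R smooth_on_hadamard_quotient[OF O']] by blast
  define \<delta> where "\<delta> = min R (min \<delta>1 \<delta>2)"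
  have "smooth_on A (sq \<delta>)" "smooth_on B (sq \<delta>)"
    by (rule smooth_on_subset[OF A(2) sq_mono] smooth_on_subset[OF B(2) sq_mono]; simp add: \<delta>_def)+
  moreover have "F (pt u t) = A (pt (u\<^sup>2) t) + u * B (pt (u\<^sup>2) t)" if "\<bar>u\<bar> < \<delta>" "\<bar>t\<bar> < \<delta>" for u t
  proof -
    have "F (pt u t) = E (pt u t) + O' (pt u t)"
      by (simp add: E_def O'_def field_simps)
    then show ?thesis
      using that A(3) B(3) Q[of u t] by (simp add: \<delta>_def)
  qed
  moreover have "\<delta> > 0"
    using R A(1) B(1) by (simp add: \<delta>_def)
  ultimately show ?thesis by blast
qed

section \<open>A normal form for wave fronts with a parameter\<close>

text \<open>A map that keeps the second coordinate is a diffeomorphism germ as soon as its first component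
  is a submersion along the first axis.\<close>

lemma diffeo_germ_shear:
  assumes N: "open N" "0 \<in> N" and \<alpha>: "smooth_on \<alpha> N" "\<alpha> 0 = 0" "pd1 \<alpha> 0 \<noteq> 0"
  shows "diffeo_germ (\<lambda>x. pt (\<alpha> x) (x $ 2)) 0 0"
proof -
  let ?\<phi> = "\<lambda>x. pt (\<alpha> x) (x $ 2)"
  have D: "(?\<phi> has_derivative (\<lambda>v. pt (v $ 1 * pd1 \<alpha> 0 + v $ 2 * pd2 \<alpha> 0) (v $ 2))) (at 0)"
    by (intro has_derivative_pt has_derivative_partials[OF \<alpha>(1) N(2)] has_derivative_nth has_derivative_ident)
  have "surj (\<lambda>v :: real^2. pt (v $ 1 * pd1 \<alpha> 0 + v $ 2 * pd2 \<alpha> 0) (v $ 2))"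
  proof (rule surjI)
    fix w :: "real^2"
    let ?v = "pt ((w $ 1 - w $ 2 * pd2 \<alpha> 0) / pd1 \<alpha> 0) (w $ 2)"
    show "pt (?v $ 1 * pd1 \<alpha> 0 + ?v $ 2 * pd2 \<alpha> 0) (?v $ 2) = w"
      using \<alpha>(3) by (simp add: vec_eq_iff forall_2)
  qed
  then have "surj (frechet_derivative ?\<phi> (at 0))"
    unfolding frechet_derivative_at[OF D, symmetric] .
  moreover have "smooth_on ?\<phi> N"
    by (intro smooth_on_pt smooth_intros \<alpha>(1) N(1))
  ultimately have "diffeo_germ ?\<phi> 0 (?\<phi> 0)"
    using smooth_inverse_function[OF N] by blast
  then show ?thesis
    using \<alpha>(2) by simp
qed

text \<open>A fold with a parameter: the critical points of the functions \<open>S(\<cdot>, t)\<close> form a smooth curve,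
  which is moved to \<open>u = 0\<close>; two divisions by \<open>u\<close> then exhibit \<open>S\<close> as a function of \<open>t\<close> plus
  \<open>u\<^sup>2\<close> times a function without zeros, whose square root is absorbed into the coordinate.\<close>

lemma fold_normal_form:
  assumes N: "open N" "0 \<in> N" and S: "smooth_on S N" and S1: "pd1 S 0 = 0" and S11: "pd1 (pd1 S) 0 \<noteq> 0"
  shows "\<exists>\<psi> \<epsilon> C \<delta>. diffeo_germ \<psi> 0 0 \<and> 0 < \<delta> \<and> \<bar>\<epsilon>\<bar> = 1 \<and> smooth_on \<psi> (sq \<delta>) \<and>
    smooth_on (\<lambda>y. C (y $ 2)) (sq \<delta>) \<and>
    (\<forall>y\<in>sq \<delta>. \<psi> y \<in> N \<and> \<psi> y $ 2 = y $ 2 \<and> S (\<psi> y) = C (y $ 2) + \<epsilon> * (y $ 1)\<^sup>2)"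
proof -
  have germ_pd1: "diffeo_germ (\<lambda>x. pt (pd1 S x) (x $ 2)) 0 0"
    by (rule diffeo_germ_shear[OF N smooth_on_derivative[OF S] S1 S11])
  obtain V W H where H: "open V" "open W" "0 \<in> V" "0 \<in> W" "H 0 = 0" "smooth_on H W"
    "\<forall>y\<in>W. H y \<in> V \<and> pt (pd1 S (H y)) (H y $ 2) = y"
    using diffeo_germD[OF germ_pd1] by blast
  obtain R1 where R1: "R1 > 0" "sq R1 \<subseteq> W"
    using sq_subset_nbhd[OF H(2,4)] by blast
  \<comment> \<open>\<open>crit t\<close> is the critical point of \<open>S(\<cdot>, t)\<close> near \<open>0\<close>.\<close>
  define crit where "crit t = H (pt 0 t) $ 1" for t
  have crit: "pd1 S (pt (crit t) t) = 0" if "\<bar>t\<bar> < R1" for t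
  proof -
    have "pt 0 t \<in> W" using R1 that by auto
    then have *: "pt (pd1 S (H (pt 0 t))) (H (pt 0 t) $ 2) = pt 0 t"
      using H(7) by blast
    then have "H (pt 0 t) = pt (crit t) t"
      by (metis crit_def pt_collapse pt_nth(2))
    with * show ?thesis
      by (metis pt_nth(1))
  qed
  have crit_0: "crit 0 = 0"
    by (simp add: crit_def H(5))
  have crit_smooth: "smooth_on (\<lambda>x. crit (x $ 2)) (sq R1)"
  proof -
    have "smooth_on (\<lambda>x. H (pt 0 (x $ 2))) (sq R1)"
    proof (rule smooth_on_compose[OF H(6) _ open_sq H(2)])
      show "smooth_on (\<lambda>x. pt 0 (x $ 2)) (sq R1)"
        by (intro smooth_on_pt smooth_intros open_sq)
    qed (use R1 in \<open>auto simp: sq_def\<close>)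
    then show ?thesis
      unfolding crit_def by (intro smooth_on_nth open_sq)
  qed
  define shift where "shift x = pt (x $ 1 + crit (x $ 2)) (x $ 2)" for x :: "real^2"
  have shift: "smooth_on shift (sq R1)"
    unfolding shift_def[abs_def] by (intro smooth_on_pt smooth_intros crit_smooth open_sq)
  have "open (sq R1 \<inter> shift -` N)"
    by (rule continuous_open_preimage[OF smooth_on_continuous[OF shift] open_sq N(1)])
  moreover have "0 \<in> sq R1 \<inter> shift -` N"
    using R1 N crit_0 pt_in_sq[of 0 0 R1] by (simp add: shift_def)
  ultimately obtain R where R: "R > 0" "sq R \<subseteq> sq R1 \<inter> shift -` N"
    using sq_subset_nbhd by blast
  have R_le: "\<bar>t\<bar> < R1" if "\<bar>t\<bar> < R" for t
  proof -
    have "pt 0 t \<in> sq R" using R(1) that by simp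
    then have "pt 0 t \<in> sq R1" using R(2) by blast
    then show ?thesis by simp
  qed
  define T where "T x = S (shift x)" for x
  have T: "smooth_on T (sq R)"
    unfolding T_def[abs_def]
    by (rule smooth_on_compose[OF S smooth_on_subset[OF shift] open_sq N(1)]) (use R in auto)
  have T1: "pd1 T (pt 0 t) = 0" if t: "\<bar>t\<bar> < R" for t
  proof -
    have in_N: "pt (0 + crit t) t \<in> N"
      using R(2) pt_in_sq[of 0 t R] t R(1) by (auto simp: shift_def simp del: pt_in_sq)
    have "((\<lambda>u. S (pt (u + crit t) t)) has_real_derivative
        1 * pd1 S (pt (0 + crit t) t) + 0 * pd2 S (pt (0 + crit t) t)) (at 0)"
      by (rule DERIV_pt[where a = "\<lambda>u. u + crit t" and b = "\<lambda>_. t", OF S in_N])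
        (auto intro!: derivative_eq_intros)
    moreover have "((\<lambda>u. S (pt (u + crit t) t)) has_real_derivative pd1 T (pt 0 t)) (at 0)"
      using DERIV_pd1[OF T, of 0 t] t R(1) by (simp add: T_def shift_def)
    ultimately have "1 * pd1 S (pt (0 + crit t) t) + 0 * pd2 S (pt (0 + crit t) t) = pd1 T (pt 0 t)"
      by (rule DERIV_unique)
    then show ?thesis
      using crit[OF R_le[OF t]] by simp
  qed
  define G where "G = hadamard_quotient (hadamard_quotient T)"
  have G: "smooth_on G (sq R)"
    unfolding G_def by (intro smooth_on_hadamard_quotient T)
  have T_eq: "T x = T (pt 0 (x $ 2)) + (x $ 1)\<^sup>2 * G x" if "x \<in> sq R" for x
  proof -
    have "hadamard_quotient T (pt 0 (x $ 2)) = 0"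
      using T1[of "x $ 2"] that by (simp add: hadamard_quotient_0 sq_def)
    then show ?thesis
      using hadamard_quotient[OF T that] hadamard_quotient[OF smooth_on_hadamard_quotient[OF T] that]
      by (simp add: G_def power2_eq_square)
  qed
  have G0: "pd1 (pd1 S) 0 = 2 * G 0"
  proof -
    have eq: "pd1 T (pt u 0) = pd1 S (pt u 0)" if u: "\<bar>u\<bar> < R" for u
    proof -
      have in_sq: "pt u 0 \<in> sq R" using u R(1) by simp
      then have in_N: "pt u 0 \<in> N"
        using R(2) by (auto simp: shift_def crit_0 simp del: pt_in_sq)
      have "((\<lambda>u. T (pt u 0)) has_real_derivative pd1 S (pt u 0)) (at u)"
        using DERIV_pd1[OF S in_N] by (simp add: T_def shift_def crit_0)
      from DERIV_unique[OF DERIV_pd1[OF T in_sq] this] show ?thesis .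
    qed
    have "((\<lambda>u. pd1 T (pt u 0)) has_real_derivative pd1 (pd1 S) (pt 0 0)) (at 0)"
    proof (rule has_field_derivative_transform_within_open)
      show "((\<lambda>u. pd1 S (pt u 0)) has_real_derivative pd1 (pd1 S) (pt 0 0)) (at 0)"
        by (rule DERIV_pd1[OF smooth_on_derivative[OF S]]) (use N in simp)
      show "open {- R<..<R}" "0 \<in> {- R<..<R}" using R(1) by auto
    qed (use eq in \<open>auto simp: abs_less_iff\<close>)
    moreover have "((\<lambda>u. pd1 T (pt u 0)) has_real_derivative pd1 (pd1 T) (pt 0 0)) (at 0)"
      by (rule DERIV_pd1[OF smooth_on_derivative[OF T]]) (use R(1) in \<open>simp add: zero_in_sq\<close>)
    ultimately have "pd1 (pd1 S) (pt 0 0) = pd1 (pd1 T) (pt 0 0)"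
      by (rule DERIV_unique)
    then show ?thesis
      using pd1_pd1_hadamard[OF R(1) T] by (simp add: G_def)
  qed
  define \<epsilon> where "\<epsilon> = sgn (G 0)"
  have \<epsilon>: "\<bar>\<epsilon>\<bar> = 1" "\<epsilon> * \<epsilon> = 1" "\<epsilon> * G 0 > 0"
    using S11 G0 by (auto simp: \<epsilon>_def sgn_if)
  have "open (sq R \<inter> (\<lambda>x. \<epsilon> * G x) -` {0<..})"
    by (rule continuous_open_preimage[OF _ open_sq])
      (use G smooth_on_continuous in \<open>auto intro!: continuous_intros\<close>)
  moreover have "0 \<in> sq R \<inter> (\<lambda>x. \<epsilon> * G x) -` {0<..}"
    using R \<epsilon>(3) zero_in_sq by simp
  ultimately obtain R2 where R2: "R2 > 0" "sq R2 \<subseteq> sq R \<inter> (\<lambda>x. \<epsilon> * G x) -` {0<..}"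
    using sq_subset_nbhd by blast
  let ?\<alpha> = "\<lambda>x. x $ 1 * sqrt (\<epsilon> * G x)"
  have sqrt_smooth: "smooth_on (\<lambda>x. sqrt (\<epsilon> * G x)) (sq R2)"
    by (rule smooth_on_sqrt)
      (use R2 in \<open>auto intro!: smooth_intros smooth_on_subset[OF G] open_sq\<close>)
  then have \<alpha>: "smooth_on ?\<alpha> (sq R2)"
    by (intro smooth_on_mult smooth_on_nth smooth_on_id open_sq)
  have 0: "0 \<in> sq R2" using R2(1) pt_in_sq[of 0 0 R2] by simp
  have "pd1 ?\<alpha> 0 = sqrt (\<epsilon> * G 0)"
  proof -
    have "isCont (\<lambda>u. sqrt (\<epsilon> * G (pt u 0))) 0"
      using DERIV_isCont[OF DERIV_pd1[OF sqrt_smooth, of 0 0]] 0 by simp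
    from DERIV_id_mult[OF this] have "((\<lambda>u. ?\<alpha> (pt u 0)) has_real_derivative sqrt (\<epsilon> * G 0)) (at 0)"
      by simp
    moreover have "((\<lambda>u. ?\<alpha> (pt u 0)) has_real_derivative pd1 ?\<alpha> (pt 0 0)) (at 0)"
      by (rule DERIV_pd1[OF \<alpha>]) (use 0 in simp)
    ultimately have "sqrt (\<epsilon> * G 0) = pd1 ?\<alpha> (pt 0 0)"
      by (rule DERIV_unique)
    then show ?thesis by simp
  qed
  then have "pd1 ?\<alpha> 0 \<noteq> 0" using \<epsilon>(3) by (auto simp: zero_less_mult_iff)
  then have "diffeo_germ (\<lambda>x. pt (?\<alpha> x) (x $ 2)) 0 0"
    by (intro diffeo_germ_shear[OF open_sq 0 \<alpha>]) auto
  then obtain \<psi> where \<psi>: "diffeo_germ \<psi> 0 0" "\<forall>\<^sub>F y in nhds 0. pt (?\<alpha> (\<psi> y)) (\<psi> y $ 2) = y"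
    using diffeo_germ_inverse by blast
  obtain V' where V': "open V'" "0 \<in> V'" "smooth_on \<psi> V'" "\<psi> 0 = 0"
    using diffeo_germD[OF \<psi>(1)] by blast
  have "\<forall>\<^sub>F y in nhds 0. \<psi> y \<in> sq R2"
    by (rule eventually_compose_filterlim[OF eventually_nhds_in_open[OF open_sq 0] diffeo_germ_filterlim[OF \<psi>(1)]])
  moreover have "\<forall>\<^sub>F y in nhds 0. y \<in> V'"
    by (rule eventually_nhds_in_open[OF V'(1,2)])
  moreover have "\<forall>\<^sub>F y in nhds 0. y \<in> sq R"
    by (rule eventually_nhds_in_open[OF open_sq]) (use R pt_in_sq[of 0 0 R] in simp)
  ultimately have "\<forall>\<^sub>F y in nhds 0. \<psi> y \<in> sq R2 \<and> y \<in> V' \<and> y \<in> sq R \<and> pt (?\<alpha> (\<psi> y)) (\<psi> y $ 2) = y"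
    using \<psi>(2) by eventually_elim auto
  then obtain V'' where V'': "open V''" "0 \<in> V''"
    "\<forall>y\<in>V''. \<psi> y \<in> sq R2 \<and> y \<in> V' \<and> y \<in> sq R \<and> pt (?\<alpha> (\<psi> y)) (\<psi> y $ 2) = y"
    unfolding eventually_nhds by blast
  obtain \<delta> where \<delta>: "\<delta> > 0" "sq \<delta> \<subseteq> V''"
    using sq_subset_nbhd[OF V''(1,2)] by blast
  have on_\<delta>: "\<psi> y \<in> sq R2" "y \<in> V'" "y \<in> sq R" "?\<alpha> (\<psi> y) = y $ 1" "\<psi> y $ 2 = y $ 2" if "y \<in> sq \<delta>" for y
  proof -
    have "pt (?\<alpha> (\<psi> y)) (\<psi> y $ 2) = y"
      using V''(3) \<delta>(2) that by blast
    from arg_cong[OF this, of "\<lambda>v. v $ 1"] arg_cong[OF this, of "\<lambda>v. v $ 2"]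
    show "?\<alpha> (\<psi> y) = y $ 1" "\<psi> y $ 2 = y $ 2" by simp_all
  qed (use V''(3) \<delta>(2) that in blast)+
  have "pd1 (\<lambda>x. x $ 1 + crit (x $ 2)) 0 = 1"
  proof -
    have "((\<lambda>u. u) has_real_derivative pd1 (\<lambda>x. x $ 1 + crit (x $ 2)) 0) (at 0)"
      using DERIV_pd1[of "\<lambda>x. x $ 1 + crit (x $ 2)" "sq R1" 0 0] R1 crit_0
        smooth_on_add[OF smooth_on_nth[OF smooth_on_id[OF open_sq] open_sq] crit_smooth open_sq, of 1]
      by (simp add: zero_in_sq)
    from DERIV_unique[OF this DERIV_ident] show ?thesis .
  qed
  then have "diffeo_germ shift 0 0"
    unfolding shift_def[abs_def] using crit_0 R1 pt_in_sq[of 0 0 R1]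
    by (intro diffeo_germ_shear[OF open_sq, of R1] smooth_intros crit_smooth open_sq) auto
  then have germ: "diffeo_germ (\<lambda>y. shift (\<psi> y)) 0 0"
    by (rule diffeo_germ_compose[OF \<psi>(1)])
  have smooth: "smooth_on (\<lambda>y. shift (\<psi> y)) (sq \<delta>)"
    by (rule smooth_on_compose[OF shift smooth_on_subset[OF V'(3)] open_sq open_sq])
      (use on_\<delta> R2 R in blast)+
  define C where "C t = T (pt 0 t)" for t
  have "smooth_on (\<lambda>y. C (y $ 2)) (sq \<delta>)"
    unfolding C_def
  proof (rule smooth_on_compose[OF T _ open_sq open_sq])
    show "smooth_on (\<lambda>y. pt 0 (y $ 2)) (sq \<delta>)"
      by (intro smooth_on_pt smooth_intros open_sq)
  qed (use on_\<delta>(3) R(1) in \<open>auto simp: sq_def\<close>)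
  moreover have "shift (\<psi> y) \<in> N \<and> shift (\<psi> y) $ 2 = y $ 2 \<and> S (shift (\<psi> y)) = C (y $ 2) + \<epsilon> * (y $ 1)\<^sup>2"
    if y: "y \<in> sq \<delta>" for y
  proof -
    have in_R: "\<psi> y \<in> sq R" and pos: "\<epsilon> * G (\<psi> y) > 0"
      using on_\<delta>(1)[OF y] R2(2) by auto
    have "\<epsilon> * (y $ 1)\<^sup>2 = \<epsilon> * ((\<psi> y $ 1)\<^sup>2 * (\<epsilon> * G (\<psi> y)))"
      using pos by (simp add: on_\<delta>(4)[OF y, symmetric] power_mult_distrib)
    also have "\<dots> = (\<epsilon> * \<epsilon>) * ((\<psi> y $ 1)\<^sup>2 * G (\<psi> y))"
      by (simp add: mult_ac)
    finally have "S (shift (\<psi> y)) = C (y $ 2) + \<epsilon> * (y $ 1)\<^sup>2"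
      using T_eq[OF in_R] on_\<delta>(5)[OF y] \<epsilon>(2) by (simp add: T_def C_def)
    moreover have "shift (\<psi> y) \<in> N" using in_R R(2) by blast
    ultimately show ?thesis
      using on_\<delta>(5)[OF y] by (simp add: shift_def)
  qed
  ultimately show ?thesis
    using germ \<delta>(1) \<epsilon>(1) smooth by blast
qed

text \<open>After the fold \<open>S\<close> has been normalized to \<open>C(t) \<plusminus> u\<^sup>2\<close>, the function \<open>K\<close> has even and odd part
  in \<open>u\<close>, both smooth in \<open>(u\<^sup>2, t)\<close>.  The even part and the factor of the odd part are removed
  by a diffeomorphism of the target; what has to be shown is that the odd part has order exactly
  three.\<close>

theorem cuspidal_edge_normal_form:
  fixes S K :: "real^2 \<Rightarrow> real"
  assumes N: "open N" "0 \<in> N" and S: "smooth_on S N" and K: "smooth_on K N"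
    and KS: "\<And>x. x \<in> N \<Longrightarrow> pd1 K x = x $ 1 * pd1 S x"
    and S1: "pd1 S 0 = 0" and S11: "pd1 (pd1 S) 0 \<noteq> 0"
  shows "cuspidal_edge_at (\<lambda>x. vector [x $ 2, S x, K x]) 0"
proof -
  obtain \<psi> \<epsilon> C \<delta> where \<psi>: "diffeo_germ \<psi> 0 0" and \<delta>: "0 < \<delta>" and \<epsilon>: "\<bar>\<epsilon>\<bar> = 1"
    and smooth_\<psi>: "smooth_on \<psi> (sq \<delta>)" and C: "smooth_on (\<lambda>y. C (y $ 2)) (sq \<delta>)"
    and fold: "\<forall>y\<in>sq \<delta>. \<psi> y \<in> N \<and> \<psi> y $ 2 = y $ 2 \<and> S (\<psi> y) = C (y $ 2) + \<epsilon> * (y $ 1)\<^sup>2"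
    using fold_normal_form[OF N S S1 S11] by blast
  have \<epsilon>2: "\<epsilon> * \<epsilon> = 1" "\<epsilon> \<noteq> 0"
    using \<epsilon> by (auto simp: abs_if split: if_splits)
  have \<psi>0: "\<psi> 0 = 0"
    using \<psi> by (simp add: diffeo_germ_def)
  define a where "a y = \<psi> y $ 1" for y
  have a: "smooth_on a (sq \<delta>)"
    unfolding a_def[abs_def] by (intro smooth_on_nth smooth_\<psi> open_sq)
  have \<psi>_eq: "\<psi> y = pt (a y) (y $ 2)" if "y \<in> sq \<delta>" for y
    using fold that pt_collapse[of "\<psi> y"] by (simp add: a_def)
  have a_0: "a 0 = 0"
    by (simp add: a_def \<psi>0)
  have a_1: "pd1 a 0 \<noteq> 0"
  proof
    assume *: "pd1 a 0 = 0"
    have 0: "0 \<in> sq \<delta>" using \<delta> by (simp add: zero_in_sq)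
    have "((\<lambda>y. pt (a y) (y $ 2)) has_derivative (\<lambda>v. pt (v $ 1 * pd1 a 0 + v $ 2 * pd2 a 0) (v $ 2))) (at 0)"
      by (intro has_derivative_pt has_derivative_partials[OF a 0] has_derivative_nth has_derivative_ident)
    then have "(\<psi> has_derivative (\<lambda>v. pt (v $ 1 * pd1 a 0 + v $ 2 * pd2 a 0) (v $ 2))) (at 0)"
      by (rule has_derivative_transform_within_open[OF _ open_sq 0]) (simp add: \<psi>_eq)
    note D\<psi> = frechet_derivative_at[OF this, symmetric]
    have "frechet_derivative \<psi> (at 0) (pt 1 0) = frechet_derivative \<psi> (at 0) 0"
      unfolding D\<psi> by (simp add: *)
    then have "pt 1 0 = (0 :: real^2)"
      using diffeo_germ_bij_derivative(2)[OF \<psi>] by (metis bij_is_inj injD)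
    then show False
      by (simp flip: pt_0)
  qed
  \<comment> \<open>The relation between \<open>K\<close> and \<open>S\<close> holds in the new coordinates as well.\<close>
  define K' where "K' y = K (\<psi> y)" for y
  have K': "smooth_on K' (sq \<delta>)"
    unfolding K'_def[abs_def]
    by (rule smooth_on_compose[OF K smooth_\<psi> open_sq N(1)]) (use fold in blast)
  have K'_1: "pd1 K' (pt u t) = a (pt u t) * (2 * \<epsilon> * u)" if ut: "\<bar>u\<bar> < \<delta>" "\<bar>t\<bar> < \<delta>" for u t
  proof -
    have in_sq: "pt u t \<in> sq \<delta>" using ut by simp
    have in_N: "pt (a (pt u t)) t \<in> N"
      using fold[rule_format, OF in_sq] \<psi>_eq[OF in_sq] by simp
    have chain: "((\<lambda>u. F (\<psi> (pt u t))) has_real_derivative pd1 a (pt u t) * pd1 F (pt (a (pt u t)) t)) (at u)"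
      if F: "smooth_on F N" for F :: "real^2 \<Rightarrow> real"
    proof (rule has_field_derivative_transform_within_open)
      have "((\<lambda>u. F (pt (a (pt u t)) t)) has_real_derivative pd1 a (pt u t) * pd1 F (pt (a (pt u t)) t)
          + 0 * pd2 F (pt (a (pt u t)) t)) (at u)"
        by (rule DERIV_pt[where a = "\<lambda>u. a (pt u t)" and b = "\<lambda>_. t", OF F in_N])
          (auto intro!: DERIV_pd1[OF a in_sq])
      then show "((\<lambda>u. F (pt (a (pt u t)) t)) has_real_derivative pd1 a (pt u t) * pd1 F (pt (a (pt u t)) t)) (at u)"
        by simp
      show "open {- \<delta><..<\<delta>}" "u \<in> {- \<delta><..<\<delta>}"
        using ut by auto
      show "F (pt (a (pt v t)) t) = F (\<psi> (pt v t))" if "v \<in> {- \<delta><..<\<delta>}" for v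
        using \<psi>_eq[of "pt v t"] that ut by (simp add: abs_less_iff)
    qed
    have "((\<lambda>u. S (\<psi> (pt u t))) has_real_derivative 2 * \<epsilon> * u) (at u)"
    proof (rule has_field_derivative_transform_within_open)
      show "((\<lambda>u. C t + \<epsilon> * u\<^sup>2) has_real_derivative 2 * \<epsilon> * u) (at u)"
        by (auto intro!: derivative_eq_intros)
      show "open {- \<delta><..<\<delta>}" "u \<in> {- \<delta><..<\<delta>}"
        using ut by auto
      show "C t + \<epsilon> * v\<^sup>2 = S (\<psi> (pt v t))" if "v \<in> {- \<delta><..<\<delta>}" for v
        using fold[rule_format, of "pt v t"] that ut by (simp add: abs_less_iff)
    qed
    from DERIV_unique[OF this chain[OF S]]
    have "pd1 a (pt u t) * pd1 S (pt (a (pt u t)) t) = 2 * \<epsilon> * u" ..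
    moreover have "pd1 K' (pt u t) = pd1 a (pt u t) * pd1 K (pt (a (pt u t)) t)"
      using DERIV_unique[OF DERIV_pd1[OF K' in_sq] chain[OF K, folded K'_def]] .
    ultimately show ?thesis
      using KS[OF in_N] by simp
  qed
  obtain \<delta>1 A B where \<delta>1: "\<delta>1 > 0" and A: "smooth_on A (sq \<delta>1)" and B: "smooth_on B (sq \<delta>1)"
    and K'_AB: "\<forall>u t. \<bar>u\<bar> < \<delta>1 \<longrightarrow> \<bar>t\<bar> < \<delta>1 \<longrightarrow> K' (pt u t) = A (pt (u\<^sup>2) t) + u * B (pt (u\<^sup>2) t)"
    using whitney_even_odd[OF \<delta> K'] by blast
  define \<delta>2 where "\<delta>2 = min 1 (min \<delta> \<delta>1)"
  have \<delta>2: "0 < \<delta>2" "\<delta>2 \<le> 1" "\<delta>2 \<le> \<delta>" "\<delta>2 \<le> \<delta>1"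
    using \<delta> \<delta>1 by (simp_all add: \<delta>2_def)
  have sqr: "u\<^sup>2 < \<delta>2" if "\<bar>u\<bar> < \<delta>2" for u
  proof -
    have "u\<^sup>2 = \<bar>u\<bar> * \<bar>u\<bar>" by (simp add: power2_eq_square)
    also have "\<dots> \<le> \<bar>u\<bar> * 1" using that \<delta>2(2) by (intro mult_left_mono) auto
    finally show ?thesis using that by simp
  qed
  have in_sq1: "pt (u\<^sup>2) t \<in> sq \<delta>1" if "\<bar>u\<bar> < \<delta>2" "\<bar>t\<bar> < \<delta>2" for u t
    using sqr[OF that(1)] that \<delta>2 by simp
  have D_square: "((\<lambda>u. F (pt (u\<^sup>2) t)) has_real_derivative 2 * u * pd1 F (pt (u\<^sup>2) t)) (at u)"
    if "smooth_on F (sq \<delta>1)" "\<bar>u\<bar> < \<delta>2" "\<bar>t\<bar> < \<delta>2" for F :: "real^2 \<Rightarrow> real" and u t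
  proof -
    have "((\<lambda>u. F (pt (u\<^sup>2) t)) has_real_derivative (2 * u) * pd1 F (pt (u\<^sup>2) t) + 0 * pd2 F (pt (u\<^sup>2) t)) (at u)"
      by (rule DERIV_pt[where a = "\<lambda>u. u\<^sup>2" and b = "\<lambda>_. t", OF that(1) in_sq1[OF that(2,3)]])
        (auto intro!: derivative_eq_intros)
    then show ?thesis by simp
  qed
  \<comment> \<open>The term of first order in \<open>u\<close> is missing.\<close>
  have B0: "B (pt 0 t) = 0" if t: "\<bar>t\<bar> < \<delta>2" for t
  proof -
    have 0: "\<bar>0\<bar> < \<delta>2" using \<delta>2 by simp
    have "isCont (\<lambda>u. B (pt (u\<^sup>2) t)) 0"
      by (rule DERIV_isCont[OF D_square[OF B 0 t]])
    from DERIV_add[OF D_square[OF A 0 t] DERIV_id_mult[OF this]]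
    have "((\<lambda>u. A (pt (u\<^sup>2) t) + u * B (pt (u\<^sup>2) t)) has_real_derivative B (pt 0 t)) (at 0)"
      by simp
    then have "((\<lambda>u. K' (pt u t)) has_real_derivative B (pt 0 t)) (at 0)"
    proof (rule has_field_derivative_transform_within_open)
      show "open {- \<delta>2<..<\<delta>2}" "0 \<in> {- \<delta>2<..<\<delta>2}"
        using \<delta>2 by auto
      show "A (pt (v\<^sup>2) t) + v * B (pt (v\<^sup>2) t) = K' (pt v t)" if "v \<in> {- \<delta>2<..<\<delta>2}" for v
        using K'_AB[rule_format, of v t] that t \<delta>2 by (simp add: abs_less_iff)
    qed
    moreover have "((\<lambda>u. K' (pt u t)) has_real_derivative pd1 K' (pt 0 t)) (at 0)"
      by (rule DERIV_pd1[OF K']) (use t \<delta>2 \<delta> in simp)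
    ultimately show ?thesis
      using DERIV_unique K'_1[of 0 t] t \<delta>2 \<delta> by fastforce
  qed
  define Q where "Q = hadamard_quotient B"
  have Q: "smooth_on Q (sq \<delta>1)"
    unfolding Q_def by (rule smooth_on_hadamard_quotient[OF B])
  have B_eq: "B (pt v t) = v * Q (pt v t)" if "\<bar>v\<bar> < \<delta>2" "\<bar>t\<bar> < \<delta>2" for v t
    using hadamard_quotient[OF B, of "pt v t"] B0[of t] that \<delta>2 by (simp add: Q_def)
  have K'_eq: "K' (pt u t) = A (pt (u\<^sup>2) t) + u ^ 3 * Q (pt (u\<^sup>2) t)" if "\<bar>u\<bar> < \<delta>2" "\<bar>t\<bar> < \<delta>2" for u t
    using K'_AB[rule_format, of u t] B_eq[of "u\<^sup>2" t] sqr[of u] that \<delta>2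
    by (simp add: power3_eq_cube power2_eq_square)
  \<comment> \<open>The odd part of \<open>a\<close> along \<open>t = 0\<close> is computed from the derivative of \<open>K'\<close>.\<close>
  have Q0: "Q 0 \<noteq> 0"
  proof -
    let ?h = "\<lambda>u. 3 * Q (pt (u\<^sup>2) 0) + 2 * u\<^sup>2 * pd1 Q (pt (u\<^sup>2) 0)"
    have a_eq: "\<epsilon> * a (pt u 0) = pd1 A (pt (u\<^sup>2) 0) + 3 / 2 * u * Q (pt (u\<^sup>2) 0) + u ^ 3 * pd1 Q (pt (u\<^sup>2) 0)"
      if u: "\<bar>u\<bar> < \<delta>2" "u \<noteq> 0" for u
    proof -
      have 0: "\<bar>0\<bar> < \<delta>2" using \<delta>2 by simp
      have "((\<lambda>u. A (pt (u\<^sup>2) 0) + u ^ 3 * Q (pt (u\<^sup>2) 0)) has_real_derivative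
          2 * u * (pd1 A (pt (u\<^sup>2) 0) + 3 / 2 * u * Q (pt (u\<^sup>2) 0) + u ^ 3 * pd1 Q (pt (u\<^sup>2) 0))) (at u)"
        by (rule derivative_eq_intros D_square[OF A u(1) 0] D_square[OF Q u(1) 0] refl)+
          (simp add: power2_eq_square power3_eq_cube algebra_simps)
      then have "((\<lambda>u. K' (pt u 0)) has_real_derivative
          2 * u * (pd1 A (pt (u\<^sup>2) 0) + 3 / 2 * u * Q (pt (u\<^sup>2) 0) + u ^ 3 * pd1 Q (pt (u\<^sup>2) 0))) (at u)"
      proof (rule has_field_derivative_transform_within_open)
        show "open {- \<delta>2<..<\<delta>2}" "u \<in> {- \<delta>2<..<\<delta>2}"
          using u by auto
        show "A (pt (v\<^sup>2) 0) + v ^ 3 * Q (pt (v\<^sup>2) 0) = K' (pt v 0)" if "v \<in> {- \<delta>2<..<\<delta>2}" for v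
          using K'_eq[of v 0] that \<delta>2 by (simp add: abs_less_iff)
      qed
      moreover have "((\<lambda>u. K' (pt u 0)) has_real_derivative pd1 K' (pt u 0)) (at u)"
        by (rule DERIV_pd1[OF K']) (use u \<delta>2 \<delta> in simp)
      ultimately have "2 * u * (pd1 A (pt (u\<^sup>2) 0) + 3 / 2 * u * Q (pt (u\<^sup>2) 0) + u ^ 3 * pd1 Q (pt (u\<^sup>2) 0))
          = pd1 K' (pt u 0)"
        by (rule DERIV_unique)
      also have "\<dots> = 2 * u * (\<epsilon> * a (pt u 0))"
        using K'_1[of u 0] u \<delta>2 \<delta> by simp
      finally show ?thesis
        using u(2) by simp
    qed
    have "((\<lambda>u. \<epsilon> * a (pt u 0) - \<epsilon> * a (pt (- u) 0)) has_real_derivative 2 * \<epsilon> * pd1 a 0) (at 0)"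
    proof -
      have D: "((\<lambda>u. a (pt u 0)) has_real_derivative pd1 a 0) (at 0)"
        using DERIV_pd1[OF a, of 0 0] \<delta> by (simp add: zero_in_sq)
      have "((\<lambda>u. a (pt (- u) 0)) has_real_derivative - pd1 a 0) (at 0)"
        using DERIV_chain2[of "\<lambda>u. a (pt u 0)" "pd1 a 0" uminus 0 "- 1" UNIV] D
          DERIV_minus[OF DERIV_ident, of 0 UNIV] by simp
      from DERIV_diff[OF DERIV_cmult[OF D] DERIV_cmult[OF this], of \<epsilon> \<epsilon>] show ?thesis
        by (simp add: mult.assoc)
    qed
    moreover have "((\<lambda>u. \<epsilon> * a (pt u 0) - \<epsilon> * a (pt (- u) 0)) has_real_derivative ?h 0) (at 0)"
    proof (rule has_field_derivative_transform_within_open)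
      have cont: "isCont (\<lambda>u. F (pt (u\<^sup>2) 0)) 0" if "smooth_on F (sq \<delta>1)" for F :: "real^2 \<Rightarrow> real"
        by (rule DERIV_isCont[OF D_square[OF that]]) (use \<delta>2 in auto)
      show "((\<lambda>u. u * ?h u) has_real_derivative ?h 0) (at 0)"
        by (intro DERIV_id_mult continuous_intros cont Q smooth_on_derivative[OF Q])
      show "open {- \<delta>2<..<\<delta>2}" "0 \<in> {- \<delta>2<..<\<delta>2}"
        using \<delta>2 by auto
      fix u assume "u \<in> {- \<delta>2<..<\<delta>2}"
      then have u: "\<bar>u\<bar> < \<delta>2" by auto
      show "u * ?h u = \<epsilon> * a (pt u 0) - \<epsilon> * a (pt (- u) 0)"
      proof (cases "u = 0")
        case False
        then show ?thesis
          using a_eq[of u] a_eq[of "- u"] u by (simp add: power2_eq_square power3_eq_cube algebra_simps)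
      qed simp
    qed
    ultimately have "2 * \<epsilon> * pd1 a 0 = ?h 0"
      by (rule DERIV_unique)
    then show ?thesis
      using \<epsilon>2(2) a_1 by auto
  qed
  \<comment> \<open>In the target, \<open>S\<close> and \<open>K\<close> are now replaced by \<open>u\<^sup>2\<close> and \<open>u\<^sup>3\<close>.\<close>
  have "open (sq \<delta>2 \<inter> Q -` (- {0}))"
    by (rule continuous_open_preimage[OF _ open_sq])
      (use smooth_on_continuous[OF smooth_on_subset[OF Q sq_mono[OF \<delta>2(4)]]] in auto)
  moreover have "0 \<in> sq \<delta>2 \<inter> Q -` (- {0})"
    using \<delta>2 Q0 by (simp add: zero_in_sq)
  ultimately obtain \<eta>' where "\<eta>' > 0" "sq \<eta>' \<subseteq> sq \<delta>2 \<inter> Q -` (- {0})"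
    using sq_subset_nbhd by blast
  moreover define \<eta> where "\<eta> = min 1 \<eta>'"
  ultimately have \<eta>: "\<eta> > 0" "sq \<eta> \<subseteq> sq \<delta>2 \<inter> Q -` (- {0})" "\<eta> \<le> 1"
    using sq_mono[of \<eta> \<eta>'] by auto
  have \<eta>_le: "sq \<eta> \<subseteq> sq \<delta>1" "sq \<eta> \<subseteq> sq \<delta>" "sq \<eta> \<subseteq> sq \<delta>2"
    using \<eta>(2) sq_mono[OF \<delta>2(3)] sq_mono[OF \<delta>2(4)] by blast+
  define Z where "Z = {z :: real^3. \<bar>z $ 1\<bar> < \<eta>}"
  define W where "W = {w :: real^3. \<bar>w $ 2\<bar> < \<eta> \<and> \<bar>w $ 1\<bar> < \<eta>}"
  define y2 where "y2 z = \<epsilon> * (z $ 2 - C (z $ 1))" for z :: "real^3"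
  define V where "V = Z \<inter> y2 -` {- \<eta><..<\<eta>}"
  have Z_open: "open Z"
  proof -
    have "Z = (\<lambda>z. \<bar>z $ 1\<bar>) -` {..<\<eta>}" by (auto simp: Z_def)
    moreover have "open \<dots>"
      by (intro open_vimage continuous_intros open_lessThan)
    ultimately show ?thesis by simp
  qed
  have W_open: "open W"
  proof -
    have "W = (\<lambda>z. \<bar>z $ 2\<bar>) -` {..<\<eta>} \<inter> (\<lambda>z. \<bar>z $ 1\<bar>) -` {..<\<eta>}" by (auto simp: W_def)
    moreover have "open \<dots>"
      by (intro open_vimage continuous_intros open_lessThan open_Int)
    ultimately show ?thesis by simp
  qed
  have C_smooth: "smooth_on (\<lambda>z :: real^3. C (z $ 1)) X" if "open X" "\<And>z. z \<in> X \<Longrightarrow> \<bar>z $ 1\<bar> < \<eta>" for X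
  proof -
    have "smooth_on (\<lambda>z :: real^3. C (pt 0 (z $ 1) $ 2)) X"
    proof (rule smooth_on_compose[OF C _ that(1) open_sq])
      show "smooth_on (\<lambda>z :: real^3. pt 0 (z $ 1)) X"
        by (intro smooth_on_pt smooth_intros that(1))
      show "pt 0 (z $ 1) \<in> sq \<delta>" if "z \<in> X" for z
      proof (rule subsetD[OF \<eta>_le(2)])
        show "pt 0 (z $ 1) \<in> sq \<eta>"
          using \<open>\<And>z. z \<in> X \<Longrightarrow> \<bar>z $ 1\<bar> < \<eta>\<close>[OF that] \<eta>(1) by simp
      qed
    qed
    then show ?thesis by simp
  qed
  have y2_smooth: "smooth_on y2 Z"
    unfolding y2_def[abs_def]
    by (intro smooth_intros C_smooth Z_open) (simp add: Z_def)
  have V_open: "open V"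
    unfolding V_def by (rule continuous_open_preimage[OF smooth_on_continuous[OF y2_smooth] Z_open]) simp
  have in_sq_V: "pt (y2 z) (z $ 1) \<in> sq \<eta>" if "z \<in> V" for z
    using that by (auto simp: V_def Z_def abs_less_iff)
  have in_sq_W: "pt (w $ 2) (w $ 1) \<in> sq \<eta>" if "w \<in> W" for w
    using that by (simp add: W_def)
  define \<Phi> where "\<Phi> z = (vector [z $ 1, y2 z, (z $ 3 - A (pt (y2 z) (z $ 1))) / Q (pt (y2 z) (z $ 1))] :: real^3)"
    for z :: "real^3"
  define \<Psi> where "\<Psi> w = (vector [w $ 1, C (w $ 1) + \<epsilon> * w $ 2,
      A (pt (w $ 2) (w $ 1)) + w $ 3 * Q (pt (w $ 2) (w $ 1))] :: real^3)" for w :: "real^3"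
  have Q_V: "Q (pt (y2 z) (z $ 1)) \<noteq> 0" if "z \<in> V" for z
    using in_sq_V[OF that] \<eta>(2) by blast
  have comp_V: "smooth_on (\<lambda>z. F (pt (y2 z) (z $ 1))) V" if "smooth_on F (sq \<delta>1)" for F :: "real^2 \<Rightarrow> real"
  proof (rule smooth_on_compose[OF that _ V_open open_sq])
    show "smooth_on (\<lambda>z. pt (y2 z) (z $ 1)) V"
      by (intro smooth_on_pt smooth_on_nth smooth_on_id V_open smooth_on_subset[OF y2_smooth])
        (simp add: V_def)
  qed (use in_sq_V \<eta>_le(1) in blast)
  have comp_W: "smooth_on (\<lambda>w. F (pt (w $ 2) (w $ 1))) W" if "smooth_on F (sq \<delta>1)" for F :: "real^2 \<Rightarrow> real"
  proof (rule smooth_on_compose[OF that _ W_open open_sq])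
    show "smooth_on (\<lambda>w :: real^3. pt (w $ 2) (w $ 1)) W"
      by (intro smooth_on_pt smooth_on_nth smooth_on_id W_open)
  qed (use in_sq_W \<eta>_le(1) in blast)
  let ?f = "\<lambda>x. vector [x $ 2, S x, K x] :: real^3"
  let ?g = "\<lambda>x :: real^2. vector [x $ 1, (x $ 2)^2, (x $ 2)^3] :: real^3"
  have f_\<psi>: "?f (\<psi> (pt u t)) = \<Psi> (vector [t, u\<^sup>2, u ^ 3])" if "\<bar>u\<bar> < \<eta>" "\<bar>t\<bar> < \<eta>" for u t
  proof -
    have "pt u t \<in> sq \<eta>" using that by simp
    then have "pt u t \<in> sq \<delta>" "\<bar>u\<bar> < \<delta>2" "\<bar>t\<bar> < \<delta>2"
      using \<eta>_le pt_in_sq by blast+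
    then show ?thesis
      using fold[rule_format, of "pt u t"] K'_eq[of u t]
      by (simp add: \<Psi>_def K'_def vector_3)
  qed
  have \<Psi>_inv: "\<Psi> w \<in> V \<and> \<Phi> (\<Psi> w) = w" if w: "w \<in> W" for w
  proof -
    have y2: "y2 (\<Psi> w) = w $ 2"
      using \<epsilon>2 by (simp add: y2_def \<Psi>_def vector_3 mult.assoc[symmetric])
    have w1: "\<Psi> w $ 1 = w $ 1"
      by (simp add: \<Psi>_def vector_3)
    have V: "\<Psi> w \<in> V"
      using w by (auto simp: V_def Z_def W_def y2 w1 abs_less_iff)
    then show ?thesis
      using Q_V[OF V] unfolding \<Phi>_def y2 w1
      by (simp add: vec_eq_iff forall_3 vector_3 \<Psi>_def)
  qed
  have \<Phi>_inv: "\<Phi> z \<in> W \<and> \<Psi> (\<Phi> z) = z" if z: "z \<in> V" for z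
  proof -
    have 1: "\<Phi> z $ 1 = z $ 1" "\<Phi> z $ 2 = y2 z"
      by (simp_all add: \<Phi>_def vector_3)
    have "\<epsilon> * y2 z = z $ 2 - C (z $ 1)"
      using \<epsilon>2 by (simp add: y2_def mult.assoc[symmetric])
    then have "\<Psi> (\<Phi> z) = z"
      using Q_V[OF z] unfolding \<Psi>_def 1
      by (simp add: vec_eq_iff forall_3 vector_3 \<Phi>_def)
    moreover have "\<Phi> z \<in> W"
      using z by (auto simp: W_def 1 V_def Z_def abs_less_iff)
    ultimately show ?thesis by simp
  qed
  have f0: "?f 0 = \<Psi> 0"
  proof -
    have "(vector [0, 0, 0] :: real^3) = 0"
      by (simp add: vec_eq_iff forall_3 vector_3)
    then show ?thesis
      using f_\<psi>[of 0 0] \<eta>(1) \<psi>0 by simp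
  qed
  have 0: "0 \<in> W"
    using \<eta>(1) by (simp add: W_def)
  have g0: "?g 0 = 0"
    by (simp add: vec_eq_iff forall_3 vector_3)
  have \<Phi>_germ: "diffeo_germ \<Phi> (?f 0) (?g 0)"
  proof (rule diffeo_germI[OF V_open W_open])
    show "?f 0 \<in> V" "\<Phi> (?f 0) = ?g 0"
      unfolding f0 g0 using \<Psi>_inv[OF 0] by blast+
    show "smooth_on \<Phi> V"
      unfolding \<Phi>_def[abs_def]
      by (intro smooth_on_vector_3 smooth_intros comp_V A Q V_open Q_V smooth_on_subset[OF y2_smooth])
        (auto simp: V_def)
    show "smooth_on \<Psi> W"
      unfolding \<Psi>_def[abs_def]
      by (intro smooth_on_vector_3 smooth_intros comp_W A Q W_open C_smooth) (simp add: W_def)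
  qed (use \<Psi>_inv \<Phi>_inv in blast)+
  have swap: "diffeo_germ (\<lambda>x :: real^2. pt (x $ 2) (x $ 1)) 0 0"
    by (rule diffeo_germI[of UNIV UNIV _ _ _ "\<lambda>x. pt (x $ 2) (x $ 1)"])
      (auto intro!: smooth_on_pt smooth_on_nth smooth_on_id)
  have "germ_equiv ?f 0 ?g 0"
  proof (rule germ_equiv_parametrizedI[where f = ?f and g = ?g, OF diffeo_germ_compose[OF swap \<psi>] \<Phi>_germ])
    have "\<forall>\<^sub>F x in nhds 0. x \<in> sq \<eta>"
      using \<eta>(1) by (intro eventually_nhds_in_open) (auto simp: zero_in_sq)
    then show "\<forall>\<^sub>F x in nhds 0. \<Phi> (?f (\<psi> (pt (x $ 2) (x $ 1)))) = ?g x"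
    proof eventually_elim
      case (elim x)
      then have x: "\<bar>x $ 2\<bar> < \<eta>" "\<bar>x $ 1\<bar> < \<eta>" by (auto simp: sq_def)
      then have "?g x \<in> W"
        using mult_left_mono[of "\<bar>x $ 2\<bar>" 1 "\<bar>x $ 2\<bar>"] \<eta>(3)
        by (simp add: W_def vector_3 power2_eq_square)
      then show ?case
        unfolding f_\<psi>[OF x] using \<Psi>_inv by blast
    qed
  qed
  then show ?thesis
    by (simp add: cuspidal_edge_at_def)
qed

section \<open>Consequences of the two singularity types\<close>

text \<open>The first component of \<open>(u, v\<^sup>2, v\<^sup>3)\<close> already has a nonzero differential.\<close>

lemma cuspidal_edge_rank:
  assumes f: "(f has_derivative f') (at p)" and "cuspidal_edge_at f p"
  shows "\<exists>v. f' v \<noteq> 0"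
proof (rule ccontr)
  assume "\<not> ?thesis"
  then have 0: "f' v = 0" for v by simp
  let ?g = "\<lambda>x :: real^2. vector [x $ 1, (x $ 2)^2, (x $ 2)^3] :: real^3"
  obtain \<phi> \<Phi> where \<phi>: "diffeo_germ \<phi> p 0" and \<Phi>: "diffeo_germ \<Phi> (f p) (?g 0)"
    and eq: "\<forall>\<^sub>F x in nhds p. \<Phi> (f x) = ?g (\<phi> x)"
    using assms(2) unfolding cuspidal_edge_at_def germ_equiv_def by blast
  let ?D = "frechet_derivative \<Phi> (at (f p))"
  have lin: "bounded_linear ?D"
    using diffeo_germ_bij_derivative(1)[OF \<Phi>] by (rule has_derivative_bounded_linear)
  have "((\<lambda>x. \<Phi> (f x) $ 1) has_derivative (\<lambda>v. ?D (f' v) $ 1)) (at p)"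
    using diff_chain_at[OF f diffeo_germ_bij_derivative(1)[OF \<Phi>]]
    by (intro has_derivative_nth) (simp add: o_def)
  then have 1: "((\<lambda>x. \<Phi> (f x) $ 1) has_derivative (\<lambda>v. 0)) (at p)"
    by (simp add: 0 linear_simps(3)[OF lin])
  obtain N where N: "open N" "p \<in> N" "\<forall>x\<in>N. \<Phi> (f x) = ?g (\<phi> x)"
    using eq unfolding eventually_nhds by blast
  have "((\<lambda>x. \<phi> x $ 1) has_derivative (\<lambda>v. 0)) (at p)"
    by (rule has_derivative_transform_within_open[OF 1 N(1,2)]) (use N(3) in \<open>simp add: vector_3\<close>)
  moreover have "((\<lambda>x. \<phi> x $ 1) has_derivative (\<lambda>v. frechet_derivative \<phi> (at p) v $ 1)) (at p)"
    by (intro has_derivative_nth diffeo_germ_bij_derivative(1)[OF \<phi>])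
  ultimately have "(\<lambda>v. frechet_derivative \<phi> (at p) v $ 1) = (\<lambda>v. 0)"
    by (rule has_derivative_unique[THEN sym])
  moreover obtain v where "frechet_derivative \<phi> (at p) v = pt 1 0"
    using diffeo_germ_bij_derivative(2)[OF \<phi>] by (metis bij_is_surj surjD)
  ultimately show False
    by (metis pt_nth(1) zero_neq_one)
qed

lemma isCont_eq_at_0:
  fixes f g :: "real \<Rightarrow> real"
  assumes "isCont f 0" "isCont g 0" "r > 0" and eq: "\<And>u. u \<noteq> 0 \<Longrightarrow> \<bar>u\<bar> < r \<Longrightarrow> f u = g u"
  shows "f 0 = g 0"
proof -
  have "\<forall>\<^sub>F u in at 0. f u = g u"
    unfolding eventually_at using assms(3) eq by (intro exI[of _ r]) (auto simp: dist_real_def)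
  then have "(g \<longlongrightarrow> f 0) (at 0)"
    using assms(1) tendsto_cong unfolding isCont_def by metis
  then show ?thesis
    using assms(2) LIM_unique unfolding isCont_def by blast
qed

text \<open>For \<open>P = X\<^sup>3 + \<sigma> X Y\<^sup>2\<close> with \<open>\<sigma> = 1\<close> or \<open>\<sigma> = - 1\<close>, the gradient of \<open>P\<close> is a quadratic map
  that vanishes at the origin only.  If the gradient of \<open>w\<close> is \<open>(S, 0)\<close> along the first axis, then
  \<open>S\<close> must vanish there to second order exactly.\<close>

lemma D4_second_order_zero:
  fixes \<tau> :: "real^2 \<Rightarrow> real^2" and w S :: "real^2 \<Rightarrow> real" and \<sigma> :: real
  assumes \<sigma>: "\<bar>\<sigma>\<bar> = 1" and \<tau>: "diffeo_germ \<tau> 0 0" and N: "open N" "0 \<in> N"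
    and w: "smooth_on w N" and S: "smooth_on S N"
    and w_eq: "\<And>y. y \<in> N \<Longrightarrow> w y = (\<tau> y $ 1) ^ 3 + \<sigma> * (\<tau> y $ 1 * (\<tau> y $ 2)\<^sup>2)"
    and grad: "\<And>u. pt u 0 \<in> N \<Longrightarrow> pd1 w (pt u 0) = S (pt u 0) \<and> pd2 w (pt u 0) = 0"
  shows "pd1 S 0 = 0" "pd1 (pd1 S) 0 \<noteq> 0"
proof -
  obtain V where V: "open V" "0 \<in> V" "smooth_on \<tau> V" "\<tau> 0 = 0"
    using diffeo_germD[OF \<tau>] by blast
  obtain r where r: "r > 0" "sq r \<subseteq> N \<inter> V"
    using sq_subset_nbhd[of "N \<inter> V"] N V by blast
  define X where "X y = \<tau> y $ 1" for y
  define Y where "Y y = \<tau> y $ 2" for y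
  have X: "smooth_on X (sq r)" and Y: "smooth_on Y (sq r)"
    unfolding X_def[abs_def] Y_def[abs_def]
    by (intro smooth_on_nth smooth_on_subset[OF V(3)] open_sq; use r in blast)+
  have XY0: "X 0 = 0" "Y 0 = 0"
    by (simp_all add: X_def Y_def V(4))
  have w_r: "smooth_on w (sq r)" and S_r: "smooth_on S (sq r)"
    using smooth_on_subset[OF w] smooth_on_subset[OF S] r by blast+
  define A where "A y = 3 * (X y)\<^sup>2 + \<sigma> * (Y y)\<^sup>2" for y
  define B where "B y = 2 * \<sigma> * X y * Y y" for y
  have pd: "frechet_derivative w (at y) v = A y * frechet_derivative X (at y) v + B y * frechet_derivative Y (at y) v"
    if y: "y \<in> sq r" for y v
  proof -
    have "((\<lambda>y. X y ^ 3 + \<sigma> * (X y * (Y y)\<^sup>2)) has_derivative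
        (\<lambda>v. A y * frechet_derivative X (at y) v + B y * frechet_derivative Y (at y) v)) (at y)"
      by (auto intro!: derivative_eq_intros smooth_on_has_derivative[OF X y] smooth_on_has_derivative[OF Y y]
          simp: A_def B_def algebra_simps power2_eq_square)
    then have "(w has_derivative
        (\<lambda>v. A y * frechet_derivative X (at y) v + B y * frechet_derivative Y (at y) v)) (at y)"
      by (rule has_derivative_transform_within_open[OF _ open_sq y])
        (use r w_eq in \<open>auto simp: X_def Y_def\<close>)
    from frechet_derivative_at[OF this, symmetric] show ?thesis by simp
  qed
  define x where "x u = hadamard_quotient X (pt u 0)" for u
  define y where "y u = hadamard_quotient Y (pt u 0)" for u
  have XY_eq: "X (pt u 0) = u * x u" "Y (pt u 0) = u * y u" if "\<bar>u\<bar> < r" for u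
    using hadamard_quotient[OF X, of "pt u 0"] hadamard_quotient[OF Y, of "pt u 0"] that r(1)
    by (simp_all add: x_def y_def XY0)
  have xy0: "x 0 = pd1 X 0" "y 0 = pd1 Y 0"
    using hadamard_quotient_0[of X 0] hadamard_quotient_0[of Y 0] by (simp_all add: x_def y_def)
  have cont: "isCont (\<lambda>u. F (pt u 0)) 0" if "smooth_on F (sq r)" for F :: "real^2 \<Rightarrow> real"
    using DERIV_isCont[OF DERIV_pd1[OF that, of 0 0]] r by (simp add: zero_in_sq)
  have cont_xy: "isCont x 0" "isCont y 0"
    unfolding x_def[abs_def] y_def[abs_def]
    by (intro cont smooth_on_hadamard_quotient X Y)+
  \<comment> \<open>\<open>L pd1\<close> and \<open>L pd2\<close> extend the partial derivatives of \<open>w\<close> at \<open>(u, 0)\<close>, divided by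
    \<open>u\<^sup>2\<close>, continuously to \<open>u = 0\<close>.\<close>
  define L where "L D u = (3 * (x u)\<^sup>2 + \<sigma> * (y u)\<^sup>2) * D X (pt u 0) + (2 * \<sigma> * x u * y u) * D Y (pt u 0)"
    for D :: "(real^2 \<Rightarrow> real) \<Rightarrow> real^2 \<Rightarrow> real" and u
  have L: "A (pt u 0) * D X (pt u 0) + B (pt u 0) * D Y (pt u 0) = u\<^sup>2 * L D u" if "\<bar>u\<bar> < r" for u D
    unfolding A_def B_def L_def XY_eq[OF that] by (simp add: power2_eq_square algebra_simps)
  have cont_L: "isCont (L pd1) 0" "isCont (L pd2) 0"
    unfolding L_def[abs_def]
    by (intro continuous_intros cont_xy cont smooth_on_derivative X Y)+
  have S_L: "S (pt u 0) = u\<^sup>2 * L pd1 u" and L2: "0 = u\<^sup>2 * L pd2 u" if u: "\<bar>u\<bar> < r" for u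
  proof -
    have in_sq: "pt u 0 \<in> sq r" using u r(1) by simp
    have "pt u 0 \<in> N" using in_sq r(2) by blast
    then show "S (pt u 0) = u\<^sup>2 * L pd1 u" "0 = u\<^sup>2 * L pd2 u"
      using grad[of u] pd[OF in_sq] L[OF u, of pd1] L[OF u, of pd2] by simp_all
  qed
  have L2_0: "L pd2 0 = 0"
    using isCont_eq_at_0[OF cont_L(2) continuous_const r(1), of 0] L2 by auto
  have L1_0: "L pd1 0 \<noteq> 0"
  proof
    assume L1_0: "L pd1 0 = 0"
    let ?A = "3 * (x 0)\<^sup>2 + \<sigma> * (y 0)\<^sup>2" and ?B = "2 * \<sigma> * x 0 * y 0"
    have D\<tau>: "frechet_derivative \<tau> (at 0) v = pt (frechet_derivative X (at 0) v) (frechet_derivative Y (at 0) v)" for v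
    proof -
      have 0: "0 \<in> sq r" using r by (simp add: zero_in_sq)
      have "((\<lambda>y. pt (X y) (Y y)) has_derivative
          (\<lambda>v. pt (frechet_derivative X (at 0) v) (frechet_derivative Y (at 0) v))) (at 0)"
        by (intro has_derivative_pt smooth_on_has_derivative[OF X 0] smooth_on_has_derivative[OF Y 0])
      then have "(\<tau> has_derivative
          (\<lambda>v. pt (frechet_derivative X (at 0) v) (frechet_derivative Y (at 0) v))) (at 0)"
        by (simp add: X_def Y_def)
      from frechet_derivative_at[OF this, symmetric] show ?thesis by simp
    qed
    have "?A * frechet_derivative X (at 0) v + ?B * frechet_derivative Y (at 0) v = 0" for v
    proof -
      have 0: "0 \<in> sq r" using r by (simp add: zero_in_sq)
      have "?A * pd1 X 0 + ?B * pd1 Y 0 = 0" "?A * pd2 X 0 + ?B * pd2 Y 0 = 0"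
        using L1_0 L2_0 by (simp_all add: L_def)
      moreover have "?A * frechet_derivative X (at 0) v + ?B * frechet_derivative Y (at 0) v
        = v $ 1 * (?A * pd1 X 0 + ?B * pd1 Y 0) + v $ 2 * (?A * pd2 X 0 + ?B * pd2 Y 0)"
        unfolding frechet_derivative_partials[OF smooth_on_has_derivative[OF X 0], of v]
          frechet_derivative_partials[OF smooth_on_has_derivative[OF Y 0], of v]
        by (simp add: algebra_simps)
      ultimately show ?thesis by simp
    qed
    moreover have "\<exists>v. frechet_derivative X (at 0) v = \<alpha> \<and> frechet_derivative Y (at 0) v = \<beta>" for \<alpha> \<beta>
    proof -
      obtain v where "frechet_derivative \<tau> (at 0) v = pt \<alpha> \<beta>"
        using diffeo_germ_bij_derivative(2)[OF \<tau>] by (metis bij_is_surj surjD)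
      then show ?thesis by (auto simp: D\<tau>)
    qed
    ultimately have AB: "?A * \<alpha> + ?B * \<beta> = 0" for \<alpha> \<beta>
      by metis
    have "?A = 0" "?B = 0"
      using AB[of 1 0] AB[of 0 1] by simp_all
    then have "x 0 = 0" "y 0 = 0"
      using \<sigma> by auto
    then have "frechet_derivative \<tau> (at 0) (axis 1 1) = 0"
      by (simp add: D\<tau> xy0)
    moreover have "frechet_derivative \<tau> (at 0) 0 = 0"
      using diffeo_germ_bij_derivative(1)[OF \<tau>] has_derivative_bounded_linear linear_simps(3) by blast
    ultimately have "axis 1 1 = (0 :: real^2)"
      using diffeo_germ_bij_derivative(2)[OF \<tau>] by (metis bij_is_inj injD)
    then show False
      by (simp add: axis_eq_0_iff)
  qed
  have S_0: "S 0 = 0"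
    using S_L[of 0] r by simp
  show S1: "pd1 S 0 = 0"
  proof -
    have "isCont (\<lambda>u. u * L pd1 u) 0"
      by (intro continuous_intros cont_L)
    from DERIV_id_mult[OF this] have "((\<lambda>u. u\<^sup>2 * L pd1 u) has_real_derivative 0) (at 0)"
      by (simp add: power2_eq_square mult.assoc)
    then have "((\<lambda>u. S (pt u 0)) has_real_derivative 0) (at 0)"
      by (rule has_field_derivative_transform_within_open[of _ _ _ "{- r<..<r}"])
        (use S_L r in \<open>auto simp: abs_less_iff\<close>)
    moreover have "((\<lambda>u. S (pt u 0)) has_real_derivative pd1 S 0) (at 0)"
      using DERIV_pd1[OF S_r, of 0 0] r by (simp add: zero_in_sq)
    ultimately show ?thesis
      using DERIV_unique by blast
  qed
  let ?G = "hadamard_quotient (hadamard_quotient S)"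
  have "S (pt u 0) = u\<^sup>2 * ?G (pt u 0)" if "\<bar>u\<bar> < r" for u
    using hadamard_quotient[OF S_r, of "pt u 0"] hadamard_quotient[OF smooth_on_hadamard_quotient[OF S_r], of "pt u 0"]
      hadamard_quotient_0[of S 0] that r(1)
    by (simp add: S_0 S1 power2_eq_square)
  then have "?G (pt 0 0) = L pd1 0"
    by (intro isCont_eq_at_0[OF cont cont_L(1) r(1)] smooth_on_hadamard_quotient S_r)
      (use S_L in \<open>metis mult_left_cancel power_not_zero\<close>)
  then show "pd1 (pd1 S) 0 \<noteq> 0"
    using pd1_pd1_hadamard[OF r(1) S_r] L1_0 by simp
qed

section \<open>Frames, duality and the theorem\<close>

lemma cross3_frame_expansion:
  fixes n e :: "real^3"
  assumes "norm n = 1" "norm e = 1" "n \<bullet> e = 0"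
  defines "e' \<equiv> cross3 n e"
  shows "norm e' = 1" "n \<bullet> e' = 0" "e \<bullet> e' = 0"
    and "v = (v \<bullet> e) *\<^sub>R e + (v \<bullet> e') *\<^sub>R e' + (v \<bullet> n) *\<^sub>R n"
proof -
  have "(norm e')\<^sup>2 = 1"
    using norm_cross_dot[of n e] assms by (simp add: e'_def)
  then show 1: "norm e' = 1"
    using norm_ge_zero[of e'] by (simp add: power2_eq_1_iff)
  show 2: "n \<bullet> e' = 0" "e \<bullet> e' = 0"
    by (simp_all add: e'_def dot_cross_self)
  have ne: "e \<noteq> e'" "e \<noteq> n" "e' \<noteq> n"
    using assms(1-3) 1 2 by auto
  let ?B = "{e, e', n}"
  have orth: "pairwise orthogonal ?B"
    using assms(3) 2 by (auto simp: pairwise_def orthogonal_def inner_commute)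
  have "0 \<notin> ?B" using assms(1,2) 1 by auto
  with orth have "independent ?B"
    by (rule pairwise_orthogonal_independent)
  then have "UNIV \<subseteq> span ?B"
    using ne by (intro card_ge_dim_independent) auto
  then have "(\<Sum>i\<in>?B. (v \<bullet> i) *\<^sub>R i) = v"
    using orth assms(1,2) 1 by (intro orthonormal_basis_expand) auto
  then show "v = (v \<bullet> e) *\<^sub>R e + (v \<bullet> e') *\<^sub>R e' + (v \<bullet> n) *\<^sub>R n"
    using ne by (simp add: add.assoc)
qed

text \<open>The foot of the perpendicular from the origin to the plane
  \<open>\<langle>x - c, n - s e - t e'\<rangle> = - k\<close>, as a function of \<open>(t, s, k)\<close>.  The dual surface sends a point to
  the foot of the perpendicular from the origin to the tangent plane of \<open>f + c\<close>, and \<open>- k\<close> is the constant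
  of this plane when \<open>k\<close> is the Legendre transform.\<close>

definition pedal_chart :: "real^3 \<Rightarrow> real^3 \<Rightarrow> real^3 \<Rightarrow> real^3 \<Rightarrow> real^3 \<Rightarrow> real^3"
  where "pedal_chart n e e' c z =
    ((c \<bullet> n - z $ 3 - z $ 2 * (c \<bullet> e) - z $ 1 * (c \<bullet> e')) / (1 + (z $ 2)\<^sup>2 + (z $ 1)\<^sup>2)) *\<^sub>R
      (n - (z $ 2) *\<^sub>R e - (z $ 1) *\<^sub>R e')"

text \<open>Away from the plane through the origin orthogonal to \<open>n\<close>, the direction of the foot
  point determines \<open>s\<close> and \<open>t\<close>, and its length then determines \<open>k\<close>.\<close>

lemma pedal_chart_inverse:
  fixes n e e' c :: "real^3"
  assumes unit: "norm n = 1" "norm e = 1" "norm e' = 1"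
    and orth: "n \<bullet> e = 0" "n \<bullet> e' = 0" "e \<bullet> e' = 0"
    and expand: "\<And>v. v = (v \<bullet> e) *\<^sub>R e + (v \<bullet> e') *\<^sub>R e' + (v \<bullet> n) *\<^sub>R n"
    and c: "c \<bullet> n \<noteq> 0"
  shows "\<exists>\<Phi>. diffeo_germ \<Phi> ((c \<bullet> n) *\<^sub>R n) 0 \<and>
    (\<forall>z. c \<bullet> n - z $ 3 - z $ 2 * (c \<bullet> e) - z $ 1 * (c \<bullet> e') \<noteq> 0 \<longrightarrow> \<Phi> (pedal_chart n e e' c z) = z)"
proof -
  let ?q = "\<lambda>z :: real^3. c \<bullet> n - z $ 3 - z $ 2 * (c \<bullet> e) - z $ 1 * (c \<bullet> e')"
  let ?\<Psi> = "pedal_chart n e e' c"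
  define s where "s x = - ((x \<bullet> e) / (x \<bullet> n))" for x :: "real^3"
  define t where "t x = - ((x \<bullet> e') / (x \<bullet> n))" for x :: "real^3"
  define k where "k x = c \<bullet> n - s x * (c \<bullet> e) - t x * (c \<bullet> e') - (x \<bullet> n) * (1 + (s x)\<^sup>2 + (t x)\<^sup>2)" for x
  define \<Phi> where "\<Phi> x = (vector [t x, s x, k x] :: real^3)" for x
  define V where "V = {x :: real^3. x \<bullet> n \<noteq> 0}"
  define W where "W = {z :: real^3. ?q z \<noteq> 0}"
  have V_open: "open V" and W_open: "open W"
    unfolding V_def W_def by (intro open_Collect_neq continuous_intros)+
  have [simp]: "n \<bullet> n = 1" "e \<bullet> e = 1" "e' \<bullet> e' = 1"
    using unit by (simp_all add: norm_eq_1)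
  have pos: "1 + a\<^sup>2 + b\<^sup>2 > 0" for a b :: real
    using zero_le_power2[of a] zero_le_power2[of b] by linarith
  have s: "smooth_on s V" and t: "smooth_on t V"
    unfolding s_def[abs_def] t_def[abs_def]
    by (intro smooth_intros V_open; simp add: V_def)+
  have \<Phi>: "smooth_on \<Phi> V"
    unfolding \<Phi>_def[abs_def] k_def by (intro smooth_on_vector_3 smooth_intros s t V_open)
  have \<Psi>: "smooth_on ?\<Psi> W"
    unfolding pedal_chart_def[abs_def]
    by (intro smooth_intros W_open) (use pos less_irrefl in metis)
  have inner_\<Psi>: "?\<Psi> z \<bullet> n = ?q z / (1 + (z $ 2)\<^sup>2 + (z $ 1)\<^sup>2)"
      "?\<Psi> z \<bullet> e = - z $ 2 * (?\<Psi> z \<bullet> n)" "?\<Psi> z \<bullet> e' = - z $ 1 * (?\<Psi> z \<bullet> n)" for z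
    using orth by (simp_all add: pedal_chart_def inner_diff_left inner_commute[of e n]
        inner_commute[of e' n] inner_commute[of e' e])
  have \<Psi>_inv: "?\<Psi> z \<in> V \<and> \<Phi> (?\<Psi> z) = z" if z: "z \<in> W" for z
  proof -
    have ne: "?\<Psi> z \<bullet> n \<noteq> 0"
      using z pos[of "z $ 2" "z $ 1"] by (simp add: W_def inner_\<Psi>(1))
    have st: "s (?\<Psi> z) = z $ 2" "t (?\<Psi> z) = z $ 1"
      unfolding s_def t_def inner_\<Psi>(2,3) using ne by simp_all
    have "(?\<Psi> z \<bullet> n) * (1 + (z $ 2)\<^sup>2 + (z $ 1)\<^sup>2) = ?q z"
      using pos[of "z $ 2" "z $ 1"] by (simp add: inner_\<Psi>(1))
    then have "k (?\<Psi> z) = z $ 3"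
      unfolding k_def st by simp
    then show ?thesis
      using ne by (simp add: V_def \<Phi>_def st vec_eq_iff forall_3 vector_3)
  qed
  have \<Phi>_inv: "\<Phi> x \<in> W \<and> ?\<Psi> (\<Phi> x) = x" if x: "x \<in> V" for x
  proof -
    have ne: "x \<bullet> n \<noteq> 0" using x by (simp add: V_def)
    have q: "?q (\<Phi> x) = (x \<bullet> n) * (1 + (s x)\<^sup>2 + (t x)\<^sup>2)"
      by (simp add: \<Phi>_def vector_3 k_def)
    have "?\<Psi> (\<Phi> x) = (x \<bullet> n) *\<^sub>R (n - s x *\<^sub>R e - t x *\<^sub>R e')"
      unfolding pedal_chart_def q using pos[of "s x" "t x"] by (simp add: \<Phi>_def vector_3)
    also have "\<dots> = (x \<bullet> e) *\<^sub>R e + (x \<bullet> e') *\<^sub>R e' + (x \<bullet> n) *\<^sub>R n"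
      using ne by (simp add: s_def t_def algebra_simps)
    also have "\<dots> = x" by (rule expand[symmetric])
    finally have "?\<Psi> (\<Phi> x) = x" .
    moreover have "\<Phi> x \<in> W"
      using ne pos[of "s x" "t x"] unfolding W_def mem_Collect_eq q by simp
    ultimately show ?thesis by simp
  qed
  have "diffeo_germ \<Phi> ((c \<bullet> n) *\<^sub>R n) 0"
  proof (rule diffeo_germI[OF V_open W_open _ _ \<Phi> \<Psi>])
    show "(c \<bullet> n) *\<^sub>R n \<in> V" using c by (simp add: V_def)
    have "s ((c \<bullet> n) *\<^sub>R n) = 0" "t ((c \<bullet> n) *\<^sub>R n) = 0"
      using orth by (simp_all add: s_def t_def)
    then show "\<Phi> ((c \<bullet> n) *\<^sub>R n) = 0"
      by (simp add: \<Phi>_def k_def vec_eq_iff forall_3 vector_3)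
  qed (use \<Psi>_inv \<Phi>_inv in blast)+
  then show ?thesis
    using \<Psi>_inv by (auto simp: W_def)
qed

text \<open>The normal turns in the direction of the kernel of \<open>df(p)\<close>, and it does so perpendicularly to
  the image of \<open>df(p)\<close>: the second fundamental form \<open>df \<bullet> d\<nu>\<close> is symmetric.\<close>

lemma front_kernel_derivative_normal:
  assumes front: "front_with_normal U f \<nu>" and p: "p \<in> U"
    and \<xi>: "frechet_derivative f (at p) \<xi> = 0" "\<xi> \<noteq> 0"
  shows "frechet_derivative \<nu> (at p) \<xi> \<noteq> 0"
    and "frechet_derivative \<nu> (at p) v \<bullet> \<nu> p = 0"
    and "frechet_derivative f (at p) v \<bullet> frechet_derivative \<nu> (at p) \<xi> = 0"
proof -
  have U: "open U" and f: "smooth_on f U" and \<nu>: "smooth_on \<nu> U"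
    and unit: "\<And>x. x \<in> U \<Longrightarrow> norm (\<nu> x) = 1"
    and normal: "\<And>x v. x \<in> U \<Longrightarrow> frechet_derivative f (at x) v \<bullet> \<nu> x = 0"
    and imm: "immersion_at (\<lambda>y. (f y, \<nu> y)) p"
    using front p by (auto simp: front_with_normal_def)
  let ?Df = "\<lambda>x. frechet_derivative f (at x)" and ?D\<nu> = "\<lambda>x. frechet_derivative \<nu> (at x)"
  note Df = smooth_on_has_derivative[OF f] and D\<nu> = smooth_on_has_derivative[OF \<nu>]
  have lin: "bounded_linear (?Df p)" "bounded_linear (?D\<nu> p)"
    using Df[OF p] D\<nu>[OF p] has_derivative_bounded_linear by blast+
  show "?D\<nu> p \<xi> \<noteq> 0"
  proof
    assume *: "?D\<nu> p \<xi> = 0"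
    have "((\<lambda>y. (f y, \<nu> y)) has_derivative (\<lambda>v. (?Df p v, ?D\<nu> p v))) (at p)"
      by (intro has_derivative_Pair Df D\<nu> p)
    from frechet_derivative_at[OF this] have "inj (\<lambda>v. (?Df p v, ?D\<nu> p v))"
      using imm by (simp add: immersion_at_def)
    moreover have "(\<lambda>v. (?Df p v, ?D\<nu> p v)) \<xi> = (\<lambda>v. (?Df p v, ?D\<nu> p v)) 0"
      using * \<xi>(1) by (simp add: linear_simps(3)[OF lin(1)] linear_simps(3)[OF lin(2)])
    ultimately show False
      using \<xi>(2) by (meson injD)
  qed
  have "((\<lambda>x. \<nu> x \<bullet> \<nu> x) has_derivative (\<lambda>v. \<nu> p \<bullet> ?D\<nu> p v + ?D\<nu> p v \<bullet> \<nu> p)) (at p)"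
    by (intro has_derivative_inner D\<nu> p)
  then have "((\<lambda>x. 1) has_derivative (\<lambda>v. \<nu> p \<bullet> ?D\<nu> p v + ?D\<nu> p v \<bullet> \<nu> p)) (at p)"
    by (rule has_derivative_transform_within_open[OF _ U p]) (use unit in \<open>simp add: norm_eq_1\<close>)
  from has_derivative_unique[OF this has_derivative_const]
  have "\<nu> p \<bullet> ?D\<nu> p v + ?D\<nu> p v \<bullet> \<nu> p = 0"
    by metis
  then show "?D\<nu> p v \<bullet> \<nu> p = 0"
    by (simp add: inner_commute)
  define w where "w x = f x \<bullet> \<nu> p" for x
  have w: "smooth_on w U"
    unfolding w_def[abs_def] by (intro smooth_intros f U)
  have Dw: "frechet_derivative w (at x) v = ?Df x v \<bullet> \<nu> p" if "x \<in> U" for x v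
  proof -
    have "(w has_derivative (\<lambda>v. ?Df x v \<bullet> \<nu> p)) (at x)"
      unfolding w_def[abs_def] by (rule has_derivative_inner_left[OF Df[OF that]])
    from frechet_derivative_at[OF this, symmetric] show ?thesis by simp
  qed
  have second: "frechet_derivative (\<lambda>x. frechet_derivative w (at x) a) (at p) b = - (?Df p a \<bullet> ?D\<nu> p b)" for a b
  proof -
    let ?F = "frechet_derivative (\<lambda>x. ?Df x a) (at p)"
    have F: "((\<lambda>x. ?Df x a) has_derivative ?F) (at p)"
      by (rule smooth_on_has_derivative[OF smooth_on_derivative[OF f] p])
    have "((\<lambda>x. ?Df x a \<bullet> \<nu> x) has_derivative (\<lambda>b. ?Df p a \<bullet> ?D\<nu> p b + ?F b \<bullet> \<nu> p)) (at p)"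
      by (rule has_derivative_inner[OF F D\<nu>[OF p]])
    then have "((\<lambda>x. 0) has_derivative (\<lambda>b. ?Df p a \<bullet> ?D\<nu> p b + ?F b \<bullet> \<nu> p)) (at p)"
      by (rule has_derivative_transform_within_open[OF _ U p]) (use normal in simp)
    from has_derivative_unique[OF this has_derivative_const]
    have 1: "?Df p a \<bullet> ?D\<nu> p b + ?F b \<bullet> \<nu> p = 0"
      by metis
    have "((\<lambda>x. frechet_derivative w (at x) a) has_derivative (\<lambda>b. ?F b \<bullet> \<nu> p)) (at p)"
      by (rule has_derivative_transform_within_open[OF has_derivative_inner_left[OF F] U p]) (simp add: Dw)
    from frechet_derivative_at[OF this, symmetric] 1 show ?thesis by simp
  qed
  show "?Df p v \<bullet> ?D\<nu> p \<xi> = 0"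
    using second_derivative_symmetric_real[OF U w p, of v \<xi>] second[of v \<xi>] second[of \<xi> v] \<xi>(1) by simp
qed

theorem proposition4p3:
  fixes U :: "(real^2) set" and f \<nu> :: "real^2 \<Rightarrow> real^3" and p :: "real^2" and c :: "real^3"
  assumes "front_with_normal U f \<nu>"
    and "p \<in> singular_set U f"
    and "cuspidal_edge_at f p"
    and "f p = 0"
    and "c \<noteq> 0"
    and "\<nu> p \<bullet> c \<noteq> 0"
    and "D4_singularity_at (\<lambda>x. (f x + c) \<bullet> \<nu> p - (f p + c) \<bullet> \<nu> p) p"
  shows "cuspidal_edge_at (dual_surface f \<nu> c) p"
proof -
  have U: "open U" and f: "smooth_on f U" and \<nu>: "smooth_on \<nu> U"
    and unit: "\<And>x. x \<in> U \<Longrightarrow> norm (\<nu> x) = 1"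
    and normal: "\<And>x v. x \<in> U \<Longrightarrow> frechet_derivative f (at x) v \<bullet> \<nu> x = 0"
    using assms(1) by (auto simp: front_with_normal_def)
  have p: "p \<in> U" and not_imm: "\<not> immersion_at f p"
    using assms(2) by (auto simp: singular_set_def)
  let ?Df = "\<lambda>x. frechet_derivative f (at x)" and ?D\<nu> = "\<lambda>x. frechet_derivative \<nu> (at x)"
  note Df = smooth_on_has_derivative[OF f] and D\<nu> = smooth_on_has_derivative[OF \<nu>]
  define n where "n = \<nu> p"
  have n: "norm n = 1" "n \<bullet> n = 1"
    using unit[OF p] by (simp_all add: n_def norm_eq_1)
  have lin: "linear (?Df p)"
    using Df[OF p] has_derivative_linear by blast
  obtain \<xi> where \<xi>: "?Df p \<xi> = 0" "\<xi> \<noteq> 0"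
    using not_imm Df[OF p] linear_injective_0[OF lin] by (auto simp: immersion_at_def differentiable_def)
  obtain \<eta> where \<eta>: "?Df p \<eta> \<noteq> 0"
    using cuspidal_edge_rank[OF Df[OF p] assms(3)] by blast
  define e where "e = ?Df p \<eta> /\<^sub>R norm (?Df p \<eta>)"
  have e: "norm e = 1" "n \<bullet> e = 0"
    using \<eta> normal[OF p, of \<eta>] by (simp_all add: e_def n_def inner_commute)
  define e' where "e' = cross3 n e"
  note frame = cross3_frame_expansion[OF n(1) e, folded e'_def]
  have D\<nu>_\<xi>: "?D\<nu> p \<xi> \<bullet> e = 0" "?D\<nu> p \<xi> \<bullet> e' \<noteq> 0"
  proof -
    note * = front_kernel_derivative_normal[OF assms(1) p \<xi>]
    show 1: "?D\<nu> p \<xi> \<bullet> e = 0"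
      using *(3)[of \<eta>] by (simp add: e_def inner_commute)
    show "?D\<nu> p \<xi> \<bullet> e' \<noteq> 0"
      using *(1) *(2)[of \<xi>] 1 frame(4)[of "?D\<nu> p \<xi>"] by (auto simp: n_def)
  qed
  \<comment> \<open>Coordinates of \<open>f\<close> and of the direction of its normal; \<open>k\<close> is the Legendre transform.\<close>
  define U0 where "U0 = U \<inter> (\<lambda>x. \<nu> x \<bullet> n) -` {0<..}"
  have U0: "open U0" "p \<in> U0" "U0 \<subseteq> U"
  proof -
    show "open U0"
      unfolding U0_def by (rule continuous_open_preimage[OF _ U])
        (auto intro!: continuous_intros smooth_on_continuous[OF \<nu>])
    show "p \<in> U0" using p n(2) by (simp add: U0_def n_def)
  qed (simp add: U0_def)
  define \<gamma> where "\<gamma> x = \<nu> x \<bullet> n" for x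
  define s where "s x = - ((\<nu> x \<bullet> e) / \<gamma> x)" for x
  define t where "t x = - ((\<nu> x \<bullet> e') / \<gamma> x)" for x
  define a where "a x = f x \<bullet> e" for x
  define b where "b x = f x \<bullet> e'" for x
  define w where "w x = f x \<bullet> n" for x
  define k where "k x = s x * a x + t x * b x - w x" for x
  have \<gamma>_pos: "\<gamma> x > 0" if "x \<in> U0" for x
    using that by (simp add: U0_def \<gamma>_def)
  have f0: "smooth_on f U0" and \<nu>0: "smooth_on \<nu> U0"
    using smooth_on_subset[OF f U0(3)] smooth_on_subset[OF \<nu> U0(3)] .
  have \<gamma>: "smooth_on \<gamma> U0" and a: "smooth_on a U0" and b: "smooth_on b U0" and w: "smooth_on w U0"
    unfolding \<gamma>_def[abs_def] a_def[abs_def] b_def[abs_def] w_def[abs_def]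
    by (intro smooth_intros f0 \<nu>0 U0(1))+
  have s: "smooth_on s U0" and t: "smooth_on t U0"
    unfolding s_def[abs_def] t_def[abs_def]
    by (intro smooth_intros \<nu>0 \<gamma> U0(1); use \<gamma>_pos in fastforce)+
  have k: "smooth_on k U0"
    unfolding k_def[abs_def] by (intro smooth_intros s t a b w U0(1))
  have at_p: "\<gamma> p = 1" "s p = 0" "t p = 0" "a p = 0" "b p = 0" "w p = 0"
    using n(2) e(2) frame(2) assms(4)
    by (simp_all add: \<gamma>_def s_def t_def a_def b_def w_def flip: n_def)
  have \<nu>_eq: "\<nu> x = \<gamma> x *\<^sub>R (n - s x *\<^sub>R e - t x *\<^sub>R e')" if "x \<in> U0" for x
  proof -
    have "\<gamma> x * s x = - (\<nu> x \<bullet> e)" "\<gamma> x * t x = - (\<nu> x \<bullet> e')"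
      using \<gamma>_pos[OF that] by (simp_all add: s_def t_def)
    then have "\<gamma> x *\<^sub>R (n - s x *\<^sub>R e - t x *\<^sub>R e') = (\<nu> x \<bullet> e) *\<^sub>R e + (\<nu> x \<bullet> e') *\<^sub>R e' + \<gamma> x *\<^sub>R n"
      by (simp add: scaleR_diff_right)
    then show ?thesis
      using frame(4)[of "\<nu> x"] by (simp add: \<gamma>_def)
  qed
  have D_ab: "(a has_derivative (\<lambda>v. ?Df x v \<bullet> e)) (at x)" "(b has_derivative (\<lambda>v. ?Df x v \<bullet> e')) (at x)"
      "(w has_derivative (\<lambda>v. ?Df x v \<bullet> n)) (at x)" if "x \<in> U" for x
    unfolding a_def[abs_def] b_def[abs_def] w_def[abs_def]
    by (rule has_derivative_inner_left[OF Df[OF that]])+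
  have contact: "?Df x v \<bullet> n = s x * (?Df x v \<bullet> e) + t x * (?Df x v \<bullet> e')" if x: "x \<in> U0" for x v
  proof -
    have "\<gamma> x * (?Df x v \<bullet> n - s x * (?Df x v \<bullet> e) - t x * (?Df x v \<bullet> e')) = ?Df x v \<bullet> \<nu> x"
      unfolding \<nu>_eq[OF x] by (simp add: inner_diff_right)
    also have "\<dots> = 0" using normal x U0(3) by blast
    finally show ?thesis
      using \<gamma>_pos[OF x] by simp
  qed
  \<comment> \<open>\<open>a\<close> and \<open>t\<close> are coordinates of the source.\<close>
  define \<theta> where "\<theta> x = pt (a x) (t x)" for x
  have \<theta>: "smooth_on \<theta> U0"
    unfolding \<theta>_def[abs_def] by (intro smooth_on_pt a t U0(1))
  have Dt: "frechet_derivative t (at p) v = - (?D\<nu> p v \<bullet> e')" for v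
  proof -
    have "((\<lambda>x. \<nu> x \<bullet> e') has_derivative (\<lambda>v. ?D\<nu> p v \<bullet> e')) (at p)"
      by (rule has_derivative_inner_left[OF D\<nu>[OF p]])
    then have "((\<lambda>x. - (\<nu> x \<bullet> e')) has_derivative (\<lambda>v. - (?D\<nu> p v \<bullet> e'))) (at p)"
      by (rule has_derivative_minus)
    then have "((\<lambda>x. t x * \<gamma> x) has_derivative (\<lambda>v. - (?D\<nu> p v \<bullet> e'))) (at p)"
      by (rule has_derivative_transform_within_open[OF _ U0(1,2)]) (use \<gamma>_pos in \<open>force simp: t_def\<close>)
    moreover have "((\<lambda>x. t x * \<gamma> x) has_derivative
        (\<lambda>v. t p * frechet_derivative \<gamma> (at p) v + frechet_derivative t (at p) v * \<gamma> p)) (at p)"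
      by (intro has_derivative_mult smooth_on_has_derivative[OF t U0(2)] smooth_on_has_derivative[OF \<gamma> U0(2)])
    ultimately have "(\<lambda>v. - (?D\<nu> p v \<bullet> e')) =
        (\<lambda>v. t p * frechet_derivative \<gamma> (at p) v + frechet_derivative t (at p) v * \<gamma> p)"
      by (rule has_derivative_unique)
    from fun_cong[OF this, of v] show ?thesis
      by (simp add: at_p)
  qed
  have D\<theta>: "(\<theta> has_derivative (\<lambda>v. pt (?Df p v \<bullet> e) (frechet_derivative t (at p) v))) (at p)"
    unfolding \<theta>_def[abs_def]
    by (intro has_derivative_pt D_ab p smooth_on_has_derivative[OF t U0(2)])
  have "surj (\<lambda>v. pt (?Df p v \<bullet> e) (frechet_derivative t (at p) v))"
  proof (rule surjI)
    fix y :: "real^2"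
    let ?\<alpha> = "y $ 1 / (?Df p \<eta> \<bullet> e)"
    let ?\<beta> = "(y $ 2 - ?\<alpha> * frechet_derivative t (at p) \<eta>) / frechet_derivative t (at p) \<xi>"
    have lin_t: "linear (frechet_derivative t (at p))"
      using smooth_on_has_derivative[OF t U0(2)] has_derivative_linear by blast
    have "?Df p \<eta> \<bullet> e \<noteq> 0"
      using \<eta> by (simp add: e_def)
    moreover have "frechet_derivative t (at p) \<xi> \<noteq> 0"
      using D\<nu>_\<xi>(2) by (simp add: Dt)
    moreover have "?Df p \<xi> \<bullet> e = 0"
      using \<xi>(1) by simp
    ultimately show "pt (?Df p (?\<alpha> *\<^sub>R \<eta> + ?\<beta> *\<^sub>R \<xi>) \<bullet> e) (frechet_derivative t (at p) (?\<alpha> *\<^sub>R \<eta> + ?\<beta> *\<^sub>R \<xi>)) = y"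
      by (simp add: vec_eq_iff forall_2 linear_add[OF lin] linear_cmul[OF lin]
          linear_add[OF lin_t] linear_cmul[OF lin_t] inner_add_left)
  qed
  then have "diffeo_germ \<theta> p (\<theta> p)"
    using frechet_derivative_at[OF D\<theta>, symmetric] by (intro smooth_inverse_function[OF U0(1,2) \<theta>]) simp
  then have \<theta>_germ: "diffeo_germ \<theta> p 0"
    by (simp add: \<theta>_def at_p)
  then obtain V W \<zeta> where VW: "open V" "open W" "p \<in> V" "0 \<in> W" "\<zeta> 0 = p" "smooth_on \<zeta> W"
    and \<theta>_inv: "\<forall>x\<in>V. \<theta> x \<in> W \<and> \<zeta> (\<theta> x) = x" and \<zeta>_inv: "\<forall>y\<in>W. \<zeta> y \<in> V \<and> \<theta> (\<zeta> y) = y"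
    and \<theta>V: "smooth_on \<theta> V"
    using diffeo_germD[OF \<theta>_germ] by blast
  define N where "N = W \<inter> \<zeta> -` U0"
  have N: "open N" "0 \<in> N"
    unfolding N_def using VW U0 continuous_open_preimage[OF smooth_on_continuous[OF VW(6)] VW(2) U0(1)]
    by auto
  have \<zeta>: "smooth_on \<zeta> N" and \<zeta>_U0: "\<And>y. y \<in> N \<Longrightarrow> \<zeta> y \<in> U0"
    using smooth_on_subset[OF VW(6)] by (auto simp: N_def)
  have a_\<zeta>: "a (\<zeta> y) = y $ 1" and t_\<zeta>: "t (\<zeta> y) = y $ 2" if "y \<in> N" for y
  proof -
    have "pt (a (\<zeta> y)) (t (\<zeta> y)) = y"
      using \<zeta>_inv that by (simp add: N_def \<theta>_def)
    from arg_cong[OF this, of "\<lambda>v. v $ 1"] arg_cong[OF this, of "\<lambda>v. v $ 2"]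
    show "a (\<zeta> y) = y $ 1" "t (\<zeta> y) = y $ 2" by simp_all
  qed
  define S where "S y = s (\<zeta> y)" for y
  define K where "K y = k (\<zeta> y)" for y
  define b' where "b' y = b (\<zeta> y)" for y
  define w' where "w' y = w (\<zeta> y)" for y
  have S: "smooth_on S N" and K: "smooth_on K N" and b': "smooth_on b' N" and w': "smooth_on w' N"
    unfolding S_def[abs_def] K_def[abs_def] b'_def[abs_def] w'_def[abs_def]
    by (rule smooth_on_compose[OF _ \<zeta> N(1) U0(1)], fact, fact \<zeta>_U0)+
  have Dw': "frechet_derivative w' (at y) v = S y * v $ 1 + y $ 2 * frechet_derivative b' (at y) v"
    if y: "y \<in> N" for y v
  proof -
    let ?D\<zeta> = "frechet_derivative \<zeta> (at y)"
    note D\<zeta> = smooth_on_has_derivative[OF \<zeta> y]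
    have yU: "\<zeta> y \<in> U" using \<zeta>_U0[OF y] U0(3) by blast
    have "((\<lambda>y. a (\<zeta> y)) has_derivative (\<lambda>v. ?Df (\<zeta> y) (?D\<zeta> v) \<bullet> e)) (at y)"
      using diff_chain_at[OF D\<zeta> D_ab(1)[OF yU]] by (simp add: o_def)
    then have "((\<lambda>y. y $ 1) has_derivative (\<lambda>v. ?Df (\<zeta> y) (?D\<zeta> v) \<bullet> e)) (at y)"
      by (rule has_derivative_transform_within_open[OF _ N(1) y]) (simp add: a_\<zeta>)
    from has_derivative_unique[OF this has_derivative_nth[OF has_derivative_ident]]
    have 1: "?Df (\<zeta> y) (?D\<zeta> v) \<bullet> e = v $ 1" by metis
    have "(b' has_derivative (\<lambda>v. ?Df (\<zeta> y) (?D\<zeta> v) \<bullet> e')) (at y)"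
      using diff_chain_at[OF D\<zeta> D_ab(2)[OF yU]] by (simp add: o_def b'_def[abs_def])
    from frechet_derivative_at[OF this, symmetric]
    have 2: "?Df (\<zeta> y) (?D\<zeta> v) \<bullet> e' = frechet_derivative b' (at y) v" by simp
    have "(w' has_derivative (\<lambda>v. ?Df (\<zeta> y) (?D\<zeta> v) \<bullet> n)) (at y)"
      using diff_chain_at[OF D\<zeta> D_ab(3)[OF yU]] by (simp add: o_def w'_def[abs_def])
    from frechet_derivative_at[OF this, symmetric]
    have "frechet_derivative w' (at y) v = ?Df (\<zeta> y) (?D\<zeta> v) \<bullet> n" by simp
    then show ?thesis
      unfolding contact[OF \<zeta>_U0[OF y]] 1 2 t_\<zeta>[OF y] S_def .
  qed
  have K_eq: "K y = S y * y $ 1 + y $ 2 * b' y - w' y" if "y \<in> N" for y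
    using that by (simp add: K_def k_def S_def b'_def w'_def a_\<zeta> t_\<zeta>)
  have KS: "pd1 K y = y $ 1 * pd1 S y" if y: "y \<in> N" for y
  proof -
    have "((\<lambda>y. S y * y $ 1 + y $ 2 * b' y - w' y) has_derivative
        (\<lambda>v. S y * v $ 1 + frechet_derivative S (at y) v * y $ 1
          + (y $ 2 * frechet_derivative b' (at y) v + v $ 2 * b' y) - frechet_derivative w' (at y) v)) (at y)"
      by (intro has_derivative_diff has_derivative_add has_derivative_mult has_derivative_nth has_derivative_ident
          smooth_on_has_derivative[OF S y] smooth_on_has_derivative[OF b' y] smooth_on_has_derivative[OF w' y])
    then have "(K has_derivative
        (\<lambda>v. S y * v $ 1 + frechet_derivative S (at y) v * y $ 1
          + (y $ 2 * frechet_derivative b' (at y) v + v $ 2 * b' y) - frechet_derivative w' (at y) v)) (at y)"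
      by (rule has_derivative_transform_within_open[OF _ N(1) y]) (simp add: K_eq)
    from frechet_derivative_at[OF this, symmetric] show ?thesis
      by (simp add: Dw'[OF y] axis_def)
  qed
  \<comment> \<open>On the first axis, where \<open>t = 0\<close>, the gradient of \<open>w'\<close> is \<open>(S, 0)\<close>.\<close>
  obtain \<sigma> :: real and \<phi> :: "real^2 \<Rightarrow> real^2" where \<sigma>: "\<bar>\<sigma>\<bar> = 1" and \<phi>: "diffeo_germ \<phi> p 0"
    and D4: "\<forall>\<^sub>F x in nhds p. w x = (\<phi> x $ 1) ^ 3 + \<sigma> * (\<phi> x $ 1 * (\<phi> x $ 2)\<^sup>2)"
  proof -
    have h: "(f x + c) \<bullet> \<nu> p - (f p + c) \<bullet> \<nu> p = w x" for x
      using assms(4) by (simp add: w_def n_def inner_add_left)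
    from assms(7) show thesis
      unfolding D4_singularity_at_def h right_equiv_def
    proof (elim disjE exE conjE)
      fix \<phi> :: "real^2 \<Rightarrow> real^2" assume "diffeo_germ \<phi> p 0"
        and "\<forall>\<^sub>F x in nhds p. w x = (\<phi> x $ 1) ^ 3 + \<phi> x $ 1 * (\<phi> x $ 2)\<^sup>2"
      then show thesis using that[of 1 \<phi>] by simp
    next
      fix \<phi> :: "real^2 \<Rightarrow> real^2" assume "diffeo_germ \<phi> p 0"
        and "\<forall>\<^sub>F x in nhds p. w x = (\<phi> x $ 1) ^ 3 - \<phi> x $ 1 * (\<phi> x $ 2)\<^sup>2"
      then show thesis using that[of "- 1" \<phi>] by simp
    qed
  qed
  have \<zeta>_germ: "diffeo_germ \<zeta> 0 p"
    using VW \<theta>V \<theta>_inv \<zeta>_inv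
    by (intro diffeo_germI[of W V 0 \<zeta> p \<theta>]) auto
  have "\<forall>\<^sub>F y in nhds 0. w (\<zeta> y) = (\<phi> (\<zeta> y) $ 1) ^ 3 + \<sigma> * (\<phi> (\<zeta> y) $ 1 * (\<phi> (\<zeta> y) $ 2)\<^sup>2)"
    by (rule eventually_compose_filterlim[OF D4 diffeo_germ_filterlim[OF \<zeta>_germ]])
  then obtain M where M: "open M" "0 \<in> M"
    "\<forall>y\<in>M. w (\<zeta> y) = (\<phi> (\<zeta> y) $ 1) ^ 3 + \<sigma> * (\<phi> (\<zeta> y) $ 1 * (\<phi> (\<zeta> y) $ 2)\<^sup>2)"
    unfolding eventually_nhds by blast
  have S_order: "pd1 S 0 = 0" "pd1 (pd1 S) 0 \<noteq> 0"
  proof -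
    have grad: "pd1 w' (pt u 0) = S (pt u 0) \<and> pd2 w' (pt u 0) = 0" if "pt u 0 \<in> N \<inter> M" for u
      using Dw'[of "pt u 0"] that by (simp add: axis_def)
    note * = D4_second_order_zero[OF \<sigma> diffeo_germ_compose[OF \<zeta>_germ \<phi>] open_Int[OF N(1) M(1)], of w' S]
    show "pd1 S 0 = 0"
      by (rule *(1)) (use N M grad smooth_on_subset[OF w'] smooth_on_subset[OF S] in \<open>auto simp: w'_def[symmetric]\<close>)
    show "pd1 (pd1 S) 0 \<noteq> 0"
      by (rule *(2)) (use N M grad smooth_on_subset[OF w'] smooth_on_subset[OF S] in \<open>auto simp: w'_def[symmetric]\<close>)
  qed
  let ?g = "\<lambda>y :: real^2. vector [y $ 2, S y, K y] :: real^3"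
  have cusp: "cuspidal_edge_at ?g 0"
    by (rule cuspidal_edge_normal_form[OF N S K KS S_order])
  have c: "c \<bullet> n \<noteq> 0"
    using assms(6) by (simp add: n_def inner_commute)
  obtain \<Phi> where \<Phi>: "diffeo_germ \<Phi> ((c \<bullet> n) *\<^sub>R n) 0"
    and \<Phi>_inv: "\<forall>z. c \<bullet> n - z $ 3 - z $ 2 * (c \<bullet> e) - z $ 1 * (c \<bullet> e') \<noteq> 0 \<longrightarrow> \<Phi> (pedal_chart n e e' c z) = z"
    using pedal_chart_inverse[OF n(1) e(1) frame(1) e(2) frame(2,3) frame(4) c] by blast
  let ?f' = "dual_surface f \<nu> c"
  have dual_eq: "\<Phi> (?f' x) = vector [t x, s x, k x]" if x: "x \<in> U0" "(f x + c) \<bullet> \<nu> x \<noteq> 0" for x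
  proof -
    let ?q = "c \<bullet> n - k x - s x * (c \<bullet> e) - t x * (c \<bullet> e')"
    have \<rho>: "(f x + c) \<bullet> \<nu> x = \<gamma> x * ?q"
      unfolding \<nu>_eq[OF x(1)]
      by (simp add: inner_diff_right inner_add_left k_def a_def b_def w_def algebra_simps)
    have "\<nu> x \<bullet> \<nu> x = 1"
      using unit x(1) U0(3) by (auto simp: norm_eq_1)
    moreover have "\<nu> x \<bullet> \<nu> x = (\<gamma> x)\<^sup>2 * (1 + (s x)\<^sup>2 + (t x)\<^sup>2)"
    proof -
      have ee: "e \<bullet> e = 1" "e' \<bullet> e' = 1"
        using e(1) frame(1) by (simp_all add: norm_eq_1)
      have "(n - s x *\<^sub>R e - t x *\<^sub>R e') \<bullet> (n - s x *\<^sub>R e - t x *\<^sub>R e') = 1 + (s x)\<^sup>2 + (t x)\<^sup>2"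
        using ee n(2) e(2) frame(2,3)
        by (simp add: inner_diff_left inner_diff_right inner_commute[of e n] inner_commute[of e' n]
            inner_commute[of e' e] power2_eq_square)
      then show ?thesis
        unfolding \<nu>_eq[OF x(1)] by (simp add: power2_eq_square)
    qed
    ultimately have "(\<gamma> x)\<^sup>2 = 1 / (1 + (s x)\<^sup>2 + (t x)\<^sup>2)"
      by (metis eq_divide_imp mult_zero_right zero_neq_one)
    moreover have "?f' x = ((\<gamma> x)\<^sup>2 * ?q) *\<^sub>R (n - s x *\<^sub>R e - t x *\<^sub>R e')"
      using arg_cong[OF \<nu>_eq[OF x(1)], of "\<lambda>v. (\<gamma> x * ?q) *\<^sub>R v"]
      by (simp add: dual_surface_def \<rho> power2_eq_square mult_ac)
    ultimately have "?f' x = (?q / (1 + (s x)\<^sup>2 + (t x)\<^sup>2)) *\<^sub>R (n - s x *\<^sub>R e - t x *\<^sub>R e')"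
      by simp
    also have "\<dots> = pedal_chart n e e' c (vector [t x, s x, k x])"
      by (simp add: pedal_chart_def vector_3)
    finally have "\<Phi> (?f' x) = \<Phi> (pedal_chart n e e' c (vector [t x, s x, k x]))"
      by simp
    moreover have "?q \<noteq> 0"
      using x(2) \<rho> by auto
    ultimately show ?thesis
      using \<Phi>_inv by (simp add: vector_3)
  qed
  have "germ_equiv ?f' p ?g 0"
    unfolding germ_equiv_def
  proof (intro exI conjI)
    show "diffeo_germ \<theta> p 0" by (rule \<theta>_germ)
    have "?f' p = (c \<bullet> n) *\<^sub>R n"
      by (simp add: dual_surface_def assms(4) n_def)
    moreover have "S 0 = 0" "K 0 = 0"
      using VW(5) at_p by (simp_all add: S_def K_def k_def)
    then have "?g 0 = 0"
      by (simp add: vec_eq_iff forall_3 vector_3)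
    ultimately show "diffeo_germ \<Phi> (?f' p) (?g 0)"
      using \<Phi> by simp
    have "open (U0 \<inter> (\<lambda>x. (f x + c) \<bullet> \<nu> x) -` (- {0}))"
      by (rule continuous_open_preimage[OF _ U0(1)])
        (auto intro!: continuous_intros smooth_on_continuous[OF f0] smooth_on_continuous[OF \<nu>0])
    moreover have "p \<in> U0 \<inter> (\<lambda>x. (f x + c) \<bullet> \<nu> x) -` (- {0})"
      using U0(2) c by (simp add: assms(4) flip: n_def)
    ultimately have "\<forall>\<^sub>F x in nhds p. x \<in> U0 \<inter> (\<lambda>x. (f x + c) \<bullet> \<nu> x) -` (- {0})"
      by (rule eventually_nhds_in_open)
    moreover have "\<forall>\<^sub>F x in nhds p. x \<in> V"
      by (rule eventually_nhds_in_open[OF VW(1,3)])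
    ultimately show "\<forall>\<^sub>F x in nhds p. \<Phi> (?f' x) = ?g (\<theta> x)"
    proof eventually_elim
      case (elim x)
      then have "\<Phi> (?f' x) = vector [t x, s x, k x]"
        by (intro dual_eq) auto
      moreover have "\<zeta> (\<theta> x) = x" "\<theta> x $ 2 = t x"
        using elim \<theta>_inv by (auto simp: \<theta>_def)
      ultimately show ?case
        by (simp add: S_def K_def)
    qed
  qed
  then show ?thesis
    using cusp germ_equiv_trans unfolding cuspidal_edge_at_def by blast
qed

end
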